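(* Let $F$ be a free $k$-pluriharmonic function on the regular polyball $\mathbf B_{\mathbf n}$, with coefficients in $B(\mathcal E)$, $\mathcal E$ a Hilbert space. Then $F$ is positive on $\mathbf B_{\mathbf n}$ if and only if the kernel $\Gamma_{F_r}$ is positive semi-definite for any $r\in[0,1)$, where $F_r$ stands for the mapping $\mathbf X\mapsto F(r\mathbf X)$.
   Context: Let $k\ge1$, $\mathbf n=(n_1,\dots,n_k)$ with $n_i\in\{1,2,\dots\}$, let $\mathbb F_{n_i}^+$ be the unital free semigroup with generators $g^i_1,\dots,g^i_{n_i}$ and identity $g^i_0$, with length function $|\cdot|$, and $\mathbf F^+_{\mathbf n}:=\mathbb F_{n_1}^+\times\cdots\times\mathbb F_{n_k}^+$. For operators $X_{i,1},\dots,X_{i,n_i}$ and $\alpha=g^i_{j_1}\cdots g^i_{j_p}$ put $X_{i,\alpha}=X_{i,j_1}\cdots X_{i,j_p}$, $X_{i,g^i_0}=I$; $X_{i,\alpha}^*$ means $(X_{i,\alpha})^*$. For $m\in\mathbb Z$, $m^+=\max\{m,0\}$, $m^-=\max\{-m,0\}$. Regular polyball: $\mathbf B_{\mathbf n}(\mathcal H)$ is the set of $\mathbf X=(X_1,\dots,X_k)$, $X_i=(X_{i,1},\dots,X_{i,n_i})\in B(\mathcal H)^{n_i}$, such that the entries of $X_s$ commute with those of $X_t$ for $s\ne t$, $\|\sum_jX_{i,j}X_{i,j}^*\|<1$ for each $i$, and $\boldsymbol\Delta_{\mathbf X}(I)$ is positive and invertible, where $\boldsymbol\Delta_{\mathbf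 X}=(id-\Phi_{X_1})\circ\cdots\circ(id-\Phi_{X_k})$, $\Phi_{X_i}(Y)=\sum_jX_{i,j}YX_{i,j}^*$. A free $k$-pluriharmonic function on $\mathbf B_{\mathbf n}$ with coefficients in $B(\mathcal E)$ is a function of the form $$F(\mathbf X)=\sum_{m_1\in\mathbb Z}\cdots\sum_{m_k\in\mathbb Z}\ \sum_{\alpha_i,\beta_i\in\mathbb F_{n_i}^+,\ |\alpha_i|=m_i^-,\ |\beta_i|=m_i^+}A_{(\alpha_1,\dots,\alpha_k;\beta_1,\dots,\beta_k)}\otimes X_{1,\alpha_1}\cdots X_{k,\alpha_k}X_{1,\beta_1}^*\cdots X_{k,\beta_k}^*,$$ $A_{(\cdot;\cdot)}\in B(\mathcal E)$, the series converging in operator norm for every $\mathbf X\in\mathbf B_{\mathbf n}(\mathcal H)$ and every Hilbert space $\mathcal H$ (a series $\sum_{m\in\mathbb Z}$ converges if the parts over $m<0$ and $m\ge0$ do). $F$ is positive if $F(\mathbf X)\ge0$ for all such $\mathbf X$ and $\mathcal H$. Comparability: for $\omega,\gamma\in\mathbb F_n^+$ write $\gamma<_r\omega$ if $\omega=\sigma\gamma$ for some $\sigma\ne g_0$, and then $\omega\backslash_r\gamma:=\sigma$. For $\boldsymbol\omega,\boldsymbol\gamma\in\mathbf F^+_{\mathbf n}$ write $\boldsymbol\omega\sim_{rc}\boldsymbol\gamma$ if for each $i$ one of $\omega_i<_r\gamma_i$, $\gamma_i<_r\omega_i$, $\omega_i=\gamma_i$ holds; then $c_r^\pm(\boldsymbol\omega,\boldsymbol\gamma)=(c_r^\pm(\omega_1,\gamma_1),\dots,c_r^\pm(\omega_k,\gamma_k))$,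 where $c_r^+(\omega,\gamma)=\omega\backslash_r\gamma$ if $\gamma<_r\omega$ and $g_0$ otherwise, and $c_r^-(\omega,\gamma)=\gamma\backslash_r\omega$ if $\omega<_r\gamma$ and $g_0$ otherwise. The kernel $\Gamma_F:\mathbf F^+_{\mathbf n}\times\mathbf F^+_{\mathbf n}\to B(\mathcal E)$ associated with $F$ is $\Gamma_F(\boldsymbol\sigma,\boldsymbol\omega)=A_{(c_r^+(\boldsymbol\sigma,\boldsymbol\omega);c_r^-(\boldsymbol\sigma,\boldsymbol\omega))}$ if $\boldsymbol\sigma\sim_{rc}\boldsymbol\omega$ and $0$ otherwise (so $\Gamma_{F_r}$ uses the coefficients $r^{\sum_i(|\alpha_i|+|\beta_i|)}A_{(\alpha_1,\dots,\alpha_k;\beta_1,\dots,\beta_k)}$ of $F_r$). A kernel $\Gamma$ is positive semi-definite if $\sum_{i,j=1}^m\langle\Gamma(\boldsymbol\sigma^{(i)},\boldsymbol\sigma^{(j)})h_j,h_i\rangle\ge0$ for all $m\in\mathbb N$, $h_i\in\mathcal E$, $\boldsymbol\sigma^{(i)}\in\mathbf F^+_{\mathbf n}$. *)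

theory Defs
  imports "HOL-Analysis.Analysis" "HOL-Library.Function_Algebras" "HOL-Library.Sublist"
begin

section \<open>Hilbert spaces as objects\<close>

text \<open>
  The definitions below quantify over all Hilbert spaces, so a Hilbert space has to be a value
  and not a type. It is a linear subspace \<open>vectors H\<close> of the complex vector space
  \<open>'i \<Rightarrow> complex\<close> with an \<^emph>\<open>arbitrary\<close> complete inner product on it. The functions only serve
  as names of vectors: point evaluations need not be continuous, and the inner product has
  nothing to do with the values. Every Hilbert space is unitarily equivalent to one of this kind
  once \<open>'i\<close> is large enough, and for every infinite \<open>'i\<close> all separable ones occur.
\<close>

type_synonym 'i cfun = "'i \<Rightarrow> complex"
type_synonym 'i cop = "'i cfun \<Rightarrow> 'i cfun"

definition cscale :: "complex \<Rightarrow> 'i cfun \<Rightarrow> 'i cfun" (infixr "\<cdot>\<^sub>C" 75)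
  where "c \<cdot>\<^sub>C x = (\<lambda>i. c * x i)"

record 'i hilbert =
  vectors :: "'i cfun set"
  ip :: "'i cfun \<Rightarrow> 'i cfun \<Rightarrow> complex"

definition hnorm :: "'i hilbert \<Rightarrow> 'i cfun \<Rightarrow> real"
  where "hnorm H x = sqrt (Re (ip H x x))"

locale hilbert_space =
  fixes H :: "'i hilbert"
  assumes zero_closed: "0 \<in> vectors H"
    and add_closed: "\<lbrakk>x \<in> vectors H; y \<in> vectors H\<rbrakk> \<Longrightarrow> x + y \<in> vectors H"
    and scale_closed: "x \<in> vectors H \<Longrightarrow> c \<cdot>\<^sub>C x \<in> vectors H"
    and ip_add_left: "\<lbrakk>x \<in> vectors H; y \<in> vectors H; z \<in> vectors H\<rbrakk>
      \<Longrightarrow> ip H (x + y) z = ip H x z + ip H y z"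
    and ip_scale_left: "\<lbrakk>x \<in> vectors H; y \<in> vectors H\<rbrakk> \<Longrightarrow> ip H (c \<cdot>\<^sub>C x) y = c * ip H x y"
    and ip_commute: "\<lbrakk>x \<in> vectors H; y \<in> vectors H\<rbrakk> \<Longrightarrow> ip H y x = cnj (ip H x y)"
    and ip_nonneg: "x \<in> vectors H \<Longrightarrow> ip H x x \<in> \<real>\<^sub>\<ge>\<^sub>0"
    and ip_definite: "\<lbrakk>x \<in> vectors H; ip H x x = 0\<rbrakk> \<Longrightarrow> x = 0"
    and complete: "\<lbrakk>\<forall>n. s n \<in> vectors H;
        \<forall>e>0. \<exists>N. \<forall>m\<ge>N. \<forall>n\<ge>N. hnorm H (s m - s n) < e\<rbrakk>
      \<Longrightarrow> \<exists>x\<in>vectors H. (\<lambda>n. hnorm H (s n - x)) \<longlonglongrightarrow> 0"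

text \<open>
  An operator on \<open>H\<close> is represented by any function that has the right values on
  \<open>vectors H\<close>; values elsewhere never matter.
\<close>

definition bounded_op :: "'i hilbert \<Rightarrow> 'i cop \<Rightarrow> bool"
  where "bounded_op H T \<longleftrightarrow>
    (\<forall>x\<in>vectors H. T x \<in> vectors H) \<and>
    (\<forall>x\<in>vectors H. \<forall>y\<in>vectors H. T (x + y) = T x + T y) \<and>
    (\<forall>c. \<forall>x\<in>vectors H. T (c \<cdot>\<^sub>C x) = c \<cdot>\<^sub>C T x) \<and>
    (\<exists>C. \<forall>x\<in>vectors H. hnorm H (T x) \<le> C * hnorm H x)"

definition op_norm :: "'i hilbert \<Rightarrow> 'i cop \<Rightarrow> real"
  where "op_norm H T = (SUP x\<in>{x\<in>vectors H. hnorm H x \<le> 1}. hnorm H (T x))"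

definition adj :: "'i hilbert \<Rightarrow> 'i cop \<Rightarrow> 'i cop"
  where "adj H T y = (THE z. z \<in> vectors H \<and> (\<forall>x\<in>vectors H. ip H (T x) y = ip H x z))"

definition positive_op :: "'i hilbert \<Rightarrow> 'i cop \<Rightarrow> bool"
  where "positive_op H T \<longleftrightarrow> (\<forall>x\<in>vectors H. ip H (T x) x \<in> \<real>\<^sub>\<ge>\<^sub>0)"

definition invertible_op :: "'i hilbert \<Rightarrow> 'i cop \<Rightarrow> bool"
  where "invertible_op H T \<longleftrightarrow>
    (\<exists>S. bounded_op H S \<and> (\<forall>x\<in>vectors H. S (T x) = x \<and> T (S x) = x))"

definition op_prod :: "('a \<Rightarrow> 'a) list \<Rightarrow> ('a \<Rightarrow> 'a)"
  where "op_prod Ts = foldr (\<circ>) Ts id"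


section \<open>Hilbert tensor products\<close>

text \<open>
  \<open>hilbert_tensor E H K \<tau>\<close> says that \<open>K\<close> with \<open>\<tau> e h\<close> in the role of the elementary tensor of
  \<open>e\<close> and \<open>h\<close> is a Hilbert tensor product of \<open>E\<close> and \<open>H\<close>: this determines \<open>(K, \<tau>)\<close> up to
  unitary equivalence (bilinearity of \<open>\<tau>\<close> follows from the inner product formula). The index type
  of \<open>K\<close> consists of pairs of vectors, so that a model always exists in it, namely the reproducing
  kernel Hilbert space of the kernel \<open>ip E e e' * ip H h h'\<close>.
\<close>

type_synonym ('e, 'h) tensor_index = "'e cfun \<times> 'h cfun"

definition hilbert_tensor ::
    "'e hilbert \<Rightarrow> 'h hilbert \<Rightarrow> ('e, 'h) tensor_index hilbert
      \<Rightarrow> ('e cfun \<Rightarrow> 'h cfun \<Rightarrow> ('e, 'h) tensor_index cfun) \<Rightarrow> bool"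
  where "hilbert_tensor E H K \<tau> \<longleftrightarrow>
    hilbert_space K \<and>
    (\<forall>e\<in>vectors E. \<forall>h\<in>vectors H. \<tau> e h \<in> vectors K) \<and>
    (\<forall>e\<in>vectors E. \<forall>e'\<in>vectors E. \<forall>h\<in>vectors H. \<forall>h'\<in>vectors H.
      ip K (\<tau> e h) (\<tau> e' h') = ip E e e' * ip H h h') \<and>
    (\<forall>u\<in>vectors K. \<forall>\<epsilon>>0. \<exists>(N::nat) e h.
      (\<forall>p<N. e p \<in> vectors E \<and> h p \<in> vectors H) \<and> hnorm K (u - (\<Sum>p<N. \<tau> (e p) (h p))) < \<epsilon>)"

text \<open>The operator \<open>A \<otimes> X\<close>; it is unique on \<open>vectors K\<close>.\<close>

definition op_tensor ::
    "'e hilbert \<Rightarrow> 'h hilbert \<Rightarrow> ('e, 'h) tensor_index hilbert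
      \<Rightarrow> ('e cfun \<Rightarrow> 'h cfun \<Rightarrow> ('e, 'h) tensor_index cfun)
      \<Rightarrow> 'e cop \<Rightarrow> 'h cop \<Rightarrow> ('e, 'h) tensor_index cop"
  where "op_tensor E H K \<tau> A X = (SOME T. bounded_op K T \<and>
    (\<forall>e\<in>vectors E. \<forall>h\<in>vectors H. T (\<tau> e h) = \<tau> (A e) (X h)))"


section \<open>The regular polyball\<close>

text \<open>
  The tuple \<open>(n\<^sub>1, \<dots>, n\<^sub>k)\<close> is a list \<open>ns\<close> with \<open>k = length ns\<close>. All indices start at \<open>0\<close>: the
  operators are \<open>X i j\<close> for \<open>i < length ns\<close> and \<open>j < ns ! i\<close>, and the generators of the \<open>i\<close>-th
  free semigroup are the numbers below \<open>ns ! i\<close>, its elements being lists of these with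
  concatenation as product.
\<close>

definition \<Phi> :: "'i hilbert \<Rightarrow> nat \<Rightarrow> (nat \<Rightarrow> 'i cop) \<Rightarrow> 'i cop \<Rightarrow> 'i cop"
  where "\<Phi> H n Z Y = (\<Sum>j<n. Z j \<circ> Y \<circ> adj H (Z j))"

definition \<Delta> :: "'i hilbert \<Rightarrow> nat list \<Rightarrow> (nat \<Rightarrow> nat \<Rightarrow> 'i cop) \<Rightarrow> 'i cop \<Rightarrow> 'i cop"
  where "\<Delta> H ns X = op_prod (map (\<lambda>i Y. Y - \<Phi> H (ns ! i) (X i) Y) [0..<length ns])"

definition polyball :: "nat list \<Rightarrow> 'i hilbert \<Rightarrow> (nat \<Rightarrow> nat \<Rightarrow> 'i cop) set"
  where "polyball ns H = {X.
    (\<forall>i<length ns. \<forall>j<ns ! i. bounded_op H (X i j)) \<and>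
    (\<forall>s<length ns. \<forall>t<length ns. s \<noteq> t \<longrightarrow> (\<forall>p<ns ! s. \<forall>q<ns ! t. \<forall>x\<in>vectors H.
      X s p (X t q x) = X t q (X s p x))) \<and>
    (\<forall>i<length ns. op_norm H (\<Sum>j<ns ! i. X i j \<circ> adj H (X i j)) < 1) \<and>
    positive_op H (\<Delta> H ns X id) \<and> invertible_op H (\<Delta> H ns X id)}"

type_synonym multiword = "nat list list"

definition multiwords :: "nat list \<Rightarrow> multiword set"
  where "multiwords ns = listset (map (\<lambda>n. lists {..<n}) ns)"

definition word_op :: "(nat \<Rightarrow> 'i cop) \<Rightarrow> nat list \<Rightarrow> 'i cop"
  where "word_op Z w = op_prod (map Z w)"

text \<open>\<open>X\<^sub>1\<^sub>,\<^sub>\<alpha>\<^sub>1 \<cdots> X\<^sub>k\<^sub>,\<^sub>\<alpha>\<^sub>k X\<^sub>1\<^sub>,\<^sub>\<beta>\<^sub>1\<^sup>* \<cdots> X\<^sub>k\<^sub>,\<^sub>\<beta>\<^sub>k\<^sup>*\<close>\<close>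

definition monomial_op ::
    "'i hilbert \<Rightarrow> (nat \<Rightarrow> nat \<Rightarrow> 'i cop) \<Rightarrow> multiword \<Rightarrow> multiword \<Rightarrow> 'i cop"
  where "monomial_op H X \<alpha> \<beta> =
    op_prod (map (\<lambda>i. word_op (X i) (\<alpha> ! i)) [0..<length \<alpha>]) \<circ>
    op_prod (map (\<lambda>i. adj H (word_op (X i) (\<beta> ! i))) [0..<length \<beta>])"


section \<open>Free pluriharmonic functions\<close>

text \<open>A free pluriharmonic function is given by its family of coefficients.\<close>

type_synonym 'e coeffs = "multiword \<Rightarrow> multiword \<Rightarrow> 'e cop"

definition level_words :: "nat list \<Rightarrow> nat list \<Rightarrow> multiword set"
  where "level_words ns ps = {\<alpha> \<in> multiwords ns. map length \<alpha> = ps}"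

text \<open>For \<open>m :: int\<close>, \<open>nat m\<close> and \<open>nat (- m)\<close> are the positive and the negative part of \<open>m\<close>.\<close>

abbreviation neg_words :: "nat list \<Rightarrow> int list \<Rightarrow> multiword set"
  where "neg_words ns ms \<equiv> level_words ns (map (\<lambda>m. nat (- m)) ms)"

abbreviation pos_words :: "nat list \<Rightarrow> int list \<Rightarrow> multiword set"
  where "pos_words ns ms \<equiv> level_words ns (map nat ms)"

definition homogeneous_part ::
    "'e hilbert \<Rightarrow> 'h hilbert \<Rightarrow> ('e, 'h) tensor_index hilbert
      \<Rightarrow> ('e cfun \<Rightarrow> 'h cfun \<Rightarrow> ('e, 'h) tensor_index cfun)
      \<Rightarrow> nat list \<Rightarrow> 'e coeffs \<Rightarrow> (nat \<Rightarrow> nat \<Rightarrow> 'h cop) \<Rightarrow> int list \<Rightarrow> ('e, 'h) tensor_index cop"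
  where "homogeneous_part E H K \<tau> ns A X ms =
    (\<Sum>\<alpha>\<in>neg_words ns ms. \<Sum>\<beta>\<in>pos_words ns ms.
      op_tensor E H K \<tau> (A \<alpha> \<beta>) (monomial_op H X \<alpha> \<beta>))"

definition op_sums :: "'i hilbert \<Rightarrow> (nat \<Rightarrow> 'i cop) \<Rightarrow> 'i cop \<Rightarrow> bool"
  where "op_sums K U T \<longleftrightarrow> bounded_op K T \<and> (\<lambda>p. op_norm K ((\<Sum>q<p. U q) - T)) \<longlonglongrightarrow> 0"

definition int_op_sums :: "'i hilbert \<Rightarrow> (int \<Rightarrow> 'i cop) \<Rightarrow> 'i cop \<Rightarrow> bool"
  where "int_op_sums K U T \<longleftrightarrow> (\<exists>R S. op_sums K (\<lambda>p. U (- int (Suc p))) R \<and>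
    op_sums K (\<lambda>p. U (int p)) S \<and> T = R + S)"

text \<open>
  \<open>iterated_op_sums K k G T\<close>: the iterated series of \<open>G [m\<^sub>1, \<dots>, m\<^sub>k]\<close>, the sum over \<open>m\<^sub>1\<close> being
  the outermost one, converges to \<open>T\<close>.
\<close>

primrec iterated_op_sums ::
    "'i hilbert \<Rightarrow> nat \<Rightarrow> (int list \<Rightarrow> 'i cop) \<Rightarrow> 'i cop \<Rightarrow> bool"
  where
    "iterated_op_sums K 0 G T \<longleftrightarrow> T = G []"
  | "iterated_op_sums K (Suc k) G T \<longleftrightarrow>
      (\<exists>U. (\<forall>m. iterated_op_sums K k (\<lambda>ms. G (m # ms)) (U m)) \<and> int_op_sums K U T)"

text \<open>\<open>represents E H K \<tau> ns A X T\<close>: the series for \<open>F(X)\<close> converges to the operator \<open>T\<close>.\<close>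

definition represents ::
    "'e hilbert \<Rightarrow> 'h hilbert \<Rightarrow> ('e, 'h) tensor_index hilbert
      \<Rightarrow> ('e cfun \<Rightarrow> 'h cfun \<Rightarrow> ('e, 'h) tensor_index cfun)
      \<Rightarrow> nat list \<Rightarrow> 'e coeffs \<Rightarrow> (nat \<Rightarrow> nat \<Rightarrow> 'h cop) \<Rightarrow> ('e, 'h) tensor_index cop \<Rightarrow> bool"
  where "represents E H K \<tau> ns A X T \<longleftrightarrow>
    iterated_op_sums K (length ns) (homogeneous_part E H K \<tau> ns A X) T"

definition ph_eval ::
    "'e hilbert \<Rightarrow> 'h hilbert \<Rightarrow> ('e, 'h) tensor_index hilbert
      \<Rightarrow> ('e cfun \<Rightarrow> 'h cfun \<Rightarrow> ('e, 'h) tensor_index cfun)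
      \<Rightarrow> nat list \<Rightarrow> 'e coeffs \<Rightarrow> (nat \<Rightarrow> nat \<Rightarrow> 'h cop) \<Rightarrow> ('e, 'h) tensor_index cop"
  where "ph_eval E H K \<tau> ns A X = (SOME T. represents E H K \<tau> ns A X T)"

text \<open>
  The type argument \<open>'h\<close> is the index type of the Hilbert spaces \<open>H\<close> quantified over.
\<close>

definition free_pluriharmonic ::
    "'h itself \<Rightarrow> nat list \<Rightarrow> 'e hilbert \<Rightarrow> 'e coeffs \<Rightarrow> bool"
  where "free_pluriharmonic _ ns E A \<longleftrightarrow>
    (\<forall>ms. length ms = length ns \<longrightarrow>
      (\<forall>\<alpha>\<in>neg_words ns ms. \<forall>\<beta>\<in>pos_words ns ms. bounded_op E (A \<alpha> \<beta>))) \<and>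
    (\<forall>(H :: 'h hilbert) K \<tau> X.
      hilbert_space H \<and> hilbert_tensor E H K \<tau> \<and> X \<in> polyball ns H
      \<longrightarrow> (\<exists>T. represents E H K \<tau> ns A X T))"

definition ph_positive :: "'h itself \<Rightarrow> nat list \<Rightarrow> 'e hilbert \<Rightarrow> 'e coeffs \<Rightarrow> bool"
  where "ph_positive _ ns E A \<longleftrightarrow>
    (\<forall>(H :: 'h hilbert) K \<tau> X.
      hilbert_space H \<and> hilbert_tensor E H K \<tau> \<and> X \<in> polyball ns H
      \<longrightarrow> positive_op K (ph_eval E H K \<tau> ns A X))"

text \<open>The coefficients of \<open>X \<mapsto> F(rX)\<close>.\<close>

definition dilate :: "real \<Rightarrow> 'e coeffs \<Rightarrow> 'e coeffs"
  where "dilate r A \<alpha> \<beta> = (\<lambda>x. of_real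
    (r ^ (sum_list (map length \<alpha>) + sum_list (map length \<beta>))) \<cdot>\<^sub>C A \<alpha> \<beta> x)"


section \<open>The kernel of a free pluriharmonic function\<close>

text \<open>
  \<open>strict_suffix \<gamma> \<omega>\<close> holds iff \<open>\<omega> = \<sigma> @ \<gamma>\<close> for some \<open>\<sigma> \<noteq> []\<close>, that is \<open>\<gamma> <\<^sub>r \<omega>\<close>.
\<close>

definition rdiff :: "nat list \<Rightarrow> nat list \<Rightarrow> nat list"
  where "rdiff \<omega> \<gamma> = (THE \<sigma>. \<omega> = \<sigma> @ \<gamma>)"

definition rcomparable :: "multiword \<Rightarrow> multiword \<Rightarrow> bool"
  where "rcomparable = list_all2 (\<lambda>\<omega> \<gamma>. strict_suffix \<omega> \<gamma> \<or> strict_suffix \<gamma> \<omega> \<or> \<omega> = \<gamma>)"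

definition c_plus :: "nat list \<Rightarrow> nat list \<Rightarrow> nat list"
  where "c_plus \<omega> \<gamma> = (if strict_suffix \<gamma> \<omega> then rdiff \<omega> \<gamma> else [])"

definition c_minus :: "nat list \<Rightarrow> nat list \<Rightarrow> nat list"
  where "c_minus \<omega> \<gamma> = (if strict_suffix \<omega> \<gamma> then rdiff \<gamma> \<omega> else [])"

definition ph_kernel :: "'e coeffs \<Rightarrow> multiword \<Rightarrow> multiword \<Rightarrow> 'e cop"
  where "ph_kernel A \<sigma> \<omega> =
    (if rcomparable \<sigma> \<omega> then A (map2 c_plus \<sigma> \<omega>) (map2 c_minus \<sigma> \<omega>) else 0)"

definition psd_kernel ::
    "nat list \<Rightarrow> 'e hilbert \<Rightarrow> (multiword \<Rightarrow> multiword \<Rightarrow> 'e cop) \<Rightarrow> bool"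
  where "psd_kernel ns E \<Gamma> \<longleftrightarrow>
    (\<forall>(m::nat) \<sigma> h. (\<forall>i<m. \<sigma> i \<in> multiwords ns \<and> h i \<in> vectors E) \<longrightarrow>
      (\<Sum>i<m. \<Sum>j<m. ip E (\<Gamma> (\<sigma> i) (\<sigma> j) (h j)) (h i)) \<in> \<real>\<^sub>\<ge>\<^sub>0)"

end

theory Submission
  imports Defs
begin

text \<open>
  Let \<open>S\<close> be the tuple of creation operators on the Fock space with orthonormal basis
  \<open>\<delta>\<^sub>\<sigma>\<close>, indexed by multiwords. Then \<open>rS\<close> belongs to the polyball, and the matrix entries of
  \<open>F(rS)\<close> with respect to the vectors \<open>e \<otimes> \<delta>\<^sub>\<sigma>\<close> are those of the kernel of \<open>F\<^sub>r\<close>. Hence positivity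
  of \<open>F\<close> passes to the kernels.

  Conversely, a point of the polyball is \<open>rY\<close> with \<open>r < 1\<close> and \<open>D = \<Delta>\<^sub>Y(I) \<ge> 0\<close>, because these
  conditions are open. A telescoping sum gives \<open>\<langle>x, y\<rangle> = \<Sum>\<^sub>\<omega> \<langle>D Y\<^sub>\<omega>\<^sup>* x, Y\<^sub>\<omega>\<^sup>* y\<rangle>\<close>. It turns the quadratic
  form of \<open>F(rY)\<close> on elementary tensors into a sum over pairs of multiwords of the kernel of \<open>F\<^sub>r\<close>
  times a Gram kernel, whose finite sections are nonnegative by Schur's product theorem. For
  convergence, group the pairs by the lengths of their words: positive semidefiniteness bounds an
  off-diagonal block by the diagonal ones, these are summable by the telescoping sum, and the powers
  of \<open>r\<close> provide summability over the degrees \<open>m\<^sub>1, \<dots>, m\<^sub>k\<close>.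
\<close>

text \<open>
  As simp rules these would unfold sums of vectors, which are functions here, pointwise.
\<close>

lemmas fun_apply = plus_fun_apply zero_fun_apply minus_apply uminus_apply
declare fun_apply [simp del]

lemma cscale_apply: "(c \<cdot>\<^sub>C x) i = c * x i"
  by (simp add: cscale_def)

lemma cscale_algebra:
  "c \<cdot>\<^sub>C (x + y) = c \<cdot>\<^sub>C x + c \<cdot>\<^sub>C y" "c \<cdot>\<^sub>C (x - y) = c \<cdot>\<^sub>C x - c \<cdot>\<^sub>C y"
  "(c + d) \<cdot>\<^sub>C x = c \<cdot>\<^sub>C x + d \<cdot>\<^sub>C x" "c \<cdot>\<^sub>C d \<cdot>\<^sub>C x = (c * d) \<cdot>\<^sub>C x"
  by (simp_all add: cscale_def fun_eq_iff fun_apply algebra_simps)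

lemma cscale_units [simp]: "1 \<cdot>\<^sub>C x = x" "0 \<cdot>\<^sub>C x = 0" "c \<cdot>\<^sub>C 0 = 0" "(-1) \<cdot>\<^sub>C x = - x"
  by (simp_all add: cscale_def fun_eq_iff fun_apply)

lemma sum_fun_eval: "(\<Sum>i\<in>I. f i) x = (\<Sum>i\<in>I. f i x)"
  for f :: "'a \<Rightarrow> 'b \<Rightarrow> 'c::comm_monoid_add"
  by (induction I rule: infinite_finite_induct) (simp_all add: fun_apply)

lemma cscale_sum: "c \<cdot>\<^sub>C (\<Sum>i\<in>I. f i) = (\<Sum>i\<in>I. c \<cdot>\<^sub>C f i)"
  by (rule ext) (simp add: cscale_apply sum_fun_eval sum_distrib_left)

lemma nonneg_Reals_iff: "z \<in> \<real>\<^sub>\<ge>\<^sub>0 \<longleftrightarrow> Im z = 0 \<and> 0 \<le> Re z"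
  using complex_nonneg_Reals_iff by auto

section \<open>Sesquilinear forms\<close>

locale cspace =
  fixes V :: "'i cfun set"
  assumes V_zero: "0 \<in> V"
    and V_add: "\<lbrakk>x \<in> V; y \<in> V\<rbrakk> \<Longrightarrow> x + y \<in> V"
    and V_scale: "x \<in> V \<Longrightarrow> c \<cdot>\<^sub>C x \<in> V"
begin

lemma V_uminus: "x \<in> V \<Longrightarrow> - x \<in> V"
  using V_scale[of x "-1"] by simp

lemma V_diff: "\<lbrakk>x \<in> V; y \<in> V\<rbrakk> \<Longrightarrow> x - y \<in> V"
  using V_add[of x "- y"] V_uminus by simp

lemma V_sum: "(\<And>i. i \<in> I \<Longrightarrow> f i \<in> V) \<Longrightarrow> (\<Sum>i\<in>I. f i) \<in> V"
  by (induction I rule: infinite_finite_induct) (auto intro: V_zero V_add)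

lemmas V_intros = V_zero V_add V_scale V_uminus V_diff V_sum

end

locale sesq_form = cspace V for V :: "'i cfun set" +
  fixes b :: "'i cfun \<Rightarrow> 'i cfun \<Rightarrow> complex"
  assumes add_left: "\<lbrakk>x \<in> V; y \<in> V; z \<in> V\<rbrakk> \<Longrightarrow> b (x + y) z = b x z + b y z"
    and scale_left: "\<lbrakk>x \<in> V; y \<in> V\<rbrakk> \<Longrightarrow> b (c \<cdot>\<^sub>C x) y = c * b x y"
    and herm: "\<lbrakk>x \<in> V; y \<in> V\<rbrakk> \<Longrightarrow> b y x = cnj (b x y)"
begin

lemma add_right: "\<lbrakk>x \<in> V; y \<in> V; z \<in> V\<rbrakk> \<Longrightarrow> b z (x + y) = b z x + b z y"
  by (metis add_left herm V_add complex_cnj_add)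

lemma scale_right: "\<lbrakk>x \<in> V; y \<in> V\<rbrakk> \<Longrightarrow> b x (c \<cdot>\<^sub>C y) = cnj c * b x y"
  by (metis scale_left herm V_scale complex_cnj_mult)

lemma zero_left: "x \<in> V \<Longrightarrow> b 0 x = 0"
  using scale_left[of x x 0] by simp

lemma zero_right: "x \<in> V \<Longrightarrow> b x 0 = 0"
  using scale_right[of x x 0] by simp

lemma diff_left: "\<lbrakk>x \<in> V; y \<in> V; z \<in> V\<rbrakk> \<Longrightarrow> b (x - y) z = b x z - b y z"
  using add_left[of x "(-1) \<cdot>\<^sub>C y" z] scale_left[of y z "-1"] V_uminus by simp

lemma diff_right: "\<lbrakk>x \<in> V; y \<in> V; z \<in> V\<rbrakk> \<Longrightarrow> b z (x - y) = b z x - b z y"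
  using add_right[of x "(-1) \<cdot>\<^sub>C y" z] scale_right[of z y "-1"] V_uminus by simp

lemma sum_left:
  "\<lbrakk>\<And>i. i \<in> I \<Longrightarrow> f i \<in> V; z \<in> V\<rbrakk> \<Longrightarrow> b (\<Sum>i\<in>I. f i) z = (\<Sum>i\<in>I. b (f i) z)"
  by (induction I rule: infinite_finite_induct) (auto simp: zero_left add_left V_sum)

lemma sum_right:
  "\<lbrakk>\<And>i. i \<in> I \<Longrightarrow> f i \<in> V; z \<in> V\<rbrakk> \<Longrightarrow> b z (\<Sum>i\<in>I. f i) = (\<Sum>i\<in>I. b z (f i))"
  by (induction I rule: infinite_finite_induct) (auto simp: zero_right add_right V_sum)

lemma self_real: "x \<in> V \<Longrightarrow> b x x = of_real (Re (b x x))"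
  by (metis herm Reals_cnj_iff of_real_Re)

end

locale psd_form = sesq_form +
  assumes psd: "x \<in> V \<Longrightarrow> 0 \<le> Re (b x x)"
begin

lemma self_nonneg: "x \<in> V \<Longrightarrow> b x x \<in> \<real>\<^sub>\<ge>\<^sub>0"
  using psd[of x] by (subst self_real) simp_all

lemma Re_line:
  assumes "x \<in> V" "y \<in> V"
  shows "Re (b (x + c \<cdot>\<^sub>C y) (x + c \<cdot>\<^sub>C y)) =
    Re (b x x) + 2 * Re (cnj c * b x y) + (cmod c)\<^sup>2 * Re (b y y)"
proof -
  have "b (x + c \<cdot>\<^sub>C y) (x + c \<cdot>\<^sub>C y)
      = b x x + cnj c * b x y + c * cnj (b x y) + c * cnj c * b y y"
    using assms herm[of x y]
    by (simp add: add_left add_right scale_left scale_right V_add V_scale algebra_simps)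
  moreover have "Re (c * cnj (b x y)) = Re (cnj c * b x y)"
    by simp
  moreover have "Re (c * cnj c * b y y) = (cmod c)\<^sup>2 * Re (b y y)"
    by (simp add: complex_norm_square[symmetric] del: of_real_power)
  ultimately show ?thesis
    by simp
qed

lemma cauchy_schwarz:
  assumes "x \<in> V" "y \<in> V"
  shows "(cmod (b x y))\<^sup>2 \<le> Re (b x x) * Re (b y y)"
proof -
  define z where "z = sgn (b x y)"
  define t where "t = cmod (b x y)"
  have zt: "cnj z * b x y = of_real t"
  proof -
    have "cnj z * b x y = cnj (b x y) * b x y / of_real t"
      by (simp add: z_def t_def sgn_eq)
    also have "cnj (b x y) * b x y = of_real t * of_real t"
      using complex_norm_square[of "b x y"] by (simp add: t_def power2_eq_square mult.commute)
    finally show ?thesis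
      by (cases "t = 0") (auto simp: z_def t_def)
  qed
  have z1: "cmod z \<le> 1"
    by (simp add: z_def norm_sgn)
  have q: "0 \<le> Re (b x x) - 2 * s * t + s\<^sup>2 * Re (b y y)" for s
  proof -
    have "0 \<le> Re (b (x + (- of_real s * z) \<cdot>\<^sub>C y) (x + (- of_real s * z) \<cdot>\<^sub>C y))"
      using assms by (intro psd V_add V_scale)
    also have "\<dots> = Re (b x x) + 2 * Re (- of_real s * (cnj z * b x y)) + (cmod (- of_real s * z))\<^sup>2 * Re (b y y)"
      using assms by (subst Re_line) (simp_all add: algebra_simps)
    also have "\<dots> = Re (b x x) - 2 * s * t + s\<^sup>2 * (cmod z)\<^sup>2 * Re (b y y)"
      unfolding zt by (simp add: norm_mult power_mult_distrib)
    also have "\<dots> \<le> Re (b x x) - 2 * s * t + s\<^sup>2 * 1 * Re (b y y)"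
      using z1 psd[OF assms(2)]
      by (intro add_left_mono mult_right_mono mult_left_mono) (simp_all add: power_le_one)
    finally show ?thesis by simp
  qed
  show ?thesis
  proof (cases "Re (b y y) = 0")
    case True
    have "t = 0"
    proof (rule ccontr)
      assume "t \<noteq> 0"
      then have "t > 0" by (simp add: t_def)
      then show False
        using q[of "(Re (b x x) + 1) / (2 * t)"] True by simp
    qed
    then show ?thesis by (simp add: t_def True)
  next
    case False
    then have "Re (b y y) > 0" using psd[OF assms(2)] by simp
    then have "t\<^sup>2 \<le> Re (b x x) * Re (b y y)"
      using q[of "t / Re (b y y)"] by (simp add: field_simps power2_eq_square)
    then show ?thesis by (simp add: t_def)
  qed
qed

lemma cmod_le_half:
  assumes "x \<in> V" "y \<in> V"
  shows "cmod (b x y) \<le> (Re (b x x) + Re (b y y)) / 2"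
proof -
  have "(cmod (b x y))\<^sup>2 \<le> ((Re (b x x) + Re (b y y)) / 2)\<^sup>2"
    using cauchy_schwarz[OF assms] sum_squares_bound[of "Re (b x x)" "Re (b y y)"]
    by (simp add: power_divide power2_sum)
  then show ?thesis
    by (rule power2_le_imp_le) (use psd assms in \<open>simp add: add_nonneg_nonneg\<close>)
qed

lemma gram_psd:
  assumes "finite I" "\<And>i. i \<in> I \<Longrightarrow> v i \<in> V"
  shows "(\<Sum>i\<in>I. \<Sum>j\<in>I. cnj (c i) * c j * b (v j) (v i)) \<in> \<real>\<^sub>\<ge>\<^sub>0"
proof -
  have "b (\<Sum>j\<in>I. c j \<cdot>\<^sub>C v j) (\<Sum>i\<in>I. c i \<cdot>\<^sub>C v i)
      = (\<Sum>j\<in>I. b (c j \<cdot>\<^sub>C v j) (\<Sum>i\<in>I. c i \<cdot>\<^sub>C v i))"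
    using assms by (intro sum_left V_intros) auto
  also have "\<dots> = (\<Sum>j\<in>I. \<Sum>i\<in>I. b (c j \<cdot>\<^sub>C v j) (c i \<cdot>\<^sub>C v i))"
    using assms by (intro sum.cong refl sum_right V_intros) auto
  also have "\<dots> = (\<Sum>j\<in>I. \<Sum>i\<in>I. cnj (c i) * c j * b (v j) (v i))"
    using assms by (intro sum.cong refl) (simp add: scale_left scale_right V_scale)
  finally have "b (\<Sum>j\<in>I. c j \<cdot>\<^sub>C v j) (\<Sum>i\<in>I. c i \<cdot>\<^sub>C v i)
      = (\<Sum>j\<in>I. \<Sum>i\<in>I. cnj (c i) * c j * b (v j) (v i))" .
  moreover have "(\<Sum>i\<in>I. c i \<cdot>\<^sub>C v i) \<in> V"
    using assms by (intro V_intros)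
  ultimately show ?thesis
    using self_nonneg[of "\<Sum>i\<in>I. c i \<cdot>\<^sub>C v i"] by (subst sum.swap) simp
qed

end

section \<open>Hilbert spaces\<close>

context hilbert_space
begin

sublocale cspace "vectors H"
  by unfold_locales (rule zero_closed, rule add_closed, assumption+, rule scale_closed, assumption)

sublocale ip: psd_form "vectors H" "ip H"
proof
  show "\<And>x y. \<lbrakk>x \<in> vectors H; y \<in> vectors H\<rbrakk> \<Longrightarrow> ip H y x = cnj (ip H x y)"
    by (rule ip_commute)
qed (use ip_nonneg in \<open>auto simp: ip_add_left ip_scale_left nonneg_Reals_iff\<close>)

lemma hnorm_sq: "x \<in> vectors H \<Longrightarrow> (hnorm H x)\<^sup>2 = Re (ip H x x)"
  by (simp add: hnorm_def ip.psd)

lemma ip_self: "x \<in> vectors H \<Longrightarrow> ip H x x = of_real ((hnorm H x)\<^sup>2)"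
  using ip.self_real hnorm_sq by metis

lemma hnorm_nonneg: "x \<in> vectors H \<Longrightarrow> 0 \<le> hnorm H x"
  by (simp add: hnorm_def ip.psd)

lemma hnorm_zero [simp]: "hnorm H 0 = 0"
  by (simp add: hnorm_def ip.zero_left zero_closed)

lemma hnorm_eq_0: "x \<in> vectors H \<Longrightarrow> hnorm H x = 0 \<longleftrightarrow> x = 0"
  using ip_definite ip_self by fastforce

lemma ip_bound: "\<lbrakk>x \<in> vectors H; y \<in> vectors H\<rbrakk> \<Longrightarrow> cmod (ip H x y) \<le> hnorm H x * hnorm H y"
  by (rule power2_le_imp_le)
    (auto simp: power_mult_distrib hnorm_sq ip.cauchy_schwarz hnorm_nonneg)

lemma hnorm_scale: "x \<in> vectors H \<Longrightarrow> hnorm H (c \<cdot>\<^sub>C x) = cmod c * hnorm H x"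
  by (rule power2_eq_imp_eq)
    (use ip.Re_line[of 0 x c] in \<open>auto simp: power_mult_distrib hnorm_sq hnorm_nonneg V_scale
      ip.zero_left zero_closed\<close>)

lemma hnorm_uminus: "x \<in> vectors H \<Longrightarrow> hnorm H (- x) = hnorm H x"
  using hnorm_scale[of x "-1"] by simp

lemma hnorm_triangle:
  assumes "x \<in> vectors H" "y \<in> vectors H"
  shows "hnorm H (x + y) \<le> hnorm H x + hnorm H y"
proof (rule power2_le_imp_le)
  have "(hnorm H (x + y))\<^sup>2 = (hnorm H x)\<^sup>2 + 2 * Re (ip H x y) + (hnorm H y)\<^sup>2"
    using ip.Re_line[of x y 1] assms by (simp add: hnorm_sq V_add)
  also have "\<dots> \<le> (hnorm H x + hnorm H y)\<^sup>2"
    using ip_bound[OF assms] complex_Re_le_cmod[of "ip H x y"] by (simp add: power2_sum)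
  finally show "(hnorm H (x + y))\<^sup>2 \<le> (hnorm H x + hnorm H y)\<^sup>2" .
qed (use assms hnorm_nonneg in auto)

lemma hnorm_triangle_diff:
  assumes "x \<in> vectors H" "y \<in> vectors H"
  shows "hnorm H (x - y) \<le> hnorm H x + hnorm H y"
  using hnorm_triangle[of x "- y"] assms by (simp add: hnorm_uminus V_uminus)

lemma hnorm_minus_commute:
  "\<lbrakk>x \<in> vectors H; y \<in> vectors H\<rbrakk> \<Longrightarrow> hnorm H (x - y) = hnorm H (y - x)"
  using hnorm_uminus[of "x - y"] V_diff by simp

lemma hnorm_triangle_abs:
  assumes "x \<in> vectors H" "y \<in> vectors H"
  shows "\<bar>hnorm H x - hnorm H y\<bar> \<le> hnorm H (x - y)"
  using hnorm_triangle[of "x - y" y] hnorm_triangle[of "y - x" x] assms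
  by (simp add: V_diff hnorm_minus_commute[of x y] abs_le_iff)

lemma eq_if_ip_eq:
  assumes "x \<in> vectors H" "y \<in> vectors H" "\<And>z. z \<in> vectors H \<Longrightarrow> ip H z x = ip H z y"
  shows "x = y"
proof -
  have "ip H (x - y) (x - y) = 0"
    using assms by (simp add: ip.diff_right V_diff)
  then show ?thesis using ip_definite[of "x - y"] assms V_diff by auto
qed

lemma parallelogram:
  assumes "x \<in> vectors H" "y \<in> vectors H"
  shows "(hnorm H (x + y))\<^sup>2 + (hnorm H (x - y))\<^sup>2 = 2 * (hnorm H x)\<^sup>2 + 2 * (hnorm H y)\<^sup>2"
  using ip.Re_line[of x y 1] ip.Re_line[of x y "-1"] assms
  by (simp add: hnorm_sq V_add V_diff)

end

section \<open>Bounded operators and adjoints\<close>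

context hilbert_space
begin

lemma bounded_op_closed: "\<lbrakk>bounded_op H T; x \<in> vectors H\<rbrakk> \<Longrightarrow> T x \<in> vectors H"
  by (simp add: bounded_op_def)

lemma bounded_op_add:
  "\<lbrakk>bounded_op H T; x \<in> vectors H; y \<in> vectors H\<rbrakk> \<Longrightarrow> T (x + y) = T x + T y"
  by (simp add: bounded_op_def)

lemma bounded_op_scale: "\<lbrakk>bounded_op H T; x \<in> vectors H\<rbrakk> \<Longrightarrow> T (c \<cdot>\<^sub>C x) = c \<cdot>\<^sub>C T x"
  by (simp add: bounded_op_def)

lemma bounded_op_zero: "bounded_op H T \<Longrightarrow> T 0 = 0"
  using bounded_op_scale[of T 0 0] zero_closed by simp

lemma bounded_op_diff:
  "\<lbrakk>bounded_op H T; x \<in> vectors H; y \<in> vectors H\<rbrakk> \<Longrightarrow> T (x - y) = T x - T y"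
  using bounded_op_add[of T x "- y"] bounded_op_scale[of T y "-1"] V_uminus by simp

lemma bounded_op_sum:
  "\<lbrakk>bounded_op H T; \<And>i. i \<in> I \<Longrightarrow> f i \<in> vectors H\<rbrakk> \<Longrightarrow> T (\<Sum>i\<in>I. f i) = (\<Sum>i\<in>I. T (f i))"
proof (induction I rule: infinite_finite_induct)
  case (insert a I)
  then show ?case using bounded_op_add[of T "f a" "sum f I"] V_sum[of I f] by simp
qed (simp_all add: bounded_op_zero)

lemma bounded_op_bound:
  assumes "bounded_op H T"
  obtains C where "0 \<le> C" "\<And>x. x \<in> vectors H \<Longrightarrow> hnorm H (T x) \<le> C * hnorm H x"
proof -
  obtain C where C: "\<And>x. x \<in> vectors H \<Longrightarrow> hnorm H (T x) \<le> C * hnorm H x"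
    using assms unfolding bounded_op_def by metis
  have "hnorm H (T x) \<le> max C 0 * hnorm H x" if "x \<in> vectors H" for x
    using C[OF that] hnorm_nonneg[OF that] mult_right_mono[of C "max C 0" "hnorm H x"] by linarith
  then show ?thesis using that[of "max C 0"] by simp
qed

lemma bounded_opI:
  assumes "\<And>x. x \<in> vectors H \<Longrightarrow> T x \<in> vectors H"
    and "\<And>x y. \<lbrakk>x \<in> vectors H; y \<in> vectors H\<rbrakk> \<Longrightarrow> T (x + y) = T x + T y"
    and "\<And>c x. x \<in> vectors H \<Longrightarrow> T (c \<cdot>\<^sub>C x) = c \<cdot>\<^sub>C T x"
    and "\<And>x. x \<in> vectors H \<Longrightarrow> hnorm H (T x) \<le> C * hnorm H x"
  shows "bounded_op H T"
  unfolding bounded_op_def using assms by blast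

lemma bounded_op_cong:
  assumes "\<And>x. x \<in> vectors H \<Longrightarrow> S x = T x"
  shows "bounded_op H S \<longleftrightarrow> bounded_op H T"
  unfolding bounded_op_def using assms V_add V_scale by auto

lemma bounded_op_0: "bounded_op H 0"
  by (rule bounded_opI[where C = 0]) (auto simp: fun_apply zero_closed)

lemma bounded_op_id: "bounded_op H id"
  by (rule bounded_opI[where C = 1]) auto

lemma bounded_op_comp:
  assumes "bounded_op H S" "bounded_op H T"
  shows "bounded_op H (S \<circ> T)"
proof -
  obtain C where C: "0 \<le> C" "\<And>x. x \<in> vectors H \<Longrightarrow> hnorm H (S x) \<le> C * hnorm H x"
    using bounded_op_bound[OF assms(1)] by blast
  obtain D where D: "0 \<le> D" "\<And>x. x \<in> vectors H \<Longrightarrow> hnorm H (T x) \<le> D * hnorm H x"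
    using bounded_op_bound[OF assms(2)] by blast
  have "hnorm H (S (T x)) \<le> C * D * hnorm H x" if "x \<in> vectors H" for x
    using C(2)[of "T x"] bounded_op_closed[OF assms(2) that]
      mult_left_mono[OF D(2)[OF that] C(1)] by (simp add: mult.assoc)
  then show ?thesis
    using assms
    by (intro bounded_opI[where C = "C * D"])
      (auto simp: bounded_op_closed bounded_op_add bounded_op_scale)
qed

lemma bounded_op_plus:
  assumes "bounded_op H S" "bounded_op H T"
  shows "bounded_op H (S + T)"
proof -
  obtain C where C: "\<And>x. x \<in> vectors H \<Longrightarrow> hnorm H (S x) \<le> C * hnorm H x"
    using bounded_op_bound[OF assms(1)] by blast
  obtain D where D: "\<And>x. x \<in> vectors H \<Longrightarrow> hnorm H (T x) \<le> D * hnorm H x"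
    using bounded_op_bound[OF assms(2)] by blast
  have "hnorm H ((S + T) x) \<le> (C + D) * hnorm H x" if "x \<in> vectors H" for x
    using hnorm_triangle[of "S x" "T x"] C[OF that] D[OF that] assms that
    by (simp add: fun_apply bounded_op_closed algebra_simps)
  then show ?thesis
    using assms
    by (intro bounded_opI[where C = "C + D"])
      (auto simp: fun_apply bounded_op_closed bounded_op_add bounded_op_scale V_add cscale_algebra)
qed

lemma bounded_op_scaled:
  assumes "bounded_op H T"
  shows "bounded_op H (\<lambda>x. c \<cdot>\<^sub>C T x)"
proof -
  obtain C where C: "\<And>x. x \<in> vectors H \<Longrightarrow> hnorm H (T x) \<le> C * hnorm H x"
    using bounded_op_bound[OF assms] by blast
  have "hnorm H (c \<cdot>\<^sub>C T x) \<le> cmod c * C * hnorm H x" if "x \<in> vectors H" for x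
    using C[OF that] assms that
    by (simp add: bounded_op_closed hnorm_scale mult.assoc mult_left_mono)
  then show ?thesis
    using assms
    by (intro bounded_opI[where C = "cmod c * C"])
      (auto simp: bounded_op_closed bounded_op_add bounded_op_scale V_scale cscale_algebra mult.commute)
qed

lemma bounded_op_minus:
  assumes "bounded_op H S" "bounded_op H T"
  shows "bounded_op H (S - T)"
  using bounded_op_plus[OF assms(1) bounded_op_scaled[OF assms(2), of "-1"]]
  by (rule bounded_op_cong[THEN iffD1, rotated]) (simp add: fun_apply)

lemma bounded_op_fsum:
  "(\<And>i. i \<in> I \<Longrightarrow> bounded_op H (F i)) \<Longrightarrow> bounded_op H (\<Sum>i\<in>I. F i)"
proof (induction I rule: infinite_finite_induct)
  case (insert a I)
  then show ?case by (simp add: bounded_op_plus)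
qed (simp_all add: bounded_op_0)

lemma bounded_op_op_prod:
  "(\<And>T. T \<in> set Ts \<Longrightarrow> bounded_op H T) \<Longrightarrow> bounded_op H (op_prod Ts)"
  by (induction Ts) (auto simp: op_prod_def bounded_op_id intro!: bounded_op_comp)

lemma op_norm_bound:
  assumes T: "bounded_op H T" and x: "x \<in> vectors H"
  shows "hnorm H (T x) \<le> op_norm H T * hnorm H x"
proof (cases "hnorm H x = 0")
  case True
  then show ?thesis using x T by (simp add: hnorm_eq_0 bounded_op_zero)
next
  case False
  then have pos: "hnorm H x > 0" using hnorm_nonneg[OF x] by simp
  obtain C where C: "0 \<le> C" "\<And>x. x \<in> vectors H \<Longrightarrow> hnorm H (T x) \<le> C * hnorm H x"
    using bounded_op_bound[OF T] by blast
  have bdd: "bdd_above ((\<lambda>x. hnorm H (T x)) ` {x \<in> vectors H. hnorm H x \<le> 1})"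
    using order_trans[OF C(2) mult_left_le[OF _ C(1)]] by (auto intro!: bdd_aboveI[of _ C])
  define y where "y = of_real (1 / hnorm H x) \<cdot>\<^sub>C x"
  have y: "y \<in> vectors H" "hnorm H y = 1"
    using x pos by (simp_all add: y_def V_scale hnorm_scale norm_divide)
  have "hnorm H (T y) \<le> op_norm H T"
    unfolding op_norm_def using y by (intro cSUP_upper bdd) simp
  moreover have "hnorm H (T y) = hnorm H (T x) / hnorm H x"
    using x pos T by (simp add: y_def bounded_op_scale hnorm_scale bounded_op_closed norm_divide)
  ultimately show ?thesis using pos by (simp add: field_simps)
qed

lemma op_norm_le:
  assumes "0 \<le> C" "\<And>x. x \<in> vectors H \<Longrightarrow> hnorm H (T x) \<le> C * hnorm H x"
  shows "op_norm H T \<le> C"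
  unfolding op_norm_def
proof (rule cSUP_least)
  show "{x \<in> vectors H. hnorm H x \<le> 1} \<noteq> {}"
    using zero_closed by (auto intro!: exI[of _ 0])
next
  fix x assume "x \<in> {x \<in> vectors H. hnorm H x \<le> 1}"
  then show "hnorm H (T x) \<le> C"
    using assms(2)[of x] mult_left_le[of "hnorm H x" C] assms(1) by auto
qed

text \<open>The representing vector minimizes \<open>\<parallel>x\<parallel>\<^sup>2 - 2 Re (f x)\<close>.\<close>

theorem riesz_representation:
  assumes add: "\<And>x y. \<lbrakk>x \<in> vectors H; y \<in> vectors H\<rbrakk> \<Longrightarrow> f (x + y) = f x + f y"
    and scale: "\<And>c x. x \<in> vectors H \<Longrightarrow> f (c \<cdot>\<^sub>C x) = c * f x"
    and bound: "\<And>x. x \<in> vectors H \<Longrightarrow> cmod (f x) \<le> C * hnorm H x"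
  obtains z where "z \<in> vectors H" "\<And>x. x \<in> vectors H \<Longrightarrow> f x = ip H x z"
proof -
  define J where "J x = (hnorm H x)\<^sup>2 - 2 * Re (f x)" for x
  define m where "m = (INF x\<in>vectors H. J x)"
  have diff: "f (x - y) = f x - f y" if "x \<in> vectors H" "y \<in> vectors H" for x y
    using add[of x "- y"] scale[of y "-1"] V_uminus that by simp
  have low: "- C\<^sup>2 \<le> J x" if "x \<in> vectors H" for x
  proof -
    have "Re (f x) \<le> C * hnorm H x"
      using bound[OF that] complex_Re_le_cmod order_trans by blast
    moreover have "0 \<le> (hnorm H x - C)\<^sup>2" by simp
    ultimately show ?thesis by (simp add: J_def power2_diff mult.commute)
  qed
  have bdd: "bdd_below (J ` vectors H)"
    using low by (auto intro!: bdd_belowI)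
  have mJ: "m \<le> J x" if "x \<in> vectors H" for x
    unfolding m_def using that bdd by (rule cINF_lower[rotated])
  have "\<exists>x\<in>vectors H. J x < m + 1 / real (Suc n)" for n
    using cINF_less_iff[of "vectors H" J "m + 1 / real (Suc n)"] bdd zero_closed
    unfolding m_def[symmetric] by force
  then obtain s where s: "\<And>n. s n \<in> vectors H" "\<And>n. J (s n) < m + 1 / real (Suc n)"
    by metis
  have gap: "(hnorm H (s p - s q))\<^sup>2 \<le> 2 / real (Suc p) + 2 / real (Suc q)" for p q
  proof -
    define h where "h = (1/2) \<cdot>\<^sub>C (s p + s q)"
    have h: "h \<in> vectors H" by (simp add: h_def V_add V_scale s)
    have "4 * J h = (hnorm H (s p + s q))\<^sup>2 - 4 * Re (f (s p)) - 4 * Re (f (s q))"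
      by (simp add: h_def J_def hnorm_scale s V_add scale add power_mult_distrib norm_divide
          power_divide field_simps)
    then have "(hnorm H (s p - s q))\<^sup>2 = 2 * J (s p) + 2 * J (s q) - 4 * J h"
      using parallelogram[of "s p" "s q"] s by (simp add: J_def)
    then show ?thesis using mJ[OF h] s(2)[of p] s(2)[of q] by simp
  qed
  have "\<exists>N. \<forall>p\<ge>N. \<forall>q\<ge>N. hnorm H (s p - s q) < e" if "e > 0" for e
  proof -
    obtain N where N: "4 / e\<^sup>2 < real N" using reals_Archimedean2 by blast
    have "hnorm H (s p - s q) < e" if "p \<ge> N" "q \<ge> N" for p q
    proof (rule power2_less_imp_less)
      have Np: "real N > 0"
        using N \<open>e > 0\<close> by (smt (verit) divide_nonneg_nonneg zero_le_power2)
      have "2 / real (Suc p) \<le> 2 / real N" "2 / real (Suc q) \<le> 2 / real N"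
        using that Np by (auto intro!: divide_left_mono)
      then have "(hnorm H (s p - s q))\<^sup>2 \<le> 4 / real N"
        using gap[of p q] by simp
      also have "\<dots> < e\<^sup>2"
        using N Np \<open>e > 0\<close> by (simp add: field_simps)
      finally show "(hnorm H (s p - s q))\<^sup>2 < e\<^sup>2" .
    qed (use \<open>e > 0\<close> in simp)
    then show ?thesis by blast
  qed
  then obtain z where z: "z \<in> vectors H" and lim: "(\<lambda>n. hnorm H (s n - z)) \<longlonglongrightarrow> 0"
    using complete[of s] s(1) by blast
  have "(\<lambda>n. hnorm H (s n) - hnorm H z) \<longlonglongrightarrow> 0"
    by (rule Lim_null_comparison[OF _ lim]) (simp add: hnorm_triangle_abs s z)
  then have 1: "(\<lambda>n. hnorm H (s n)) \<longlonglongrightarrow> hnorm H z"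
    by (rule LIM_zero_cancel)
  have "(\<lambda>n. f (s n) - f z) \<longlonglongrightarrow> 0"
    by (rule Lim_null_comparison[where g = "\<lambda>n. C * hnorm H (s n - z)"])
      (use bound V_diff s z lim in \<open>auto simp: diff[symmetric] intro!: tendsto_mult_right_zero\<close>)
  then have 2: "(\<lambda>n. f (s n)) \<longlonglongrightarrow> f z"
    by (rule LIM_zero_cancel)
  have "(\<lambda>n. J (s n)) \<longlonglongrightarrow> J z"
    unfolding J_def by (intro tendsto_intros 1 2)
  moreover have "(\<lambda>n. m + 1 / real (Suc n)) \<longlonglongrightarrow> m + 0"
    by (intro tendsto_intros LIMSEQ_Suc lim_1_over_n)
  ultimately have "J z \<le> m"
    using LIMSEQ_le[of "\<lambda>n. J (s n)" "J z" "\<lambda>n. m + 1 / real (Suc n)" "m + 0"] less_imp_le[OF s(2)]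
    by auto
  then have min: "J z \<le> J x" if "x \<in> vectors H" for x
    using mJ[OF that] by simp
  have "f v = ip H v z" if v: "v \<in> vectors H" for v
  proof -
    define w where "w = ip H v z - f v"
    define t where "t = 1 / ((hnorm H v)\<^sup>2 + 1)"
    have pos: "(hnorm H v)\<^sup>2 + 1 > 0" by (smt (verit) zero_le_power2)
    define c where "c = - of_real t * cnj w"
    have "c * w = - of_real (t * (cmod w)\<^sup>2)"
      by (simp add: c_def complex_norm_square mult_ac del: of_real_power)
    then have "Re (c * w) = Re (- of_real (t * (cmod w)\<^sup>2))"
      by (rule arg_cong)
    then have cw: "Re (c * w) = - t * (cmod w)\<^sup>2" "(cmod c)\<^sup>2 = t\<^sup>2 * (cmod w)\<^sup>2"
      by (simp_all only: uminus_complex.sel Re_complex_of_real)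
        (simp_all add: c_def norm_mult power_mult_distrib)
    have "J z \<le> J (z + c \<cdot>\<^sub>C v)"
      using z v by (intro min V_add V_scale)
    moreover have "J (z + c \<cdot>\<^sub>C v) = J z + 2 * Re (cnj c * ip H z v) + (cmod c)\<^sup>2 * (hnorm H v)\<^sup>2 - 2 * Re (c * f v)"
      using z v by (simp add: J_def hnorm_sq V_add V_scale ip.Re_line add scale)
    moreover have "Re (cnj c * ip H z v) = Re (c * ip H v z)"
      by (subst ip_commute[OF v z]) simp
    ultimately have "0 \<le> 2 * Re (c * w) + (cmod c)\<^sup>2 * (hnorm H v)\<^sup>2"
      by (simp add: w_def algebra_simps)
    then have "0 \<le> t * (cmod w)\<^sup>2 * (t * (hnorm H v)\<^sup>2 - 2)"
      unfolding cw by (simp add: algebra_simps power2_eq_square)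
    moreover have "t > 0" "t * (hnorm H v)\<^sup>2 - 2 < 0"
      using pos by (auto simp: t_def field_simps add_nonneg_pos)
    ultimately have "(cmod w)\<^sup>2 \<le> 0"
      by (auto simp: zero_le_mult_iff mult_le_0_iff)
    then show ?thesis by (simp add: w_def)
  qed
  then show ?thesis using that z by blast
qed

lemma adj_props:
  assumes T: "bounded_op H T" and y: "y \<in> vectors H"
  shows adj_closed: "adj H T y \<in> vectors H"
    and adj_ip: "x \<in> vectors H \<Longrightarrow> ip H x (adj H T y) = ip H (T x) y"
proof -
  obtain C where C: "0 \<le> C" "\<And>x. x \<in> vectors H \<Longrightarrow> hnorm H (T x) \<le> C * hnorm H x"
    using bounded_op_bound[OF T] by blast
  have bd: "cmod (ip H (T x) y) \<le> (C * hnorm H y) * hnorm H x" if "x \<in> vectors H" for x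
  proof -
    have "cmod (ip H (T x) y) \<le> hnorm H (T x) * hnorm H y"
      using T that y by (simp add: ip_bound bounded_op_closed)
    also have "\<dots> \<le> C * hnorm H x * hnorm H y"
      using C that y by (intro mult_right_mono) (auto simp: hnorm_nonneg)
    finally show ?thesis by (simp add: mult_ac)
  qed
  obtain z where z: "z \<in> vectors H" "\<And>x. x \<in> vectors H \<Longrightarrow> ip H (T x) y = ip H x z"
    by (rule riesz_representation[of "\<lambda>x. ip H (T x) y" "C * hnorm H y"])
      (use T y bd in \<open>auto simp: bounded_op_add bounded_op_scale bounded_op_closed ip_add_left ip_scale_left\<close>)
  have "\<exists>!z. z \<in> vectors H \<and> (\<forall>x\<in>vectors H. ip H (T x) y = ip H x z)"
    by (rule ex1I[of _ z]) (use z eq_if_ip_eq in auto)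
  from theI'[OF this] have *: "adj H T y \<in> vectors H"
      "\<forall>x\<in>vectors H. ip H (T x) y = ip H x (adj H T y)"
    unfolding adj_def by blast+
  show "adj H T y \<in> vectors H" by (rule *(1))
  show "x \<in> vectors H \<Longrightarrow> ip H x (adj H T y) = ip H (T x) y" using *(2) by simp
qed

lemma adj_ip_left:
  "\<lbrakk>bounded_op H T; x \<in> vectors H; y \<in> vectors H\<rbrakk> \<Longrightarrow> ip H (adj H T y) x = ip H y (T x)"
  by (metis adj_closed adj_ip bounded_op_closed ip_commute)

lemma adj_unique:
  assumes "bounded_op H T" "y \<in> vectors H" "z \<in> vectors H"
    and "\<And>x. x \<in> vectors H \<Longrightarrow> ip H (T x) y = ip H x z"
  shows "adj H T y = z"
  using assms by (intro eq_if_ip_eq) (auto simp: adj_closed adj_ip)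

lemma adj_bounded:
  assumes T: "bounded_op H T"
  shows "bounded_op H (adj H T)"
proof -
  obtain C where C: "0 \<le> C" "\<And>x. x \<in> vectors H \<Longrightarrow> hnorm H (T x) \<le> C * hnorm H x"
    using bounded_op_bound[OF T] by blast
  show ?thesis
  proof (rule bounded_opI[where C = C])
    fix y assume y: "y \<in> vectors H"
    let ?z = "adj H T y"
    have z: "?z \<in> vectors H" by (rule adj_closed[OF T y])
    have "(hnorm H ?z)\<^sup>2 = cmod (ip H (T ?z) y)"
      using adj_ip[OF T y z] ip_self[OF z] by (metis norm_of_real abs_of_nonneg zero_le_power2)
    also have "\<dots> \<le> hnorm H (T ?z) * hnorm H y"
      using T z y by (simp add: ip_bound bounded_op_closed)
    also have "\<dots> \<le> C * hnorm H ?z * hnorm H y"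
      using C z y by (intro mult_right_mono) (auto simp: hnorm_nonneg)
    finally have "hnorm H ?z * hnorm H ?z \<le> hnorm H ?z * (C * hnorm H y)"
      by (simp add: power2_eq_square mult_ac)
    then show "hnorm H ?z \<le> C * hnorm H y"
      using hnorm_nonneg[OF z] hnorm_nonneg[OF y] C(1)
      by (cases "hnorm H ?z = 0") auto
  qed (use T in \<open>auto intro!: adj_unique simp: adj_closed V_add V_scale adj_ip ip.add_right
      ip.scale_right bounded_op_closed\<close>)
qed

lemma adj_comp:
  assumes "bounded_op H S" "bounded_op H T" "y \<in> vectors H"
  shows "adj H (S \<circ> T) y = adj H T (adj H S y)"
  using assms by (intro adj_unique bounded_op_comp) (auto simp: adj_closed adj_ip bounded_op_closed)

lemma adj_id: "y \<in> vectors H \<Longrightarrow> adj H id y = y"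
  by (intro adj_unique bounded_op_id) auto

lemma positive_opI_dense:
  assumes T: "bounded_op H T" and D: "D \<subseteq> vectors H"
    and dense: "\<And>u \<epsilon>. \<lbrakk>u \<in> vectors H; 0 < \<epsilon>\<rbrakk> \<Longrightarrow> \<exists>d\<in>D. hnorm H (u - d) < \<epsilon>"
    and pos: "\<And>d. d \<in> D \<Longrightarrow> ip H (T d) d \<in> \<real>\<^sub>\<ge>\<^sub>0"
  shows "positive_op H T"
  unfolding positive_op_def
proof
  fix u assume u: "u \<in> vectors H"
  obtain C where C: "0 \<le> C" "\<And>x. x \<in> vectors H \<Longrightarrow> hnorm H (T x) \<le> C * hnorm H x"
    using bounded_op_bound[OF T] by blast
  have "\<exists>d\<in>D. hnorm H (u - d) < 1 / real (Suc n)" for n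
    using dense[OF u] by simp
  then obtain d where d: "\<And>n. d n \<in> D" "\<And>n. hnorm H (u - d n) < 1 / real (Suc n)"
    by metis
  have dV: "d n \<in> vectors H" for n using d D by auto
  have lim0: "(\<lambda>n. hnorm H (u - d n)) \<longlonglongrightarrow> 0"
    by (rule Lim_null_comparison[OF _ LIMSEQ_Suc[OF lim_1_over_n]])
      (use d(2) dV u V_diff hnorm_nonneg in \<open>auto intro!: always_eventually less_imp_le\<close>)
  have dn: "hnorm H (d n) \<le> hnorm H u + hnorm H (u - d n)" for n
    using hnorm_triangle_diff[of u "u - d n"] u dV V_diff by simp
  have eq: "ip H (T u) u - ip H (T (d n)) (d n) = ip H (T (u - d n)) u + ip H (T (d n)) (u - d n)" for n
    using u dV T by (simp add: bounded_op_diff ip.diff_left ip.diff_right bounded_op_closed)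
  have bd: "cmod (ip H (T u) u - ip H (T (d n)) (d n))
      \<le> C * hnorm H (u - d n) * hnorm H u + C * (hnorm H u + hnorm H (u - d n)) * hnorm H (u - d n)" for n
  proof -
    have "cmod (ip H (T (u - d n)) u) \<le> hnorm H (T (u - d n)) * hnorm H u"
      using u dV T by (simp add: ip_bound bounded_op_closed V_diff)
    also have "\<dots> \<le> C * hnorm H (u - d n) * hnorm H u"
      using C u dV by (intro mult_right_mono) (auto simp: hnorm_nonneg V_diff)
    finally have 1: "cmod (ip H (T (u - d n)) u) \<le> C * hnorm H (u - d n) * hnorm H u" .
    have "cmod (ip H (T (d n)) (u - d n)) \<le> hnorm H (T (d n)) * hnorm H (u - d n)"
      using u dV T by (simp add: ip_bound bounded_op_closed V_diff)
    also have "\<dots> \<le> C * hnorm H (d n) * hnorm H (u - d n)"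
      using C u dV by (intro mult_right_mono) (auto simp: hnorm_nonneg V_diff)
    also have "\<dots> \<le> C * (hnorm H u + hnorm H (u - d n)) * hnorm H (u - d n)"
      using C u dV dn[of n] by (intro mult_right_mono mult_left_mono) (auto simp: hnorm_nonneg V_diff)
    finally show ?thesis
      unfolding eq using 1 by (intro norm_triangle_le) simp
  qed
  have "(\<lambda>n. C * hnorm H (u - d n) * hnorm H u + C * (hnorm H u + hnorm H (u - d n)) * hnorm H (u - d n))
      \<longlonglongrightarrow> C * 0 * hnorm H u + C * (hnorm H u + 0) * 0"
    by (intro tendsto_intros lim0)
  then have "(\<lambda>n. ip H (T u) u - ip H (T (d n)) (d n)) \<longlonglongrightarrow> 0"
    using Lim_null_comparison[OF always_eventually[OF allI[OF bd]]] by simp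
  then have "(\<lambda>n. ip H (T u) u - (ip H (T u) u - ip H (T (d n)) (d n))) \<longlonglongrightarrow> ip H (T u) u - 0"
    by (intro tendsto_intros)
  then have "(\<lambda>n. ip H (T (d n)) (d n)) \<longlonglongrightarrow> ip H (T u) u"
    by simp
  then show "ip H (T u) u \<in> \<real>\<^sub>\<ge>\<^sub>0"
    by (rule Lim_in_closed_set[OF closed_nonneg_Reals_complex, rotated 2]) (use pos d in auto)
qed

end

section \<open>Schur products\<close>

definition psd_matrix :: "'a set \<Rightarrow> ('a \<Rightarrow> 'a \<Rightarrow> complex) \<Rightarrow> bool"
  where "psd_matrix I P \<longleftrightarrow> (\<forall>c. (\<Sum>i\<in>I. \<Sum>j\<in>I. cnj (c i) * c j * P i j) \<in> \<real>\<^sub>\<ge>\<^sub>0)"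

lemma psd_matrixD:
  "psd_matrix I P \<Longrightarrow> (\<Sum>i\<in>I. \<Sum>j\<in>I. cnj (c i) * c j * P i j) \<in> \<real>\<^sub>\<ge>\<^sub>0"
  by (simp add: psd_matrix_def)

lemma psd_matrix_subset:
  assumes "psd_matrix I P" "finite I" "J \<subseteq> I"
  shows "psd_matrix J P"
  unfolding psd_matrix_def
proof
  fix c :: "'a \<Rightarrow> complex"
  define d where "d i = (if i \<in> J then c i else 0)" for i
  have "(\<Sum>i\<in>I. \<Sum>j\<in>I. cnj (d i) * d j * P i j) = (\<Sum>i\<in>J. \<Sum>j\<in>I. cnj (d i) * d j * P i j)"
    using assms by (intro sum.mono_neutral_right) (auto simp: d_def)
  also have "\<dots> = (\<Sum>i\<in>J. \<Sum>j\<in>J. cnj (d i) * d j * P i j)"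
    using assms by (intro sum.cong refl sum.mono_neutral_right) (auto simp: d_def)
  also have "\<dots> = (\<Sum>i\<in>J. \<Sum>j\<in>J. cnj (c i) * c j * P i j)"
    by (simp add: d_def)
  finally show "(\<Sum>i\<in>J. \<Sum>j\<in>J. cnj (c i) * c j * P i j) \<in> \<real>\<^sub>\<ge>\<^sub>0"
    using psd_matrixD[OF assms(1), of d] by simp
qed

lemma psd_matrix_zero_diagonal:
  assumes Q: "psd_matrix I Q" and fin: "finite I"
    and herm: "\<And>i j. \<lbrakk>i \<in> I; j \<in> I\<rbrakk> \<Longrightarrow> Q j i = cnj (Q i j)"
    and a: "a \<in> I" "Q a a = 0" and j: "j \<in> I"
  shows "Q a j = 0"
proof -
  define b where "b x y = (\<Sum>i\<in>I. \<Sum>j\<in>I. cnj (y i) * x j * Q i j)" for x y :: "'a \<Rightarrow> complex"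
  interpret psd_form UNIV b
  proof unfold_locales
    fix x y :: "'a \<Rightarrow> complex"
    have "cnj (b x y) = (\<Sum>i\<in>I. \<Sum>j\<in>I. y i * cnj (x j) * cnj (Q i j))"
      by (simp add: b_def)
    also have "\<dots> = (\<Sum>i\<in>I. \<Sum>j\<in>I. cnj (x j) * y i * Q j i)"
      by (intro sum.cong refl) (simp add: herm[symmetric] mult_ac)
    finally show "b y x = cnj (b x y)"
      using sum.swap[of "\<lambda>i j. cnj (x j) * y i * Q j i" I I] by (simp add: b_def)
    show "0 \<le> Re (b x x)"
      using psd_matrixD[OF Q, of x] by (simp add: b_def nonneg_Reals_iff)
  qed (auto simp: b_def cscale_apply fun_apply algebra_simps sum.distrib sum_distrib_left)
  define \<delta> where "\<delta> j i = (if i = j then 1 else 0 :: complex)" for i j :: 'a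
  have \<delta>: "b (\<delta> j) (\<delta> i) = Q i j" if "i \<in> I" "j \<in> I" for i j
  proof -
    have "b (\<delta> j) (\<delta> i) = (\<Sum>i'\<in>I. if i' = i then (\<Sum>j'\<in>I. if j' = j then Q i' j' else 0) else 0)"
      unfolding b_def by (intro sum.cong refl) (auto simp: \<delta>_def intro!: sum.cong)
    then show ?thesis using that fin by simp
  qed
  show ?thesis
    using cauchy_schwarz[of "\<delta> j" "\<delta> a"] a j by (simp add: \<delta>)
qed

theorem schur_product:
  assumes "finite I" "psd_matrix I P" "psd_matrix I Q"
    and "\<And>i j. \<lbrakk>i \<in> I; j \<in> I\<rbrakk> \<Longrightarrow> Q j i = cnj (Q i j)"
  shows "(\<Sum>i\<in>I. \<Sum>j\<in>I. P i j * Q i j) \<in> \<real>\<^sub>\<ge>\<^sub>0"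
  using assms
proof (induction I arbitrary: Q rule: finite_induct)
  case (insert a I)
  note P = insert.prems(1) and Q = insert.prems(2) and herm = insert.prems(3)
  define q where "q = Q a a"
  define R where "R i j = Q i j - Q i a * Q a j / q" for i j
  have q: "q \<in> \<real>\<^sub>\<ge>\<^sub>0"
  proof -
    have "psd_matrix {a} Q"
      by (rule psd_matrix_subset[OF Q]) (use insert.hyps in auto)
    then show ?thesis
      using psd_matrixD[of "{a}" Q "\<lambda>_. 1"] by (simp add: q_def)
  qed
  have q_cnj: "cnj q = q"
    using q by (auto simp: nonneg_Reals_iff complex_eq_iff)
  have zero: "Q a j = 0" if "q = 0" "j \<in> insert a I" for j
    using psd_matrix_zero_diagonal[OF Q _ herm, of a j] insert.hyps that by (auto simp: q_def)
  have zero': "Q j a = 0" if "q = 0" "j \<in> insert a I" for j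
    using zero[OF that] herm[of a j] that by simp
  have Ra: "R a j = 0" "R j a = 0" if "j \<in> insert a I" for j
    using zero[OF _ that] zero'[OF _ that] by (cases "q = 0"; simp add: R_def q_def)+
  have "psd_matrix I R"
    unfolding psd_matrix_def
  proof
    fix c :: "'a \<Rightarrow> complex"
    define u where "u = (\<Sum>j\<in>I. Q a j * c j)"
    define d where "d i = (if i = a then - u / q else c i)" for i
    have d: "d i = c i" if "i \<in> I" for i
      using that insert.hyps by (auto simp: d_def)
    have u': "cnj u = (\<Sum>i\<in>I. cnj (c i) * Q i a)"
      by (auto simp: u_def herm[symmetric] intro!: sum.cong)
    have "(\<Sum>i\<in>insert a I. \<Sum>j\<in>insert a I. cnj (d i) * d j * Q i j)
        = cnj (d a) * d a * q + cnj (d a) * u + d a * cnj u + (\<Sum>i\<in>I. \<Sum>j\<in>I. cnj (c i) * c j * Q i j)"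
      using insert.hyps
      by (simp add: sum.distrib d q_def u' u_def sum_distrib_left mult_ac herm[symmetric] cong: sum.cong)
    also have "cnj (d a) * d a * q + cnj (d a) * u + d a * cnj u = - (cnj u * u / q)"
      by (cases "q = 0") (simp_all add: d_def q_cnj field_simps)
    also have "- (cnj u * u / q) = - (\<Sum>i\<in>I. \<Sum>j\<in>I. cnj (c i) * c j * (Q i a * Q a j / q))"
      unfolding u' unfolding u_def
      by (simp add: sum_product sum_divide_distrib mult_ac) (rule sum.swap)
    also have "\<dots> + (\<Sum>i\<in>I. \<Sum>j\<in>I. cnj (c i) * c j * Q i j)
        = (\<Sum>i\<in>I. \<Sum>j\<in>I. cnj (c i) * c j * R i j)"
      by (simp add: R_def algebra_simps sum_subtractf)
    finally show "(\<Sum>i\<in>I. \<Sum>j\<in>I. cnj (c i) * c j * R i j) \<in> \<real>\<^sub>\<ge>\<^sub>0"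
      using psd_matrixD[OF Q, of d] by (simp only:)
  qed
  moreover have "R j i = cnj (R i j)" if "i \<in> I" "j \<in> I" for i j
    using herm[of i j] herm[of i a] herm[of a j] that by (simp add: R_def q_cnj mult.commute)
  ultimately have IH: "(\<Sum>i\<in>I. \<Sum>j\<in>I. P i j * R i j) \<in> \<real>\<^sub>\<ge>\<^sub>0"
  proof (intro insert.IH)
    show "psd_matrix I P" by (rule psd_matrix_subset[OF P]) (use insert.hyps in auto)
  qed
  define s where "s = (\<Sum>i\<in>insert a I. \<Sum>j\<in>insert a I. cnj (Q a i) * Q a j * P i j)"
  have s: "s \<in> \<real>\<^sub>\<ge>\<^sub>0"
    unfolding s_def by (rule psd_matrixD[OF P])
  have "(\<Sum>i\<in>insert a I. \<Sum>j\<in>insert a I. P i j * Q i j)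
      = (\<Sum>i\<in>insert a I. \<Sum>j\<in>insert a I. P i j * R i j + cnj (Q a i) * Q a j * P i j / q)"
    by (intro sum.cong refl) (simp add: R_def herm[symmetric] algebra_simps)
  also have "\<dots> = (\<Sum>i\<in>insert a I. \<Sum>j\<in>insert a I. P i j * R i j) + s / q"
    by (simp only: sum.distrib s_def sum_divide_distrib)
  also have "(\<Sum>i\<in>insert a I. \<Sum>j\<in>insert a I. P i j * R i j) = (\<Sum>i\<in>I. \<Sum>j\<in>I. P i j * R i j)"
    using insert.hyps Ra by simp
  finally show ?case
    using IH s q by (auto simp: nonneg_Reals_add_I nonneg_Reals_divide_I)
qed simp

lemma psd_form_psd_matrix:
  assumes "psd_form V b" "finite I" "\<And>i. i \<in> I \<Longrightarrow> v i \<in> V"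
  shows "psd_matrix I (\<lambda>i j. b (v j) (v i))"
  unfolding psd_matrix_def using psd_form.gram_psd[OF assms(1,2), of v] assms(3) by simp

lemma gram_schur:
  assumes b: "psd_form V b" and b': "psd_form W b'" and I: "finite I"
    and v: "\<And>i. i \<in> I \<Longrightarrow> v i \<in> V" and w: "\<And>i. i \<in> I \<Longrightarrow> w i \<in> W"
  shows "(\<Sum>i\<in>I. \<Sum>j\<in>I. b (v j) (v i) * b' (w j) (w i)) \<in> \<real>\<^sub>\<ge>\<^sub>0"
proof -
  interpret b': psd_form W b' by (rule b')
  show ?thesis
    using schur_product[OF I psd_form_psd_matrix[OF b I, of v] psd_form_psd_matrix[OF b' I, of w]]
      v w b'.herm by blast
qed

section \<open>Tensor products of operators\<close>

context hilbert_space
begin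

lemma bounded_op_defect_psd:
  assumes T: "bounded_op H T" and C: "0 \<le> C" "\<And>x. x \<in> vectors H \<Longrightarrow> hnorm H (T x) \<le> C * hnorm H x"
  shows "psd_form (vectors H) (\<lambda>x y. of_real (C\<^sup>2) * ip H x y - ip H (T x) (T y))"
proof unfold_locales
  fix x y assume xy: "x \<in> vectors H" "y \<in> vectors H"
  show "of_real (C\<^sup>2) * ip H y x - ip H (T y) (T x)
      = cnj (of_real (C\<^sup>2) * ip H x y - ip H (T x) (T y))"
    using xy T ip_commute[of x y] ip_commute[of "T x" "T y"] by (simp add: bounded_op_closed)
next
  fix x assume x: "x \<in> vectors H"
  have "(hnorm H (T x))\<^sup>2 \<le> (C * hnorm H x)\<^sup>2"
    using C x T by (intro power_mono) (auto simp: hnorm_nonneg bounded_op_closed)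
  then show "0 \<le> Re (of_real (C\<^sup>2) * ip H x x - ip H (T x) (T x))"
    using x T by (simp add: hnorm_sq bounded_op_closed power_mult_distrib del: of_real_power)
qed (use T in \<open>simp_all add: bounded_op_add bounded_op_scale ip_add_left ip_scale_left
      bounded_op_closed algebra_simps\<close>)

lemma bounded_extension:
  assumes G: "G \<subseteq> vectors H \<times> vectors H"
    and G_add: "\<And>u v u' v'. \<lbrakk>(u, v) \<in> G; (u', v') \<in> G\<rbrakk> \<Longrightarrow> (u + u', v + v') \<in> G"
    and G_scale: "\<And>c u v. (u, v) \<in> G \<Longrightarrow> (c \<cdot>\<^sub>C u, c \<cdot>\<^sub>C v) \<in> G"
    and G_bound: "\<And>u v. (u, v) \<in> G \<Longrightarrow> hnorm H v \<le> M * hnorm H u" and M: "0 \<le> M"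
    and G_dense: "\<And>u \<epsilon>. \<lbrakk>u \<in> vectors H; 0 < \<epsilon>\<rbrakk> \<Longrightarrow> \<exists>(a, b)\<in>G. hnorm H (u - a) < \<epsilon>"
  shows "\<exists>T. bounded_op H T \<and> (\<forall>(u, v)\<in>G. T u = v)"
proof -
  define R where "R u v \<longleftrightarrow> u \<in> vectors H \<and> v \<in> vectors H \<and>
    (\<forall>\<epsilon>>0. \<exists>(a, b)\<in>G. hnorm H (u - a) < \<epsilon> \<and> hnorm H (v - b) < \<epsilon>)" for u v
  have GD: "a \<in> vectors H" "b \<in> vectors H" if "(a, b) \<in> G" for a b
    using that G by auto
  have Gd: "(u - u', v - v') \<in> G" if "(u, v) \<in> G" "(u', v') \<in> G" for u v u' v'
    using G_add[OF that(1) G_scale[OF that(2), of "-1"]] by simp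
  have R_G: "R u v" if "(u, v) \<in> G" for u v
    unfolding R_def using GD[OF that] that by (auto intro!: bexI[of _ "(u, v)"])
  have R_add: "R (u + u') (v + v')" if uv: "R u v" "R u' v'" for u v u' v'
    unfolding R_def
  proof (intro conjI allI impI)
    fix \<epsilon> :: real assume "0 < \<epsilon>"
    then obtain a b a' b' where ab: "(a, b) \<in> G" "hnorm H (u - a) < \<epsilon> / 2" "hnorm H (v - b) < \<epsilon> / 2"
      and ab': "(a', b') \<in> G" "hnorm H (u' - a') < \<epsilon> / 2" "hnorm H (v' - b') < \<epsilon> / 2"
      using uv half_gt_zero[of \<epsilon>] unfolding R_def by (metis (no_types, lifting) case_prodE)
    have V: "u \<in> vectors H" "v \<in> vectors H" "u' \<in> vectors H" "v' \<in> vectors H"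
      using uv by (auto simp: R_def)
    have "hnorm H (u + u' - (a + a')) < \<epsilon>" "hnorm H (v + v' - (b + b')) < \<epsilon>"
      using hnorm_triangle[of "u - a" "u' - a'"] hnorm_triangle[of "v - b" "v' - b'"]
        ab ab' V GD[OF ab(1)] GD[OF ab'(1)] by (simp_all add: V_diff algebra_simps)
    then show "\<exists>(a, b)\<in>G. hnorm H (u + u' - a) < \<epsilon> \<and> hnorm H (v + v' - b) < \<epsilon>"
      using G_add[OF ab(1) ab'(1)] by (intro bexI[of _ "(a + a', b + b')"]) auto
  qed (use uv in \<open>auto simp: R_def V_add\<close>)
  have R_scale: "R (c \<cdot>\<^sub>C u) (c \<cdot>\<^sub>C v)" if uv: "R u v" for c u v
    unfolding R_def
  proof (intro conjI allI impI)
    fix \<epsilon> :: real assume e: "0 < \<epsilon>"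
    have pos: "cmod c + 1 > 0" by (simp add: add_nonneg_pos)
    then obtain a b where ab: "(a, b) \<in> G" "hnorm H (u - a) < \<epsilon> / (cmod c + 1)"
        "hnorm H (v - b) < \<epsilon> / (cmod c + 1)"
      using uv e unfolding R_def by (metis (no_types, lifting) case_prodE divide_pos_pos)
    have V: "u \<in> vectors H" "v \<in> vectors H" "a \<in> vectors H" "b \<in> vectors H"
      using uv GD[OF ab(1)] by (auto simp: R_def)
    have small: "cmod c * x < \<epsilon>" if "0 \<le> x" "x < \<epsilon> / (cmod c + 1)" for x
    proof -
      have "cmod c * x \<le> (cmod c + 1) * x" using that by (simp add: mult_right_mono)
      also have "\<dots> < \<epsilon>" using that pos by (simp add: field_simps)
      finally show ?thesis .
    qed
    have "hnorm H (c \<cdot>\<^sub>C u - c \<cdot>\<^sub>C a) < \<epsilon>" "hnorm H (c \<cdot>\<^sub>C v - c \<cdot>\<^sub>C b) < \<epsilon>"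
      using small ab V hnorm_nonneg
      by (simp_all add: cscale_algebra(2)[symmetric] hnorm_scale V_diff)
    then show "\<exists>(a, b)\<in>G. hnorm H (c \<cdot>\<^sub>C u - a) < \<epsilon> \<and> hnorm H (c \<cdot>\<^sub>C v - b) < \<epsilon>"
      using G_scale[OF ab(1), of c] by (intro bexI[of _ "(c \<cdot>\<^sub>C a, c \<cdot>\<^sub>C b)"]) auto
  qed (use uv in \<open>auto simp: R_def V_scale\<close>)
  have R_bound: "hnorm H v \<le> M * hnorm H u" if uv: "R u v" for u v
  proof (rule field_le_epsilon)
    fix \<epsilon> :: real assume e: "0 < \<epsilon>"
    then obtain a b where ab: "(a, b) \<in> G" "hnorm H (u - a) < \<epsilon> / (M + 1)"
        "hnorm H (v - b) < \<epsilon> / (M + 1)"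
      using uv M unfolding R_def by (metis (no_types, lifting) case_prodE divide_pos_pos add_nonneg_pos zero_less_one)
    have V: "u \<in> vectors H" "v \<in> vectors H" "a \<in> vectors H" "b \<in> vectors H"
      using uv GD[OF ab(1)] by (auto simp: R_def)
    have "hnorm H v \<le> hnorm H (v - b) + hnorm H b"
      using hnorm_triangle[of "v - b" b] V by (simp add: V_diff)
    also have "hnorm H b \<le> M * hnorm H a" by (rule G_bound[OF ab(1)])
    also have "hnorm H a \<le> hnorm H u + hnorm H (u - a)"
      using hnorm_triangle_diff[of u "u - a"] V by (simp add: V_diff)
    finally have "hnorm H v \<le> hnorm H (v - b) + M * (hnorm H u + hnorm H (u - a))"
      using M by (simp add: mult_left_mono)
    also have "\<dots> \<le> \<epsilon> / (M + 1) + M * (hnorm H u + \<epsilon> / (M + 1))"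
      using ab M by (intro add_mono mult_left_mono) auto
    also have "\<dots> = M * hnorm H u + (M + 1) * (\<epsilon> / (M + 1))"
      by (simp only: distrib_left distrib_right)
    also have "\<dots> = M * hnorm H u + \<epsilon>"
      using M by simp
    finally show "hnorm H v \<le> M * hnorm H u + \<epsilon>" .
  qed
  have R_unique: "v = v'" if "R u v" "R u v'" for u v v'
  proof -
    have "R 0 (v - v')"
      using R_add[OF that(1) R_scale[OF that(2), of "-1"]] by simp
    from R_bound[OF this] have "hnorm H (v - v') \<le> 0" by simp
    then show ?thesis
      using that hnorm_nonneg[of "v - v'"] hnorm_eq_0[of "v - v'"] by (auto simp: R_def V_diff)
  qed
  have R_total: "\<exists>v. R u v" if u: "u \<in> vectors H" for u
  proof -
    have "\<exists>a b. (a, b) \<in> G \<and> hnorm H (u - a) < 1 / real (Suc n)" for n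
      using G_dense[OF u, of "1 / real (Suc n)"] by auto
    then obtain a b where ab: "\<And>n. (a n, b n) \<in> G" "\<And>n. hnorm H (u - a n) < 1 / real (Suc n)"
      by metis
    have V: "a n \<in> vectors H" "b n \<in> vectors H" for n
      using GD[OF ab(1)] by auto
    have gap: "hnorm H (b p - b q) \<le> M * (1 / real (Suc p) + 1 / real (Suc q))" for p q
    proof -
      have "hnorm H (b p - b q) \<le> M * hnorm H (a p - a q)"
        by (rule G_bound[OF Gd[OF ab(1) ab(1)]])
      also have "hnorm H (a p - a q) \<le> hnorm H (u - a q) + hnorm H (u - a p)"
        using hnorm_triangle_diff[of "u - a q" "u - a p"] u V by (simp add: V_diff)
      finally show ?thesis
        using ab(2)[of p] ab(2)[of q] M by (smt (verit) mult_left_mono)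
    qed
    have "\<exists>N. \<forall>p\<ge>N. \<forall>q\<ge>N. hnorm H (b p - b q) < e" if "e > 0" for e
    proof -
      obtain N where N: "2 * M / e < real N" using reals_Archimedean2 by blast
      have "hnorm H (b p - b q) < e" if pq: "p \<ge> N" "q \<ge> N" for p q
      proof -
        have "1 / real (Suc p) + 1 / real (Suc q) \<le> 1 / real (Suc N) + 1 / real (Suc N)"
          using pq by (intro add_mono divide_left_mono) auto
        then have "M * (1 / real (Suc p) + 1 / real (Suc q)) \<le> M * (2 / real (Suc N))"
          using M by (intro mult_left_mono) auto
        also have "\<dots> < e"
          using N M \<open>e > 0\<close> by (simp add: field_simps) 
        finally show ?thesis using gap[of p q] by simp
      qed
      then show ?thesis by blast
    qed
    then obtain v where v: "v \<in> vectors H" "(\<lambda>n. hnorm H (b n - v)) \<longlonglongrightarrow> 0"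
      using complete[of b] V by blast
    have "R u v"
      unfolding R_def
    proof (intro conjI u v allI impI)
      fix \<epsilon> :: real assume e: "0 < \<epsilon>"
      have "eventually (\<lambda>n. hnorm H (b n - v) < \<epsilon>) sequentially"
        by (rule order_tendstoD(2)[OF v(2) e])
      moreover have "eventually (\<lambda>n. 1 / real (Suc n) < \<epsilon>) sequentially"
        by (rule order_tendstoD(2)[OF LIMSEQ_Suc[OF lim_1_over_n] e])
      ultimately obtain n where "hnorm H (b n - v) < \<epsilon>" "1 / real (Suc n) < \<epsilon>"
        using eventually_happens'[OF sequentially_bot eventually_conj] by blast
      then show "\<exists>(a, b)\<in>G. hnorm H (u - a) < \<epsilon> \<and> hnorm H (v - b) < \<epsilon>"
        using ab[of n] V v by (intro bexI[of _ "(a n, b n)"]) (auto simp: hnorm_minus_commute)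
    qed
    then show ?thesis by blast
  qed
  define T where "T u = (THE v. R u v)" for u
  have T: "T u = v" if "R u v" for u v
    unfolding T_def using that R_unique by blast
  have RT: "R u (T u)" if "u \<in> vectors H" for u
    using R_total[OF that] T by auto
  have "bounded_op H T"
  proof (rule bounded_opI[where C = M])
    show "T u \<in> vectors H" "hnorm H (T u) \<le> M * hnorm H u" if "u \<in> vectors H" for u
      using RT[OF that] R_bound[OF RT[OF that]] by (auto simp: R_def)
  qed (auto intro!: T R_add R_scale RT)
  then show ?thesis
    using T R_G by blast
qed

end

locale tensor_space = E: hilbert_space E + H: hilbert_space H + K: hilbert_space K
  for E :: "'e hilbert" and H :: "'h hilbert" and K :: "('e, 'h) tensor_index hilbert" +
  fixes \<tau> :: "'e cfun \<Rightarrow> 'h cfun \<Rightarrow> ('e, 'h) tensor_index cfun"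
  assumes tensor: "hilbert_tensor E H K \<tau>"
begin

lemma \<tau>_closed: "\<lbrakk>e \<in> vectors E; h \<in> vectors H\<rbrakk> \<Longrightarrow> \<tau> e h \<in> vectors K"
  using tensor by (simp add: hilbert_tensor_def)

lemma \<tau>_ip: "\<lbrakk>e \<in> vectors E; e' \<in> vectors E; h \<in> vectors H; h' \<in> vectors H\<rbrakk>
    \<Longrightarrow> ip K (\<tau> e h) (\<tau> e' h') = ip E e e' * ip H h h'"
  using tensor by (simp add: hilbert_tensor_def)

lemma \<tau>_dense:
  assumes "u \<in> vectors K" "0 < \<epsilon>"
  obtains N :: nat and e h where "\<And>p. p < N \<Longrightarrow> e p \<in> vectors E" "\<And>p. p < N \<Longrightarrow> h p \<in> vectors H"
    "hnorm K (u - (\<Sum>p<N. \<tau> (e p) (h p))) < \<epsilon>"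
proof -
  have "\<forall>u\<in>vectors K. \<forall>\<epsilon>>0. \<exists>(N::nat) e h. (\<forall>p<N. e p \<in> vectors E \<and> h p \<in> vectors H) \<and>
      hnorm K (u - (\<Sum>p<N. \<tau> (e p) (h p))) < \<epsilon>"
    using tensor unfolding hilbert_tensor_def by blast
  then show ?thesis using assms that by blast
qed

lemma \<tau>_scale:
  assumes "e \<in> vectors E" "h \<in> vectors H"
  shows "\<tau> (c \<cdot>\<^sub>C e) h = c \<cdot>\<^sub>C \<tau> e h"
proof -
  have V: "\<tau> e h \<in> vectors K" "\<tau> (c \<cdot>\<^sub>C e) h \<in> vectors K" "c \<cdot>\<^sub>C \<tau> e h \<in> vectors K"
    using assms by (auto intro!: \<tau>_closed E.V_scale K.V_scale)
  have "ip K (\<tau> (c \<cdot>\<^sub>C e) h - c \<cdot>\<^sub>C \<tau> e h) (\<tau> (c \<cdot>\<^sub>C e) h - c \<cdot>\<^sub>C \<tau> e h) = 0"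
    using V assms by (simp add: K.ip.diff_left K.ip.diff_right K.ip.scale_left K.ip.scale_right
        K.V_diff \<tau>_ip E.V_scale E.ip.scale_left E.ip.scale_right)
  then show ?thesis
    using K.ip_definite[of "\<tau> (c \<cdot>\<^sub>C e) h - c \<cdot>\<^sub>C \<tau> e h"] V K.V_diff by auto
qed

lemma \<tau>_sum_ip:
  assumes "\<And>p. p \<in> I \<Longrightarrow> e p \<in> vectors E" "\<And>p. p \<in> I \<Longrightarrow> h p \<in> vectors H"
    and "\<And>p. p \<in> I \<Longrightarrow> e' p \<in> vectors E" "\<And>p. p \<in> I \<Longrightarrow> h' p \<in> vectors H"
  shows "ip K (\<Sum>q\<in>I. \<tau> (e' q) (h' q)) (\<Sum>p\<in>I. \<tau> (e p) (h p))
    = (\<Sum>p\<in>I. \<Sum>q\<in>I. ip E (e' q) (e p) * ip H (h' q) (h p))"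
proof -
  have "ip K (\<Sum>q\<in>I. \<tau> (e' q) (h' q)) (\<Sum>p\<in>I. \<tau> (e p) (h p))
      = (\<Sum>q\<in>I. ip K (\<tau> (e' q) (h' q)) (\<Sum>p\<in>I. \<tau> (e p) (h p)))"
    using assms by (intro K.ip.sum_left K.V_sum) (auto simp: \<tau>_closed)
  also have "\<dots> = (\<Sum>q\<in>I. \<Sum>p\<in>I. ip K (\<tau> (e' q) (h' q)) (\<tau> (e p) (h p)))"
    using assms by (intro sum.cong refl K.ip.sum_right) (auto simp: \<tau>_closed)
  also have "\<dots> = (\<Sum>q\<in>I. \<Sum>p\<in>I. ip E (e' q) (e p) * ip H (h' q) (h p))"
    using assms by (intro sum.cong refl \<tau>_ip) auto
  finally show ?thesis by (subst sum.swap)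
qed

lemma tensor_bound:
  assumes A: "bounded_op E A" and X: "bounded_op H X"
    and C: "0 \<le> C" "\<And>x. x \<in> vectors E \<Longrightarrow> hnorm E (A x) \<le> C * hnorm E x"
    and D: "0 \<le> D" "\<And>x. x \<in> vectors H \<Longrightarrow> hnorm H (X x) \<le> D * hnorm H x"
    and I: "finite I" and e: "\<And>p. p \<in> I \<Longrightarrow> e p \<in> vectors E" and h: "\<And>p. p \<in> I \<Longrightarrow> h p \<in> vectors H"
  shows "hnorm K (\<Sum>p\<in>I. \<tau> (A (e p)) (X (h p))) \<le> C * D * hnorm K (\<Sum>p\<in>I. \<tau> (e p) (h p))"
proof (rule power2_le_imp_le)
  have V: "A (e p) \<in> vectors E" "X (h p) \<in> vectors H" if "p \<in> I" for p
    using that e h A X by (auto simp: E.bounded_op_closed H.bounded_op_closed)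
  have K: "(\<Sum>p\<in>I. \<tau> (A (e p)) (X (h p))) \<in> vectors K" "(\<Sum>p\<in>I. \<tau> (e p) (h p)) \<in> vectors K"
    using V e h by (auto intro!: K.V_sum \<tau>_closed)
  let ?e = "\<lambda>p q. ip E (e q) (e p)" and ?h = "\<lambda>p q. ip H (h q) (h p)"
  let ?Ae = "\<lambda>p q. ip E (A (e q)) (A (e p))" and ?Xh = "\<lambda>p q. ip H (X (h q)) (X (h p))"
  have "(\<Sum>p\<in>I. \<Sum>q\<in>I. (of_real (C\<^sup>2) * ?e p q - ?Ae p q) * ?Xh p q) \<in> \<real>\<^sub>\<ge>\<^sub>0"
    using V e by (intro gram_schur[OF E.bounded_op_defect_psd[OF A C] H.ip.psd_form_axioms I,
      of e "\<lambda>p. X (h p)"])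
  then have 1: "Re (\<Sum>p\<in>I. \<Sum>q\<in>I. ?Ae p q * ?Xh p q) \<le> C\<^sup>2 * Re (\<Sum>p\<in>I. \<Sum>q\<in>I. ?e p q * ?Xh p q)"
    by (simp add: nonneg_Reals_iff algebra_simps sum_subtractf sum_distrib_left del: of_real_power)
  have "(\<Sum>p\<in>I. \<Sum>q\<in>I. ?e p q * (of_real (D\<^sup>2) * ?h p q - ?Xh p q)) \<in> \<real>\<^sub>\<ge>\<^sub>0"
    using V e h by (intro gram_schur[OF E.ip.psd_form_axioms H.bounded_op_defect_psd[OF X D] I])
  then have "Re (\<Sum>p\<in>I. \<Sum>q\<in>I. ?e p q * ?Xh p q) \<le> D\<^sup>2 * Re (\<Sum>p\<in>I. \<Sum>q\<in>I. ?e p q * ?h p q)"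
    by (simp add: nonneg_Reals_iff algebra_simps sum_subtractf sum_distrib_left del: of_real_power)
  then have "C\<^sup>2 * Re (\<Sum>p\<in>I. \<Sum>q\<in>I. ?e p q * ?Xh p q)
      \<le> C\<^sup>2 * (D\<^sup>2 * Re (\<Sum>p\<in>I. \<Sum>q\<in>I. ?e p q * ?h p q))"
    by (rule mult_left_mono) simp
  with 1 show "(hnorm K (\<Sum>p\<in>I. \<tau> (A (e p)) (X (h p))))\<^sup>2 \<le> (C * D * hnorm K (\<Sum>p\<in>I. \<tau> (e p) (h p)))\<^sup>2"
    using V e h K by (simp add: power_mult_distrib K.hnorm_sq \<tau>_sum_ip mult_ac)
  show "0 \<le> C * D * hnorm K (\<Sum>p\<in>I. \<tau> (e p) (h p))"
    using C D K by (simp add: K.hnorm_nonneg)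
qed

lemma op_tensor_props:
  assumes A: "bounded_op E A" and X: "bounded_op H X"
  shows op_tensor_bounded: "bounded_op K (op_tensor E H K \<tau> A X)"
    and op_tensor_apply: "\<lbrakk>e \<in> vectors E; h \<in> vectors H\<rbrakk>
      \<Longrightarrow> op_tensor E H K \<tau> A X (\<tau> e h) = \<tau> (A e) (X h)"
proof -
  obtain C where C: "0 \<le> C" "\<And>x. x \<in> vectors E \<Longrightarrow> hnorm E (A x) \<le> C * hnorm E x"
    using E.bounded_op_bound[OF A] by blast
  obtain D where D: "0 \<le> D" "\<And>x. x \<in> vectors H \<Longrightarrow> hnorm H (X x) \<le> D * hnorm H x"
    using H.bounded_op_bound[OF X] by blast
  define pair where "pair N e h = ((\<Sum>p<N. \<tau> (e p) (h p)), (\<Sum>p<N. \<tau> (A (e p)) (X (h p))))" for N :: nat and e h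
  define G where "G = {pair N e h | N e h. (\<forall>p<N. e p \<in> vectors E) \<and> (\<forall>p<N. h p \<in> vectors H)}"
  have GI: "pair N e h \<in> G" if "\<And>p. p < N \<Longrightarrow> e p \<in> vectors E" "\<And>p. p < N \<Longrightarrow> h p \<in> vectors H" for N e h
    unfolding G_def using that by blast
  have AV: "A e \<in> vectors E" if "e \<in> vectors E" for e
    using that A by (rule E.bounded_op_closed[rotated])
  have XV: "X e \<in> vectors H" if "e \<in> vectors H" for e
    using that X by (rule H.bounded_op_closed[rotated])
  have split: "(\<Sum>p<N + N'. f p) = (\<Sum>p<N. f p) + (\<Sum>p<N'. f (N + p))"
    for N N' :: nat and f :: "nat \<Rightarrow> ('e, 'h) tensor_index cfun"
    by (induction N') (simp_all add: add.assoc)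
  have "\<exists>T. bounded_op K T \<and> (\<forall>(u, v)\<in>G. T u = v)"
  proof (rule K.bounded_extension[where M = "C * D"])
    show "G \<subseteq> vectors K \<times> vectors K"
      by (auto simp: G_def pair_def intro!: K.V_sum \<tau>_closed AV XV)
  next
    fix u v u' v' assume "(u, v) \<in> G" "(u', v') \<in> G"
    then obtain N e h N' e' h' where
      1: "(u, v) = pair N e h" "\<And>p. p < N \<Longrightarrow> e p \<in> vectors E" "\<And>p. p < N \<Longrightarrow> h p \<in> vectors H" and
      2: "(u', v') = pair N' e' h'" "\<And>p. p < N' \<Longrightarrow> e' p \<in> vectors E" "\<And>p. p < N' \<Longrightarrow> h' p \<in> vectors H"
      unfolding G_def by blast
    define f where "f p = (if p < N then e p else e' (p - N))" for p
    define g where "g p = (if p < N then h p else h' (p - N))" for p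
    have "pair (N + N') f g = (u + u', v + v')"
      using 1(1) 2(1) by (simp add: pair_def split f_def g_def)
    moreover have "pair (N + N') f g \<in> G"
      by (rule GI) (use 1 2 in \<open>auto simp: f_def g_def\<close>)
    ultimately show "(u + u', v + v') \<in> G" by simp
  next
    fix c u v assume "(u, v) \<in> G"
    then obtain N e h where
      1: "(u, v) = pair N e h" "\<And>p. p < N \<Longrightarrow> e p \<in> vectors E" "\<And>p. p < N \<Longrightarrow> h p \<in> vectors H"
      unfolding G_def by blast
    have "pair N (\<lambda>p. c \<cdot>\<^sub>C e p) h = (c \<cdot>\<^sub>C u, c \<cdot>\<^sub>C v)"
      using 1 by (simp add: pair_def cscale_sum \<tau>_scale A E.bounded_op_scale AV XV)
    moreover have "pair N (\<lambda>p. c \<cdot>\<^sub>C e p) h \<in> G"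
      by (rule GI) (use 1 E.V_scale in auto)
    ultimately show "(c \<cdot>\<^sub>C u, c \<cdot>\<^sub>C v) \<in> G" by simp
  next
    fix u v assume "(u, v) \<in> G"
    then obtain N e h where
      "(u, v) = pair N e h" "\<And>p. p < N \<Longrightarrow> e p \<in> vectors E" "\<And>p. p < N \<Longrightarrow> h p \<in> vectors H"
      unfolding G_def by blast
    then show "hnorm K v \<le> C * D * hnorm K u"
      using tensor_bound[OF A X C D, of "{..<N}" e h] by (simp add: pair_def)
  next
    show "0 \<le> C * D" using C D by simp
  next
    fix u and \<epsilon> :: real assume u: "u \<in> vectors K" "0 < \<epsilon>"
    obtain N :: nat and e h where 1: "\<And>p. p < N \<Longrightarrow> e p \<in> vectors E" "\<And>p. p < N \<Longrightarrow> h p \<in> vectors H"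
      "hnorm K (u - (\<Sum>p<N. \<tau> (e p) (h p))) < \<epsilon>"
      using \<tau>_dense[OF u] by blast
    show "\<exists>(a, b)\<in>G. hnorm K (u - a) < \<epsilon>"
      by (rule bexI[OF _ GI[of N e h]]) (use 1 in \<open>auto simp: pair_def\<close>)
  qed
  then obtain T where T: "bounded_op K T" "\<forall>(u, v)\<in>G. T u = v"
    by blast
  have "T (\<tau> e h) = \<tau> (A e) (X h)" if "e \<in> vectors E" "h \<in> vectors H" for e h
    using T(2) GI[of 1 "\<lambda>_. e" "\<lambda>_. h"] that by (auto simp: pair_def)
  then have "\<exists>T. bounded_op K T \<and> (\<forall>e\<in>vectors E. \<forall>h\<in>vectors H. T (\<tau> e h) = \<tau> (A e) (X h))"
    using T(1) by blast
  from someI_ex[OF this] show "bounded_op K (op_tensor E H K \<tau> A X)"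
    and "\<lbrakk>e \<in> vectors E; h \<in> vectors H\<rbrakk> \<Longrightarrow> op_tensor E H K \<tau> A X (\<tau> e h) = \<tau> (A e) (X h)"
    by (simp_all add: op_tensor_def)
qed

lemma positive_op_if_elementary:
  assumes T: "bounded_op K T"
    and "\<And>(N::nat) e h. \<lbrakk>\<And>p. p < N \<Longrightarrow> e p \<in> vectors E; \<And>p. p < N \<Longrightarrow> h p \<in> vectors H\<rbrakk>
      \<Longrightarrow> ip K (T (\<Sum>p<N. \<tau> (e p) (h p))) (\<Sum>p<N. \<tau> (e p) (h p)) \<in> \<real>\<^sub>\<ge>\<^sub>0"
  shows "positive_op K T"
proof (rule K.positive_opI_dense[OF T])
  let ?D = "{(\<Sum>p<N. \<tau> (e p) (h p)) | (N::nat) e h. (\<forall>p<N. e p \<in> vectors E) \<and> (\<forall>p<N. h p \<in> vectors H)}"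
  show "?D \<subseteq> vectors K"
    by (auto intro!: K.V_sum \<tau>_closed)
  show "\<exists>d\<in>?D. hnorm K (u - d) < \<epsilon>" if "u \<in> vectors K" "0 < \<epsilon>" for u \<epsilon>
    by (rule \<tau>_dense[OF that]) blast
  show "ip K (T d) d \<in> \<real>\<^sub>\<ge>\<^sub>0" if "d \<in> ?D" for d
    using that assms(2) by blast
qed

end

section \<open>Iterated operator series\<close>

lemma UNIV_int_split: "UNIV = range (\<lambda>n. - int (Suc n)) \<union> range int"
proof -
  have "m \<in> range (\<lambda>n. - int (Suc n)) \<union> range int" for m :: int
  proof (cases "m \<ge> 0")
    case True
    then show ?thesis using range_eqI[of m int "nat m"] by simp
  next
    case False
    then show ?thesis using range_eqI[of m "\<lambda>n. - int (Suc n)" "nat (- m) - 1"] by simp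
  qed
  then show ?thesis by blast
qed

context hilbert_space
begin

lemma op_sums_ip:
  assumes U: "\<And>q. bounded_op H (U q)" and T: "op_sums H U T"
    and xy: "x \<in> vectors H" "y \<in> vectors H"
  shows "(\<lambda>q. ip H (U q x) y) sums ip H (T x) y"
proof -
  have T1: "bounded_op H T" and T2: "(\<lambda>p. op_norm H ((\<Sum>q<p. U q) - T)) \<longlonglongrightarrow> 0"
    using T by (auto simp: op_sums_def)
  have bd: "cmod ((\<Sum>q<p. ip H (U q x) y) - ip H (T x) y)
      \<le> op_norm H ((\<Sum>q<p. U q) - T) * hnorm H x * hnorm H y" for p
  proof -
    have D: "bounded_op H ((\<Sum>q<p. U q) - T)"
      by (intro bounded_op_minus bounded_op_fsum U T1)
    have V: "U q x \<in> vectors H" "T x \<in> vectors H" for q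
      using xy U T1 by (auto simp: bounded_op_closed)
    have "(\<Sum>q<p. ip H (U q x) y) - ip H (T x) y = ip H (((\<Sum>q<p. U q) - T) x) y"
      using V xy by (simp add: fun_apply sum_fun_eval ip.diff_left ip.sum_left V_sum)
    also have "cmod \<dots> \<le> hnorm H (((\<Sum>q<p. U q) - T) x) * hnorm H y"
      using D xy by (simp add: ip_bound bounded_op_closed)
    also have "\<dots> \<le> op_norm H ((\<Sum>q<p. U q) - T) * hnorm H x * hnorm H y"
      using op_norm_bound[OF D xy(1)] xy by (intro mult_right_mono) (auto simp: hnorm_nonneg)
    finally show ?thesis .
  qed
  have "(\<lambda>p. op_norm H ((\<Sum>q<p. U q) - T) * hnorm H x * hnorm H y) \<longlonglongrightarrow> 0 * hnorm H x * hnorm H y"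
    by (intro tendsto_intros T2)
  then have "(\<lambda>p. (\<Sum>q<p. ip H (U q x) y) - ip H (T x) y) \<longlonglongrightarrow> 0"
    using Lim_null_comparison[OF always_eventually[OF allI[OF bd]]] by simp
  then show ?thesis
    unfolding sums_def by (rule LIM_zero_cancel)
qed

lemma int_op_sums_ip:
  assumes U: "\<And>m. bounded_op H (U m)" and T: "int_op_sums H U T"
    and xy: "x \<in> vectors H" "y \<in> vectors H"
    and s: "((\<lambda>m. ip H (U m x) y) has_sum s) UNIV"
  shows "ip H (T x) y = s"
proof -
  obtain R S where R: "op_sums H (\<lambda>p. U (- int (Suc p))) R" and S: "op_sums H (\<lambda>p. U (int p)) S"
    and T: "T = R + S"
    using T by (auto simp: int_op_sums_def)
  let ?f = "\<lambda>m. ip H (U m x) y" and ?n = "\<lambda>p. - int (Suc p)"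
  have inj: "inj ?n" "inj int" by (auto simp: inj_on_def)
  have "?f summable_on range ?n" "?f summable_on range int"
    using s by (auto intro: summable_on_subset_banach has_sum_imp_summable)
  then have "(?f has_sum infsum ?f (range ?n)) (range ?n)" "(?f has_sum infsum ?f (range int)) (range int)"
    by auto
  moreover from this have "(\<lambda>p. ?f (?n p)) sums infsum ?f (range ?n)" "(\<lambda>p. ?f (int p)) sums infsum ?f (range int)"
    using inj by (auto simp: has_sum_reindex o_def intro: has_sum_imp_sums)
  then have "infsum ?f (range ?n) = ip H (R x) y" "infsum ?f (range int) = ip H (S x) y"
    using op_sums_ip[OF U R xy] op_sums_ip[OF U S xy] sums_unique2 by blast+
  moreover have "range ?n \<inter> range int = {}" by auto
  ultimately have "(?f has_sum (ip H (R x) y + ip H (S x) y)) UNIV"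
    by (subst UNIV_int_split, intro has_sum_Un_disjoint) simp_all
  then have "s = ip H (R x) y + ip H (S x) y"
    using s has_sum_unique by blast
  moreover have "R x \<in> vectors H" "S x \<in> vectors H"
    using R S xy by (auto simp: op_sums_def bounded_op_closed)
  ultimately show ?thesis
    using xy by (simp add: T fun_apply ip.add_left)
qed

lemma int_op_sums_bounded: "int_op_sums H U T \<Longrightarrow> bounded_op H T"
  by (auto simp: int_op_sums_def op_sums_def bounded_op_plus)

lemma iterated_op_sums_bounded:
  assumes "iterated_op_sums H k G T" "\<And>ms. length ms = k \<Longrightarrow> bounded_op H (G ms)"
  shows "bounded_op H T"
  using assms by (cases k) (auto intro: int_op_sums_bounded)

lemma iterated_op_sums_ip:
  assumes "iterated_op_sums H k G T" "\<And>ms. length ms = k \<Longrightarrow> bounded_op H (G ms)"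
    and xy: "x \<in> vectors H" "y \<in> vectors H"
    and "((\<lambda>ms. ip H (G ms x) y) has_sum s) {ms. length ms = k}"
  shows "ip H (T x) y = s"
  using assms(1,2,5)
proof (induction k arbitrary: G T s)
  case 0
  have "((\<lambda>ms. ip H (G ms x) y) has_sum ip H (T x) y) {ms. length ms = 0}"
    using 0 by (intro has_sum_finiteI) auto
  then show ?case using 0 has_sum_unique by blast
next
  case (Suc k)
  obtain U where U: "\<And>m. iterated_op_sums H k (\<lambda>ms. G (m # ms)) (U m)" and T: "int_op_sums H U T"
    using Suc.prems(1) by auto
  have UB: "bounded_op H (U m)" for m
    using iterated_op_sums_bounded[OF U] Suc.prems(2) by simp
  let ?g = "\<lambda>(m, ms). ip H (G (m # ms) x) y"
  have g: "(?g has_sum s) (UNIV \<times> {ms. length ms = k})"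
    by (subst has_sum_reindex_bij_witness[where T = "{ms. length ms = Suc k}"
          and i = "\<lambda>ms. (hd ms, tl ms)" and j = "\<lambda>(m, ms). m # ms" and s' = s
          and h = "\<lambda>ms. ip H (G ms x) y"])
      (use Suc.prems(3) in \<open>auto simp: length_Suc_conv\<close>)
  have row: "((\<lambda>ms. ?g (m, ms)) has_sum (\<Sum>\<^sub>\<infinity>ms\<in>{ms. length ms = k}. ?g (m, ms))) {ms. length ms = k}" for m
    using summable_on_SigmaD1[of "\<lambda>m ms. ip H (G (m # ms) x) y" UNIV "\<lambda>_. {ms. length ms = k}" m]
      has_sum_imp_summable[OF g] by simp
  have "ip H (U m x) y = (\<Sum>\<^sub>\<infinity>ms\<in>{ms. length ms = k}. ?g (m, ms))" for m
    using row[of m] Suc.prems(2) by (intro Suc.IH[OF U]) auto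
  then have "((\<lambda>m. ip H (U m x) y) has_sum s) UNIV"
    using has_sum_SigmaD[OF g row] by simp
  then show ?case
    by (rule int_op_sums_ip[OF UB T xy])
qed

end

section \<open>Multiwords\<close>

lemma in_listset_iff: "xs \<in> listset As \<longleftrightarrow> list_all2 (\<in>) xs As"
  by (induction As arbitrary: xs) (auto simp: set_Cons_def list_all2_Cons2)

lemma multiwords_Nil: "multiwords [] = {[]}"
  by (simp add: multiwords_def)

lemma multiwords_Cons:
  "multiwords (n # ns) = (\<lambda>(w, \<sigma>). w # \<sigma>) ` (lists {..<n} \<times> multiwords ns)"
  by (auto simp: multiwords_def set_Cons_def)

lemma Cons_in_multiwords [simp]:
  "w # \<sigma> \<in> multiwords (n # ns) \<longleftrightarrow> w \<in> lists {..<n} \<and> \<sigma> \<in> multiwords ns"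
  by (auto simp: multiwords_Cons)

lemma in_multiwords_iff:
  "\<sigma> \<in> multiwords ns \<longleftrightarrow> length \<sigma> = length ns \<and> (\<forall>i<length ns. \<sigma> ! i \<in> lists {..<ns ! i})"
  unfolding multiwords_def in_listset_iff list_all2_conv_all_nth
  by (simp cong: conj_cong)

lemma length_multiword: "\<sigma> \<in> multiwords ns \<Longrightarrow> length \<sigma> = length ns"
  by (simp add: in_multiwords_iff)

lemma level_words_Cons:
  "level_words (n # ns) (p # ps)
    = (\<lambda>(w, \<sigma>). w # \<sigma>) ` ({w \<in> lists {..<n}. length w = p} \<times> level_words ns ps)"
  by (auto simp: level_words_def multiwords_Cons)

lemma finite_words: "finite {w \<in> lists {..<n::nat}. length w = p}"
  using finite_lists_length_eq[of "{..<n}" p] by (simp add: lists_eq_set)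

lemma finite_level_words: "finite (level_words ns ps)"
proof (induction ns arbitrary: ps)
  case Nil
  show ?case by (rule finite_subset[of _ "{[]}"]) (auto simp: level_words_def multiwords_Nil)
next
  case (Cons n ns)
  show ?case
  proof (cases ps)
    case Nil
    have "level_words (n # ns) [] = {}" by (auto simp: level_words_def multiwords_Cons)
    then show ?thesis by (simp add: Nil)
  next
    case (Cons p ps')
    then show ?thesis using Cons.IH finite_words by (simp add: level_words_Cons)
  qed
qed

lemma level_words_subset: "level_words ns ps \<subseteq> multiwords ns"
  by (auto simp: level_words_def)

lemma level_words_disjoint: "ps \<noteq> qs \<Longrightarrow> level_words ns ps \<inter> level_words ns qs = {}"
  by (auto simp: level_words_def)

lemma in_level_words_iff:
  "\<sigma> \<in> level_words ns ps \<longleftrightarrow> length \<sigma> = length ns \<and> length ps = length ns \<and>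
    (\<forall>i<length ns. \<sigma> ! i \<in> lists {..<ns ! i} \<and> length (\<sigma> ! i) = ps ! i)"
  by (auto simp: level_words_def in_multiwords_iff list_eq_iff_nth_eq)

definition multi_append :: "multiword \<Rightarrow> multiword \<Rightarrow> multiword" (infixr "@@" 65)
  where "\<alpha> @@ \<omega> = map2 (@) \<alpha> \<omega>"

lemma multi_append_simps [simp]: "[] @@ \<omega> = []" "(w # \<alpha>) @@ (v # \<omega>) = (w @ v) # (\<alpha> @@ \<omega>)"
  by (simp_all add: multi_append_def)

lemma length_multi_append [simp]: "length (\<alpha> @@ \<omega>) = min (length \<alpha>) (length \<omega>)"
  by (simp add: multi_append_def)

lemma nth_multi_append [simp]:
  "\<lbrakk>i < length \<alpha>; i < length \<omega>\<rbrakk> \<Longrightarrow> (\<alpha> @@ \<omega>) ! i = \<alpha> ! i @ \<omega> ! i"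
  by (simp add: multi_append_def)

lemma rdiff_append [simp]: "rdiff (\<sigma> @ \<gamma>) \<gamma> = \<sigma>"
  by (simp add: rdiff_def)

lemma strict_suffix_append_iff: "strict_suffix \<gamma> (\<sigma> @ \<gamma>) \<longleftrightarrow> \<sigma> \<noteq> []"
  by (auto simp: strict_suffix_def suffix_def)

lemma c_plus_append: "\<alpha> = [] \<or> \<beta> = [] \<Longrightarrow> c_plus (\<alpha> @ \<omega>) (\<beta> @ \<omega>) = \<alpha>"
  by (auto simp: c_plus_def strict_suffix_append_iff dest: suffix_length_le simp: strict_suffix_def)

lemma c_minus_append: "\<alpha> = [] \<or> \<beta> = [] \<Longrightarrow> c_minus (\<alpha> @ \<omega>) (\<beta> @ \<omega>) = \<beta>"
  by (auto simp: c_minus_def strict_suffix_append_iff dest: suffix_length_le simp: strict_suffix_def)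

lemma comparable_append_cases:
  assumes "strict_suffix \<sigma> \<omega> \<or> strict_suffix \<omega> \<sigma> \<or> \<sigma> = \<omega>"
  obtains \<alpha> \<gamma> \<beta> where "\<sigma> = \<alpha> @ \<gamma>" "\<omega> = \<beta> @ \<gamma>" "\<alpha> = [] \<or> \<beta> = []"
proof -
  from assms consider \<alpha> where "\<omega> = \<alpha> @ \<sigma>" | \<alpha> where "\<sigma> = \<alpha> @ \<omega>"
    by (auto simp: strict_suffix_def suffix_def)
  then show ?thesis
  proof cases
    case (1 \<alpha>)
    then show ?thesis by (intro that[of "[]" \<sigma> \<alpha>]) auto
  next
    case (2 \<alpha>)
    then show ?thesis by (intro that[of \<alpha> \<omega> "[]"]) auto
  qed
qed

lemma comparable_append:
  "\<alpha> = [] \<or> \<beta> = [] \<Longrightarrow>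
    strict_suffix (\<alpha> @ \<omega>) (\<beta> @ \<omega>) \<or> strict_suffix (\<beta> @ \<omega>) (\<alpha> @ \<omega>) \<or> \<alpha> @ \<omega> = \<beta> @ \<omega>"
  by (auto simp: strict_suffix_append_iff)

lemma neg_pos_disjoint:
  assumes "\<alpha> \<in> neg_words ns ms" "\<beta> \<in> pos_words ns ms" "i < length ns"
  shows "\<alpha> ! i = [] \<or> \<beta> ! i = []"
proof (cases "ms ! i \<ge> 0")
  case True
  then have "length (\<alpha> ! i) = 0" using assms by (auto simp: in_level_words_iff)
  then show ?thesis by simp
next
  case False
  then have "length (\<beta> ! i) = 0" using assms by (auto simp: in_level_words_iff)
  then show ?thesis by simp
qed

lemma rcomparable_append:
  assumes "\<alpha> \<in> neg_words ns ms" "\<beta> \<in> pos_words ns ms" "length \<omega> = length ns"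
  shows "rcomparable (\<alpha> @@ \<omega>) (\<beta> @@ \<omega>)"
proof -
  have "length \<alpha> = length ns" "length \<beta> = length ns"
    using assms by (auto simp: in_level_words_iff)
  then show ?thesis
    unfolding rcomparable_def list_all2_conv_all_nth
    using assms(3) comparable_append[OF neg_pos_disjoint[OF assms(1,2)]] by simp
qed

lemma ph_kernel_append:
  assumes "\<alpha> \<in> neg_words ns ms" "\<beta> \<in> pos_words ns ms" "length \<omega> = length ns"
  shows "ph_kernel A (\<alpha> @@ \<omega>) (\<beta> @@ \<omega>) = A \<alpha> \<beta>"
proof -
  have len: "length \<alpha> = length ns" "length \<beta> = length ns"
    using assms by (auto simp: in_level_words_iff)
  note disj = neg_pos_disjoint[OF assms(1,2)]
  have "map2 c_plus (\<alpha> @@ \<omega>) (\<beta> @@ \<omega>) = \<alpha>" "map2 c_minus (\<alpha> @@ \<omega>) (\<beta> @@ \<omega>) = \<beta>"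
    by (rule nth_equalityI; simp add: len assms(3) c_plus_append c_minus_append disj)+
  then show ?thesis using rcomparable_append[OF assms] by (simp add: ph_kernel_def)
qed

lemma rcomparable_level_cases:
  assumes "rcomparable \<sigma> \<omega>" "\<sigma> \<in> multiwords ns" "\<omega> \<in> multiwords ns"
  obtains \<alpha> \<beta> \<gamma> where "\<sigma> = \<alpha> @@ \<gamma>" "\<omega> = \<beta> @@ \<gamma>" "\<gamma> \<in> multiwords ns"
    "\<alpha> \<in> neg_words ns (map2 (\<lambda>u v. int (length v) - int (length u)) \<sigma> \<omega>)"
    "\<beta> \<in> pos_words ns (map2 (\<lambda>u v. int (length v) - int (length u)) \<sigma> \<omega>)"
proof -
  have len: "length \<sigma> = length ns" "length \<omega> = length ns"
    using assms by (auto simp: length_multiword)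
  have "\<forall>i<length ns. \<exists>\<alpha> \<beta> \<gamma>. \<sigma> ! i = \<alpha> @ \<gamma> \<and> \<omega> ! i = \<beta> @ \<gamma> \<and> (\<alpha> = [] \<or> \<beta> = [])"
    using assms(1) len unfolding rcomparable_def list_all2_conv_all_nth
    by (metis comparable_append_cases)
  then obtain a b g where abg: "\<And>i. i < length ns \<Longrightarrow> \<sigma> ! i = a i @ g i" "\<And>i. i < length ns \<Longrightarrow> \<omega> ! i = b i @ g i"
      "\<And>i. i < length ns \<Longrightarrow> a i = [] \<or> b i = []"
    by metis
  define \<alpha> where "\<alpha> = map a [0..<length ns]"
  define \<beta> where "\<beta> = map b [0..<length ns]"
  define \<gamma> where "\<gamma> = map g [0..<length ns]"
  note defs = \<alpha>_def \<beta>_def \<gamma>_def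
  have W: "a i \<in> lists {..<ns ! i}" "b i \<in> lists {..<ns ! i}" "g i \<in> lists {..<ns ! i}"
    if "i < length ns" for i
    using that assms(2,3) abg(1,2)[OF that] by (auto simp: in_multiwords_iff)
  have L: "length (a i) = nat (- (int (length (\<omega> ! i)) - int (length (\<sigma> ! i))))"
    "length (b i) = nat (int (length (\<omega> ! i)) - int (length (\<sigma> ! i)))" if "i < length ns" for i
    using abg(1,2)[OF that] abg(3)[OF that] by auto
  show ?thesis
  proof
    show "\<sigma> = \<alpha> @@ \<gamma>" "\<omega> = \<beta> @@ \<gamma>"
      by (rule nth_equalityI; simp add: len abg(1,2) defs)+
    show "\<gamma> \<in> multiwords ns"
      using W by (simp add: in_multiwords_iff defs)
    show "\<alpha> \<in> neg_words ns (map2 (\<lambda>u v. int (length v) - int (length u)) \<sigma> \<omega>)"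
      using W L len by (simp add: in_level_words_iff defs)
    show "\<beta> \<in> pos_words ns (map2 (\<lambda>u v. int (length v) - int (length u)) \<sigma> \<omega>)"
      using W L len by (simp add: in_level_words_iff defs)
  qed
qed

section \<open>Defect forms\<close>

type_synonym 'v form = "'v \<Rightarrow> 'v \<Rightarrow> complex"

definition lift_form :: "nat \<Rightarrow> (nat \<Rightarrow> 'v \<Rightarrow> 'v) \<Rightarrow> 'v form \<Rightarrow> 'v form"
  where "lift_form n c b = (\<lambda>x y. \<Sum>j<n. b (c j x) (c j y))"

text \<open>
  If \<open>a i j\<close> is the adjoint of \<open>X\<^sub>i\<^sub>,\<^sub>j\<close> and \<open>b\<close> is the inner product, \<open>defect ns a b\<close> is the form
  of the operator \<open>\<Delta>\<^sub>X(I)\<close>; working with forms removes the operators \<open>X\<^sub>i\<^sub>,\<^sub>j\<close> themselves.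
\<close>

fun defect :: "nat list \<Rightarrow> (nat \<Rightarrow> nat \<Rightarrow> 'v \<Rightarrow> 'v) \<Rightarrow> 'v form \<Rightarrow> 'v form"
  where
    "defect [] a b = b"
  | "defect (n # ns) a b = (\<lambda>x y. defect ns (\<lambda>i. a (Suc i)) b x y
      - lift_form n (a 0) (defect ns (\<lambda>i. a (Suc i)) b) x y)"

fun act :: "(nat \<Rightarrow> nat \<Rightarrow> 'v \<Rightarrow> 'v) \<Rightarrow> multiword \<Rightarrow> 'v \<Rightarrow> 'v"
  where
    "act a [] = id"
  | "act a (w # \<sigma>) = fold (a 0) w \<circ> act (\<lambda>i. a (Suc i)) \<sigma>"

definition commuting_rows :: "nat list \<Rightarrow> (nat \<Rightarrow> nat \<Rightarrow> 'v \<Rightarrow> 'v) \<Rightarrow> bool"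
  where "commuting_rows ns a \<longleftrightarrow> (\<forall>i<length ns. \<forall>j<length ns. i \<noteq> j \<longrightarrow>
    (\<forall>p<ns ! i. \<forall>q<ns ! j. \<forall>x. a i p (a j q x) = a j q (a i p x)))"

lemma commuting_rows_Cons:
  assumes "commuting_rows (n # ns) a"
  shows "commuting_rows ns (\<lambda>i. a (Suc i))"
    and "\<And>i p q x. \<lbrakk>i < length ns; p < ns ! i; q < n\<rbrakk> \<Longrightarrow> a 0 q (a (Suc i) p x) = a (Suc i) p (a 0 q x)"
proof -
  show "commuting_rows ns (\<lambda>i. a (Suc i))"
    unfolding commuting_rows_def
  proof (intro allI impI)
    fix i j p q x assume "i < length ns" "j < length ns" "i \<noteq> j" "p < ns ! i" "q < ns ! j"
    then show "a (Suc i) p (a (Suc j) q x) = a (Suc j) q (a (Suc i) p x)"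
      using assms[unfolded commuting_rows_def, rule_format, of "Suc i" "Suc j" p q x] by simp
  qed
  show "a 0 q (a (Suc i) p x) = a (Suc i) p (a 0 q x)" if "i < length ns" "p < ns ! i" "q < n" for i p q x
    using assms[unfolded commuting_rows_def, rule_format, of 0 "Suc i" q p x] that by simp
qed

lemma lift_form_diff:
  "lift_form n c (\<lambda>x y. b x y - b' x y) = (\<lambda>x y. lift_form n c b x y - lift_form n c b' x y)"
  by (simp add: lift_form_def sum_subtractf)

lemma lift_form_swap:
  assumes "\<And>j k x. \<lbrakk>j < n; k < m\<rbrakk> \<Longrightarrow> c j (d k x) = d k (c j x)"
  shows "lift_form n c (lift_form m d b) = lift_form m d (lift_form n c b)"
proof (intro ext)
  fix x y
  have "lift_form n c (lift_form m d b) x y = (\<Sum>j<n. \<Sum>k<m. b (c j (d k x)) (c j (d k y)))"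
    unfolding lift_form_def using assms by (intro sum.cong refl) simp
  also have "\<dots> = lift_form m d (lift_form n c b) x y"
    unfolding lift_form_def by (rule sum.swap)
  finally show "lift_form n c (lift_form m d b) x y = lift_form m d (lift_form n c b) x y" .
qed

lemma defect_diff:
  "defect ns a (\<lambda>x y. b x y - b' x y) = (\<lambda>x y. defect ns a b x y - defect ns a b' x y)"
proof (induction ns arbitrary: a)
  case (Cons n ns)
  show ?case
    by (simp only: defect.simps Cons.IH lift_form_diff) (simp add: fun_eq_iff)
qed simp

lemma lift_form_defect:
  assumes "\<And>i p q x. \<lbrakk>i < length ns; p < ns ! i; q < n\<rbrakk> \<Longrightarrow> c q (a i p x) = a i p (c q x)"
  shows "lift_form n c (defect ns a b) = defect ns a (lift_form n c b)"
  using assms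
proof (induction ns arbitrary: a)
  case (Cons m ns)
  have "lift_form n c (defect ns (\<lambda>i. a (Suc i)) b) = defect ns (\<lambda>i. a (Suc i)) (lift_form n c b)"
    using Cons.prems[of "Suc _"] by (intro Cons.IH) simp
  moreover have "lift_form n c (lift_form m (a 0) (defect ns (\<lambda>i. a (Suc i)) b))
      = lift_form m (a 0) (lift_form n c (defect ns (\<lambda>i. a (Suc i)) b))"
    using Cons.prems[of 0] by (intro lift_form_swap) simp
  ultimately show ?case
    by (simp add: lift_form_diff)
qed simp

lemma lift_form_power_defect:
  assumes "\<And>i p q x. \<lbrakk>i < length ns; p < ns ! i; q < n\<rbrakk> \<Longrightarrow> c q (a i p x) = a i p (c q x)"
  shows "(lift_form n c ^^ N) (defect ns a b) = defect ns a ((lift_form n c ^^ N) b)"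
proof (induction N)
  case (Suc N)
  have "lift_form n c (defect ns a b') = defect ns a (lift_form n c b')" for b' :: "'a form"
    by (rule lift_form_defect) (use assms in blast)
  then show ?case by (simp add: Suc)
qed simp

lemma words_Suc_eq:
  "{w \<in> lists {..<n::nat}. length w = Suc N} = (\<lambda>(j, w). j # w) ` ({..<n} \<times> {w \<in> lists {..<n}. length w = N})"
  by (auto simp: length_Suc_conv image_iff)

lemma lift_form_power:
  "(lift_form n c ^^ N) b x y = (\<Sum>w\<in>{w \<in> lists {..<n}. length w = N}. b (fold c w x) (fold c w y))"
proof (induction N arbitrary: x y)
  case 0
  have "{w \<in> lists {..<n::nat}. length w = 0} = {[]}" by auto
  then show ?case by (simp only: funpow.simps id_apply) simp
next
  case (Suc N)
  let ?W = "\<lambda>N. {w \<in> lists {..<n}. length w = N}"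
  have "(lift_form n c ^^ Suc N) b x y = (\<Sum>j<n. \<Sum>w\<in>?W N. b (fold c w (c j x)) (fold c w (c j y)))"
    unfolding funpow.simps o_apply lift_form_def[of n c "(lift_form n c ^^ N) b"] Suc.IH ..
  also have "\<dots> = (\<Sum>(j, w)\<in>{..<n} \<times> ?W N. b (fold c (j # w) x) (fold c (j # w) y))"
    using finite_words by (subst sum.cartesian_product) simp
  also have "\<dots> = (\<Sum>w\<in>?W (Suc N). b (fold c w x) (fold c w y))"
    unfolding words_Suc_eq by (subst sum.reindex) (auto simp: inj_on_def split_beta)
  finally show ?case .
qed

lemma short_words_eq: "{w \<in> lists {..<n::nat}. length w < N} = (\<Union>d<N. {w \<in> lists {..<n}. length w = d})"
  by auto

lemma finite_short_words: "finite {w \<in> lists {..<n::nat}. length w < N}"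
  unfolding short_words_eq using finite_words by blast

lemma lift_form_telescope:
  "(\<Sum>w\<in>{w \<in> lists {..<n}. length w < N}.
      b (fold c w x) (fold c w y) - lift_form n c b (fold c w x) (fold c w y))
    = b x y - (lift_form n c ^^ N) b x y"
proof -
  let ?d = "\<lambda>x y. b x y - lift_form n c b x y"
  have diff: "(lift_form n c ^^ d) ?d = (\<lambda>x y. (lift_form n c ^^ d) b x y - (lift_form n c ^^ Suc d) b x y)" for d
  proof (induction d)
    case (Suc d)
    then show ?case by (simp add: lift_form_diff)
  qed simp
  have "(\<Sum>w\<in>{w \<in> lists {..<n}. length w < N}. ?d (fold c w x) (fold c w y))
      = (\<Sum>d<N. (lift_form n c ^^ d) ?d x y)"
    unfolding short_words_eq lift_form_power by (rule sum.UNION_disjoint) (auto simp: finite_words)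
  also have "\<dots> = b x y - (lift_form n c ^^ N) b x y"
    unfolding diff by (induction N) simp_all
  finally show ?thesis .
qed

definition word_box :: "nat \<Rightarrow> nat list \<Rightarrow> multiword set"
  where "word_box N ns = {\<sigma> \<in> multiwords ns. \<forall>w\<in>set \<sigma>. length w < N}"

lemma word_box_Nil: "word_box N [] = {[]}"
  by (auto simp: word_box_def multiwords_Nil)

lemma word_box_Cons: "word_box N (n # ns) = (\<lambda>(w, \<sigma>). w # \<sigma>) ` ({w \<in> lists {..<n}. length w < N} \<times> word_box N ns)"
  by (auto simp: word_box_def multiwords_Cons)

lemma finite_word_box: "finite (word_box N ns)"
  by (induction ns) (simp_all add: word_box_Nil word_box_Cons finite_short_words)

fun telescoped :: "nat \<Rightarrow> nat list \<Rightarrow> (nat \<Rightarrow> nat \<Rightarrow> 'v \<Rightarrow> 'v) \<Rightarrow> 'v form \<Rightarrow> 'v form"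
  where
    "telescoped N [] a b = b"
  | "telescoped N (n # ns) a b =
      telescoped N ns (\<lambda>i. a (Suc i)) (\<lambda>x y. b x y - (lift_form n (a 0) ^^ N) b x y)"

lemma box_sum_defect:
  assumes "commuting_rows ns a"
  shows "(\<Sum>\<sigma>\<in>word_box N ns. defect ns a b (act a \<sigma> x) (act a \<sigma> y)) = telescoped N ns a b x y"
  using assms
proof (induction ns arbitrary: a b)
  case Nil
  show ?case by (simp add: word_box_Nil)
next
  case (Cons n ns)
  note comm = commuting_rows_Cons[OF Cons.prems]
  let ?a = "\<lambda>i. a (Suc i)" and ?W = "{w \<in> lists {..<n}. length w < N}"
  let ?c = "defect ns ?a b" and ?L = "lift_form n (a 0)"
  have "(\<Sum>\<sigma>\<in>word_box N (n # ns). defect (n # ns) a b (act a \<sigma> x) (act a \<sigma> y))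
      = (\<Sum>(w, \<sigma>)\<in>?W \<times> word_box N ns. defect (n # ns) a b (fold (a 0) w (act ?a \<sigma> x)) (fold (a 0) w (act ?a \<sigma> y)))"
    unfolding word_box_Cons by (subst sum.reindex) (auto simp: inj_on_def split_beta simp del: defect.simps)
  also have "\<dots> = (\<Sum>w\<in>?W. \<Sum>\<sigma>\<in>word_box N ns.
      defect (n # ns) a b (fold (a 0) w (act ?a \<sigma> x)) (fold (a 0) w (act ?a \<sigma> y)))"
    by (rule sum.cartesian_product[symmetric])
  also have "\<dots> = (\<Sum>\<sigma>\<in>word_box N ns. \<Sum>w\<in>?W.
      defect (n # ns) a b (fold (a 0) w (act ?a \<sigma> x)) (fold (a 0) w (act ?a \<sigma> y)))"
    by (rule sum.swap)
  also have "\<dots> = (\<Sum>\<sigma>\<in>word_box N ns. ?c (act ?a \<sigma> x) (act ?a \<sigma> y) - (?L ^^ N) ?c (act ?a \<sigma> x) (act ?a \<sigma> y))"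
    by (simp only: defect.simps lift_form_telescope)
  also have "(?L ^^ N) ?c = defect ns ?a ((?L ^^ N) b)"
    by (rule lift_form_power_defect) (use comm(2) in blast)
  also have "(\<Sum>\<sigma>\<in>word_box N ns. ?c (act ?a \<sigma> x) (act ?a \<sigma> y) - defect ns ?a ((?L ^^ N) b) (act ?a \<sigma> x) (act ?a \<sigma> y))
      = (\<Sum>\<sigma>\<in>word_box N ns. defect ns ?a (\<lambda>x y. b x y - (?L ^^ N) b x y) (act ?a \<sigma> x) (act ?a \<sigma> y))"
    by (simp only: defect_diff)
  also have "\<dots> = telescoped N (n # ns) a b x y"
    by (simp only: telescoped.simps Cons.IH[OF comm(1)])
  finally show ?case .
qed

section \<open>Bounds for forms\<close>

locale row_contractions = hilbert_space H for H :: "'i hilbert" +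
  fixes ns :: "nat list" and a :: "nat \<Rightarrow> nat \<Rightarrow> 'i cop" and q :: real
  assumes a_closed: "\<lbrakk>i < length ns; j < ns ! i; x \<in> vectors H\<rbrakk> \<Longrightarrow> a i j x \<in> vectors H"
    and a_contr: "\<lbrakk>i < length ns; x \<in> vectors H\<rbrakk>
      \<Longrightarrow> (\<Sum>j<ns ! i. (hnorm H (a i j x))\<^sup>2) \<le> q * (hnorm H x)\<^sup>2"
    and q: "0 \<le> q" "q < 1"
    and a_add: "\<lbrakk>i < length ns; j < ns ! i; x \<in> vectors H; y \<in> vectors H\<rbrakk>
      \<Longrightarrow> a i j (x + y) = a i j x + a i j y"
    and a_scale: "\<lbrakk>i < length ns; j < ns ! i; x \<in> vectors H\<rbrakk> \<Longrightarrow> a i j (c \<cdot>\<^sub>C x) = c \<cdot>\<^sub>C a i j x"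

lemma row_contractions_Cons:
  assumes "row_contractions H (n # ns) a q"
  shows "row_contractions H ns (\<lambda>i. a (Suc i)) q"
    and "\<And>j x. \<lbrakk>j < n; x \<in> vectors H\<rbrakk> \<Longrightarrow> a 0 j x \<in> vectors H"
    and "\<And>x. x \<in> vectors H \<Longrightarrow> (\<Sum>j<n. (hnorm H (a 0 j x))\<^sup>2) \<le> q * (hnorm H x)\<^sup>2"
proof -
  interpret row_contractions H "n # ns" a q by (rule assms)
  show "row_contractions H ns (\<lambda>i. a (Suc i)) q"
    using a_closed[of "Suc _"] a_contr[of "Suc _"] q a_add[of "Suc _"] a_scale[of "Suc _"]
    by unfold_locales auto
  show "\<And>j x. \<lbrakk>j < n; x \<in> vectors H\<rbrakk> \<Longrightarrow> a 0 j x \<in> vectors H"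
    using a_closed[of 0] by simp
  show "\<And>x. x \<in> vectors H \<Longrightarrow> (\<Sum>j<n. (hnorm H (a 0 j x))\<^sup>2) \<le> q * (hnorm H x)\<^sup>2"
    using a_contr[of 0] by simp
qed

definition form_bound :: "'i hilbert \<Rightarrow> real \<Rightarrow> 'i cfun form \<Rightarrow> bool"
  where "form_bound H C b \<longleftrightarrow> 0 \<le> C \<and>
    (\<forall>x\<in>vectors H. \<forall>y\<in>vectors H. cmod (b x y) \<le> C * (hnorm H x * hnorm H y))"

context hilbert_space
begin

lemma form_bound_lift:
  assumes b: "form_bound H C b" and c: "\<And>j x. \<lbrakk>j < n; x \<in> vectors H\<rbrakk> \<Longrightarrow> c j x \<in> vectors H"
    and contr: "\<And>x. x \<in> vectors H \<Longrightarrow> (\<Sum>j<n. (hnorm H (c j x))\<^sup>2) \<le> q * (hnorm H x)\<^sup>2"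
    and q: "0 \<le> q"
  shows "form_bound H (q * C) (lift_form n c b)"
  unfolding form_bound_def
proof (intro conjI ballI)
  show "0 \<le> q * C" using b q by (simp add: form_bound_def)
  fix x y assume xy: "x \<in> vectors H" "y \<in> vectors H"
  have "cmod (lift_form n c b x y) \<le> (\<Sum>j<n. C * (hnorm H (c j x) * hnorm H (c j y)))"
    unfolding lift_form_def using b c xy by (intro sum_norm_le) (auto simp: form_bound_def)
  also have "\<dots> = C * (\<Sum>j<n. hnorm H (c j x) * hnorm H (c j y))"
    by (simp add: sum_distrib_left)
  also have "\<dots> \<le> C * (q * (hnorm H x * hnorm H y))"
  proof (rule mult_left_mono[OF power2_le_imp_le])
    have "(\<Sum>j<n. hnorm H (c j x) * hnorm H (c j y))\<^sup>2
        \<le> (\<Sum>j<n. (hnorm H (c j x))\<^sup>2) * (\<Sum>j<n. (hnorm H (c j y))\<^sup>2)"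
      by (rule Cauchy_Schwarz_ineq_sum)
    also have "\<dots> \<le> (q * (hnorm H x)\<^sup>2) * (q * (hnorm H y)\<^sup>2)"
      using contr xy q by (intro mult_mono) (auto intro: sum_nonneg)
    finally show "(\<Sum>j<n. hnorm H (c j x) * hnorm H (c j y))\<^sup>2 \<le> (q * (hnorm H x * hnorm H y))\<^sup>2"
      by (simp add: power2_eq_square mult_ac)
  qed (use b q xy in \<open>simp_all add: form_bound_def hnorm_nonneg\<close>)
  finally show "cmod (lift_form n c b x y) \<le> q * C * (hnorm H x * hnorm H y)"
    by (simp add: mult_ac)
qed

lemma form_bound_lift_power:
  assumes "form_bound H C b" "\<And>j x. \<lbrakk>j < n; x \<in> vectors H\<rbrakk> \<Longrightarrow> c j x \<in> vectors H"
    and "\<And>x. x \<in> vectors H \<Longrightarrow> (\<Sum>j<n. (hnorm H (c j x))\<^sup>2) \<le> q * (hnorm H x)\<^sup>2" "0 \<le> q"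
  shows "form_bound H (q ^ N * C) ((lift_form n c ^^ N) b)"
proof (induction N)
  case (Suc N)
  then show ?case using form_bound_lift[OF Suc assms(2,3,4)] by (simp add: mult.assoc)
qed (use assms in simp)

lemma form_bound_diff:
  assumes "form_bound H C b" "form_bound H D d"
  shows "form_bound H (C + D) (\<lambda>x y. b x y - d x y)"
  unfolding form_bound_def
proof (intro conjI ballI)
  show "0 \<le> C + D" using assms by (simp add: form_bound_def)
  fix x y assume xy: "x \<in> vectors H" "y \<in> vectors H"
  have "cmod (b x y - d x y) \<le> cmod (b x y) + cmod (d x y)" by (rule norm_triangle_ineq4)
  then show "cmod (b x y - d x y) \<le> (C + D) * (hnorm H x * hnorm H y)"
    using assms xy unfolding form_bound_def distrib_right by force
qed

lemma form_bound_ip: "form_bound H 1 (ip H)"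
  by (simp add: form_bound_def ip_bound)

end

lemma telescoped_bound:
  assumes "row_contractions H ns a q" "form_bound H C b"
  shows "form_bound H (C * ((1 + q ^ N) ^ length ns - 1)) (\<lambda>x y. telescoped N ns a b x y - b x y)"
  using assms
proof (induction ns arbitrary: a b C)
  case Nil
  then show ?case by (simp add: form_bound_def)
next
  case (Cons n ns)
  interpret row_contractions H "n # ns" a q by (rule Cons.prems)
  note c = row_contractions_Cons[OF Cons.prems(1)]
  let ?k = "length ns" and ?Q = "q ^ N"
  let ?L = "(lift_form n (a 0) ^^ N) b" and ?a = "\<lambda>i. a (Suc i)"
  let ?b = "\<lambda>x y. b x y - ?L x y"
  have L: "form_bound H (?Q * C) ?L"
    by (rule form_bound_lift_power[OF Cons.prems(2) c(2,3) q(1)])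
  have b: "form_bound H (C + ?Q * C) ?b"
    by (rule form_bound_diff[OF Cons.prems(2) L])
  have "form_bound H ((C + ?Q * C) * ((1 + ?Q) ^ ?k - 1) + ?Q * C)
      (\<lambda>x y. (telescoped N ns ?a ?b x y - ?b x y) - ?L x y)"
    by (rule form_bound_diff[OF Cons.IH[OF c(1) b] L])
  moreover have "(C + ?Q * C) * ((1 + ?Q) ^ ?k - 1) + ?Q * C = C * ((1 + ?Q) ^ length (n # ns) - 1)"
    by (simp add: algebra_simps)
  moreover have "(\<lambda>x y. (telescoped N ns ?a ?b x y - ?b x y) - ?L x y)
      = (\<lambda>x y. telescoped N (n # ns) a b x y - b x y)"
    by (simp add: fun_eq_iff)
  ultimately show ?case by simp
qed

context row_contractions
begin

lemma box_sum_limit: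
  assumes "commuting_rows ns a" "x \<in> vectors H" "y \<in> vectors H"
  shows "(\<lambda>N. \<Sum>\<sigma>\<in>word_box N ns. defect ns a (ip H) (act a \<sigma> x) (act a \<sigma> y)) \<longlonglongrightarrow> ip H x y"
proof -
  have "(\<lambda>N. ((1 + q ^ N) ^ length ns - 1) * (hnorm H x * hnorm H y))
      \<longlonglongrightarrow> ((1 + 0) ^ length ns - 1) * (hnorm H x * hnorm H y)"
    using q by (intro tendsto_intros LIMSEQ_realpow_zero) auto
  then have lim: "(\<lambda>N. ((1 + q ^ N) ^ length ns - 1) * (hnorm H x * hnorm H y)) \<longlonglongrightarrow> 0"
    by simp
  have "cmod (telescoped N ns a (ip H) x y - ip H x y) \<le> ((1 + q ^ N) ^ length ns - 1) * (hnorm H x * hnorm H y)" for N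
    using telescoped_bound[OF row_contractions_axioms form_bound_ip, of N] assms(2,3)
    by (simp add: form_bound_def)
  then have "(\<lambda>N. telescoped N ns a (ip H) x y - ip H x y) \<longlonglongrightarrow> 0"
    by (intro Lim_null_comparison[OF _ lim] always_eventually) auto
  then show ?thesis
    unfolding box_sum_defect[OF assms(1)] by (rule LIM_zero_cancel)
qed

end

lemma defect_sesq_form:
  assumes "sesq_form V b"
    and "\<And>i j x. \<lbrakk>i < length ns; j < ns ! i; x \<in> V\<rbrakk> \<Longrightarrow> a i j x \<in> V"
    and "\<And>i j x y. \<lbrakk>i < length ns; j < ns ! i; x \<in> V; y \<in> V\<rbrakk> \<Longrightarrow> a i j (x + y) = a i j x + a i j y"
    and "\<And>i j c x. \<lbrakk>i < length ns; j < ns ! i; x \<in> V\<rbrakk> \<Longrightarrow> a i j (c \<cdot>\<^sub>C x) = c \<cdot>\<^sub>C a i j x"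
  shows "sesq_form V (defect ns a b)"
  using assms(2-)
proof (induction ns arbitrary: a)
  case Nil
  then show ?case using assms(1) by simp
next
  case (Cons n ns)
  interpret d: sesq_form V "defect ns (\<lambda>i. a (Suc i)) b"
    using Cons.prems[of "Suc _"] by (intro Cons.IH) auto
  have 0: "a 0 j x \<in> V" "a 0 j (x + y) = a 0 j x + a 0 j y" "a 0 j (c \<cdot>\<^sub>C x) = c \<cdot>\<^sub>C a 0 j x"
    if "j < n" "x \<in> V" "y \<in> V" for j c x y
    using Cons.prems(1)[of 0 j] Cons.prems(2)[of 0 j] Cons.prems(3)[of 0 j] that by auto
  show ?case
  proof unfold_locales
    fix x y assume xy: "x \<in> V" "y \<in> V"
    have "lift_form n (a 0) (defect ns (\<lambda>i. a (Suc i)) b) y x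
        = cnj (lift_form n (a 0) (defect ns (\<lambda>i. a (Suc i)) b) x y)"
      unfolding lift_form_def cnj_sum using 0 xy by (intro sum.cong refl d.herm) auto
    then show "defect (n # ns) a b y x = cnj (defect (n # ns) a b x y)"
      using d.herm[OF xy] by simp
  qed (simp_all add: lift_form_def 0 d.add_left d.scale_left sum.distrib sum_distrib_left
      right_diff_distrib)
qed

lemma defect_scaled_close:
  fixes t :: real
  assumes H: "row_contractions H ns a q" and t: "1 \<le> t"
  shows "\<forall>x\<in>vectors H. cmod (defect ns a (ip H) x x) \<le> 2 ^ length ns * (hnorm H x)\<^sup>2 \<and>
    cmod (defect ns (\<lambda>i j x. of_real t \<cdot>\<^sub>C a i j x) (ip H) x x - defect ns a (ip H) x x)
      \<le> ((1 + t\<^sup>2) ^ length ns - 2 ^ length ns) * (hnorm H x)\<^sup>2"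
  using H
proof (induction ns arbitrary: a)
  case Nil
  then interpret row_contractions H "[]" a q by simp
  show ?case by (simp add: ip_self norm_power)
next
  case (Cons n ns)
  interpret row_contractions H "n # ns" a q by (rule Cons.prems)
  note c = row_contractions_Cons[OF Cons.prems]
  let ?k = "length ns" and ?a = "\<lambda>i. a (Suc i)"
  let ?b = "defect ns ?a (ip H)"
  let ?bt = "defect ns (\<lambda>i j x. of_real t \<cdot>\<^sub>C ?a i j x) (ip H)"
  have IHall: "\<forall>x\<in>vectors H. cmod (?b x x) \<le> 2 ^ ?k * (hnorm H x)\<^sup>2 \<and>
    cmod (?bt x x - ?b x x) \<le> ((1 + t\<^sup>2) ^ ?k - 2 ^ ?k) * (hnorm H x)\<^sup>2"
    by (rule Cons.IH[OF c(1)])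
  have IH: "cmod (?b x x) \<le> 2 ^ ?k * (hnorm H x)\<^sup>2"
    "cmod (?bt x x - ?b x x) \<le> ((1 + t\<^sup>2) ^ ?k - 2 ^ ?k) * (hnorm H x)\<^sup>2" if "x \<in> vectors H" for x
    using IHall that by simp_all
  interpret c: row_contractions H ns ?a q by (rule c(1))
  interpret bt: sesq_form "vectors H" ?bt
    by (intro defect_sesq_form ip.sesq_form_axioms)
      (simp_all add: V_scale c.a_closed c.a_add c.a_scale cscale_algebra mult.commute)
  show ?case
  proof
    fix x assume x: "x \<in> vectors H"
    have sum: "(\<Sum>j<n. (hnorm H (a 0 j x))\<^sup>2) \<le> (hnorm H x)\<^sup>2"
      using c(3)[OF x] q mult_right_mono[of q 1 "(hnorm H x)\<^sup>2"] by simp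
    have "cmod (lift_form n (a 0) ?b x x) \<le> (\<Sum>j<n. 2 ^ ?k * (hnorm H (a 0 j x))\<^sup>2)"
      unfolding lift_form_def using IH(1) c(2) x by (intro sum_norm_le) auto
    also have "\<dots> \<le> 2 ^ ?k * (hnorm H x)\<^sup>2"
      using sum by (simp add: sum_distrib_left[symmetric])
    finally have L: "cmod (lift_form n (a 0) ?b x x) \<le> 2 ^ ?k * (hnorm H x)\<^sup>2" .
    have 1: "cmod (defect (n # ns) a (ip H) x x) \<le> 2 ^ ?k * (hnorm H x)\<^sup>2 + 2 ^ ?k * (hnorm H x)\<^sup>2"
      using norm_triangle_ineq4[of "?b x x" "lift_form n (a 0) ?b x x"] IH(1)[OF x] L by simp
    have hom: "?bt (of_real t \<cdot>\<^sub>C y) (of_real t \<cdot>\<^sub>C y) = of_real (t\<^sup>2) * ?bt y y" if "y \<in> vectors H" for y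
      using that by (simp add: bt.scale_left bt.scale_right V_scale power2_eq_square)
    have t2: "1 \<le> t\<^sup>2" using t by simp
    then have t20: "0 \<le> t\<^sup>2" and t21: "0 \<le> t\<^sup>2 - 1" by simp_all
    define M where "M = t\<^sup>2 * ((1 + t\<^sup>2) ^ ?k - 2 ^ ?k) + (t\<^sup>2 - 1) * 2 ^ ?k"
    have M: "0 \<le> M" using t2 power_mono[of 2 "1 + t\<^sup>2" ?k] by (simp add: M_def)
    have "cmod (lift_form n (\<lambda>j x. of_real t \<cdot>\<^sub>C a 0 j x) ?bt x x - lift_form n (a 0) ?b x x)
        \<le> (\<Sum>j<n. M * (hnorm H (a 0 j x))\<^sup>2)"
      unfolding lift_form_def sum_subtractf[symmetric]
    proof (rule sum_norm_le)
      fix j assume "j \<in> {..<n}"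
      then have y: "a 0 j x \<in> vectors H" using c(2) x by auto
      let ?y = "a 0 j x"
      have eq: "?bt (of_real t \<cdot>\<^sub>C ?y) (of_real t \<cdot>\<^sub>C ?y) - ?b ?y ?y
          = of_real (t\<^sup>2) * (?bt ?y ?y - ?b ?y ?y) + of_real (t\<^sup>2 - 1) * ?b ?y ?y"
        unfolding hom[OF y] by (simp add: algebra_simps)
      have "cmod (?bt (of_real t \<cdot>\<^sub>C ?y) (of_real t \<cdot>\<^sub>C ?y) - ?b ?y ?y)
          \<le> t\<^sup>2 * cmod (?bt ?y ?y - ?b ?y ?y) + (t\<^sup>2 - 1) * cmod (?b ?y ?y)"
        unfolding eq using t2 by (intro norm_triangle_le) (simp add: norm_mult del: of_real_diff of_real_power)
      also have "\<dots> \<le> t\<^sup>2 * (((1 + t\<^sup>2) ^ ?k - 2 ^ ?k) * (hnorm H ?y)\<^sup>2) + (t\<^sup>2 - 1) * (2 ^ ?k * (hnorm H ?y)\<^sup>2)"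
        by (rule add_mono[OF mult_left_mono[OF IH(2)[OF y] t20] mult_left_mono[OF IH(1)[OF y] t21]])
      also have "\<dots> = M * (hnorm H ?y)\<^sup>2" by (simp add: M_def algebra_simps)
      finally show "cmod (?bt (of_real t \<cdot>\<^sub>C ?y) (of_real t \<cdot>\<^sub>C ?y) - ?b ?y ?y) \<le> M * (hnorm H ?y)\<^sup>2" .
    qed
    also have "\<dots> \<le> M * (hnorm H x)\<^sup>2"
      using sum M by (simp add: sum_distrib_left[symmetric] mult_left_mono)
    finally have L2: "cmod (lift_form n (\<lambda>j x. of_real t \<cdot>\<^sub>C a 0 j x) ?bt x x - lift_form n (a 0) ?b x x)
        \<le> M * (hnorm H x)\<^sup>2" .
    have "cmod ((?bt x x - ?b x x) - (lift_form n (\<lambda>j x. of_real t \<cdot>\<^sub>C a 0 j x) ?bt x x - lift_form n (a 0) ?b x x))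
        \<le> ((1 + t\<^sup>2) ^ ?k - 2 ^ ?k) * (hnorm H x)\<^sup>2 + M * (hnorm H x)\<^sup>2"
      by (rule order_trans[OF norm_triangle_ineq4 add_mono[OF IH(2)[OF x] L2]])
    also have "\<dots> = ((1 + t\<^sup>2) ^ length (n # ns) - 2 ^ length (n # ns)) * (hnorm H x)\<^sup>2"
      by (simp add: M_def algebra_simps)
    finally show "cmod (defect (n # ns) a (ip H) x x) \<le> 2 ^ length (n # ns) * (hnorm H x)\<^sup>2 \<and>
      cmod (defect (n # ns) (\<lambda>i j x. of_real t \<cdot>\<^sub>C a i j x) (ip H) x x - defect (n # ns) a (ip H) x x)
        \<le> ((1 + t\<^sup>2) ^ length (n # ns) - 2 ^ length (n # ns)) * (hnorm H x)\<^sup>2"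
      using 1 by (simp add: algebra_simps)
  qed
qed

section \<open>The Poisson kernel of a point of the polyball\<close>

locale poisson_rows = row_contractions +
  assumes commuting: "commuting_rows ns a"
    and defect_nonneg: "x \<in> vectors H \<Longrightarrow> 0 \<le> Re (defect ns a (ip H) x x)"

lemma finite_subset_word_box:
  assumes "finite F" "F \<subseteq> multiwords ns"
  obtains N where "\<And>M. N \<le> M \<Longrightarrow> F \<subseteq> word_box M ns"
proof -
  define N where "N = Suc (Max (insert 0 (length ` (\<Union>\<sigma>\<in>F. set \<sigma>))))"
  have "F \<subseteq> word_box M ns" if "N \<le> M" for M
  proof
    fix \<sigma> assume \<sigma>: "\<sigma> \<in> F"
    have "length w < M" if "w \<in> set \<sigma>" for w
    proof -
      have "length w \<le> Max (insert 0 (length ` (\<Union>\<sigma>\<in>F. set \<sigma>)))"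
        using assms(1) \<sigma> that by (intro Max_ge) auto
      then show ?thesis using \<open>N \<le> M\<close> by (simp add: N_def)
    qed
    then show "\<sigma> \<in> word_box M ns" using \<sigma> assms(2) by (auto simp: word_box_def)
  qed
  then show ?thesis using that by blast
qed

lemma finite_subset_word_box_ex:
  "\<lbrakk>finite F; F \<subseteq> multiwords ns\<rbrakk> \<Longrightarrow> \<exists>N. \<forall>M\<ge>N. F \<subseteq> word_box M ns"
  by (meson finite_subset_word_box)

lemma has_sum_exhaustion:
  assumes s: "(f has_sum s) A"
    and fin: "\<And>N. finite (B N)" "\<And>N. B N \<subseteq> A"
    and ex: "\<And>F. \<lbrakk>finite F; F \<subseteq> A\<rbrakk> \<Longrightarrow> \<exists>N. \<forall>M\<ge>N. F \<subseteq> B M"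
  shows "(\<lambda>N::nat. sum f (B N)) \<longlonglongrightarrow> s"
proof -
  have "filterlim B (finite_subsets_at_top A) sequentially"
    unfolding filterlim_finite_subsets_at_top eventually_sequentially
  proof (intro allI impI)
    fix F assume "finite F \<and> F \<subseteq> A"
    then obtain N where "\<forall>M\<ge>N. F \<subseteq> B M" using ex[of F] by blast
    then show "\<exists>N. \<forall>M\<ge>N. finite (B M) \<and> F \<subseteq> B M \<and> B M \<subseteq> A"
      using fin by (intro exI[of _ N]) auto
  qed
  from filterlim_compose[OF s[unfolded has_sum_def] this] show ?thesis .
qed

lemma word_box_subset: "word_box N ns \<subseteq> multiwords ns"
  by (auto simp: word_box_def)

lemma has_sum_box_limit:
  "(f has_sum s) (multiwords ns) \<Longrightarrow> (\<lambda>N. sum f (word_box N ns)) \<longlonglongrightarrow> s"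
  by (rule has_sum_exhaustion) (auto simp: finite_word_box word_box_subset[THEN subsetD] intro: finite_subset_word_box_ex)

lemma act_closed:
  assumes "\<And>i j x. \<lbrakk>i < length ns; j < ns ! i; x \<in> V\<rbrakk> \<Longrightarrow> a i j x \<in> V"
    and "\<sigma> \<in> multiwords ns" "x \<in> V"
  shows "act a \<sigma> x \<in> V"
  using assms
proof (induction ns arbitrary: a \<sigma>)
  case Nil
  then show ?case by (simp add: multiwords_Nil)
next
  case (Cons n ns)
  from Cons.prems(2) obtain w \<rho> where \<sigma>: "\<sigma> = w # \<rho>" "w \<in> lists {..<n}" "\<rho> \<in> multiwords ns"
    by (auto simp: multiwords_Cons)
  have "fold (a 0) w y \<in> V" if "y \<in> V" for y
    using \<sigma>(2) that Cons.prems(1)[of 0] by (induction w arbitrary: y) auto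
  moreover have "act (\<lambda>i. a (Suc i)) \<rho> x \<in> V"
  proof (rule Cons.IH[OF _ \<sigma>(3) Cons.prems(3)])
    show "a (Suc i) j x \<in> V" if "i < length ns" "j < ns ! i" "x \<in> V" for i j x
      using Cons.prems(1)[of "Suc i" j x] that by simp
  qed
  ultimately show ?case by (simp add: \<sigma>(1))
qed

lemma fold_commute_fun:
  assumes "\<And>p x. p \<in> set w \<Longrightarrow> c (f p x) = f p (c x)"
  shows "c (fold f w x) = fold f w (c x)"
  using assms by (induction w arbitrary: x) auto

lemma act_commute_fun:
  assumes "\<And>i p x. \<lbrakk>i < length ns; p < ns ! i\<rbrakk> \<Longrightarrow> c (a i p x) = a i p (c x)" "\<sigma> \<in> multiwords ns"
  shows "c (act a \<sigma> x) = act a \<sigma> (c x)"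
  using assms
proof (induction ns arbitrary: a \<sigma>)
  case (Cons n ns)
  from Cons.prems(2) obtain w \<rho> where \<sigma>: "\<sigma> = w # \<rho>" "w \<in> lists {..<n}" "\<rho> \<in> multiwords ns"
    by (auto simp: multiwords_Cons)
  have "c (fold (a 0) w y) = fold (a 0) w (c y)" for y
    using Cons.prems(1)[of 0] \<sigma>(2) by (intro fold_commute_fun) auto
  moreover have "c (act (\<lambda>i. a (Suc i)) \<rho> x) = act (\<lambda>i. a (Suc i)) \<rho> (c x)"
  proof (rule Cons.IH[OF _ \<sigma>(3)])
    show "c (a (Suc i) p x) = a (Suc i) p (c x)" if "i < length ns" "p < ns ! i" for i p x
      using Cons.prems(1)[of "Suc i" p x] that by simp
  qed
  ultimately show ?case by (simp add: \<sigma>(1))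
qed (simp add: multiwords_Nil)

lemma act_fold_commute:
  assumes "commuting_rows (n # ns) a" "w \<in> lists {..<n}" "\<sigma> \<in> multiwords ns"
  shows "fold (a 0) w (act (\<lambda>i. a (Suc i)) \<sigma> x) = act (\<lambda>i. a (Suc i)) \<sigma> (fold (a 0) w x)"
proof (rule act_commute_fun[OF _ assms(3)])
  fix i p x assume "i < length ns" "p < ns ! i"
  then have "\<And>q x. q < n \<Longrightarrow> a 0 q (a (Suc i) p x) = a (Suc i) p (a 0 q x)"
    using commuting_rows_Cons(2)[OF assms(1)] by blast
  then show "fold (a 0) w (a (Suc i) p x) = a (Suc i) p (fold (a 0) w x)"
    using assms(2) by (intro fold_commute_fun[symmetric]) auto
qed

lemma act_append:
  assumes "commuting_rows ns a" "\<beta> \<in> multiwords ns" "\<omega> \<in> multiwords ns"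
  shows "act a (\<beta> @@ \<omega>) x = act a \<omega> (act a \<beta> x)"
  using assms
proof (induction ns arbitrary: a \<beta> \<omega>)
  case Nil
  then show ?case by (simp add: multiwords_Nil)
next
  case (Cons n ns)
  from Cons.prems(2,3) obtain w \<beta>' v \<omega>' where
    \<beta>: "\<beta> = w # \<beta>'" "w \<in> lists {..<n}" "\<beta>' \<in> multiwords ns" and
    \<omega>: "\<omega> = v # \<omega>'" "v \<in> lists {..<n}" "\<omega>' \<in> multiwords ns"
    by (auto simp: multiwords_Cons)
  show ?case
    using Cons.IH[OF commuting_rows_Cons(1)[OF Cons.prems(1)] \<beta>(3) \<omega>(3)]
    by (simp add: \<beta>(1) \<omega>(1) act_fold_commute[OF Cons.prems(1) \<beta>(2) \<omega>(3)])
qed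

lemma act_scaled:
  assumes "\<And>i j c x. \<lbrakk>i < length ns; j < ns ! i\<rbrakk> \<Longrightarrow> a i j (c \<cdot>\<^sub>C x) = c \<cdot>\<^sub>C a i j x"
    and "\<sigma> \<in> multiwords ns"
  shows "act (\<lambda>i j x. t \<cdot>\<^sub>C a i j x) \<sigma> x = t ^ sum_list (map length \<sigma>) \<cdot>\<^sub>C act a \<sigma> x"
  using assms
proof (induction ns arbitrary: a \<sigma>)
  case Nil
  then show ?case by (simp add: multiwords_Nil)
next
  case (Cons n ns)
  from Cons.prems(2) obtain w \<rho> where \<sigma>: "\<sigma> = w # \<rho>" "w \<in> lists {..<n}" "\<rho> \<in> multiwords ns"
    by (auto simp: multiwords_Cons)
  have scale: "a 0 j (c \<cdot>\<^sub>C x) = c \<cdot>\<^sub>C a 0 j x" if "j < n" for j c x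
    using Cons.prems(1)[of 0 j c x] that by simp
  have "fold (\<lambda>j x. t \<cdot>\<^sub>C a 0 j x) w (c \<cdot>\<^sub>C y) = (t ^ length w * c) \<cdot>\<^sub>C fold (a 0) w y" for c y
    using \<sigma>(2)
    by (induction w arbitrary: c y) (auto simp: scale cscale_algebra mult_ac)
  moreover have "act (\<lambda>i j x. t \<cdot>\<^sub>C a (Suc i) j x) \<rho> x = t ^ sum_list (map length \<rho>) \<cdot>\<^sub>C act (\<lambda>i. a (Suc i)) \<rho> x"
  proof (rule Cons.IH[OF _ \<sigma>(3)])
    show "a (Suc i) j (c \<cdot>\<^sub>C x) = c \<cdot>\<^sub>C a (Suc i) j x" if "i < length ns" "j < ns ! i" for i j c x
      using Cons.prems(1)[of "Suc i" j c x] that by simp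
  qed
  ultimately show ?case by (simp add: \<sigma>(1) power_add)
qed

context poisson_rows
begin

abbreviation "D \<equiv> defect ns a (ip H)"

lemma D_psd_form: "psd_form (vectors H) D"
proof -
  interpret sesq_form "vectors H" D
    by (rule defect_sesq_form[OF ip.sesq_form_axioms]) (auto simp: a_closed a_add a_scale)
  show ?thesis by unfold_locales (rule defect_nonneg)
qed

sublocale D: psd_form "vectors H" D
  by (rule D_psd_form)

lemma act_in: "\<lbrakk>\<sigma> \<in> multiwords ns; x \<in> vectors H\<rbrakk> \<Longrightarrow> act a \<sigma> x \<in> vectors H"
  by (rule act_closed) (auto intro: a_closed)

lemma poisson_summable_diagonal:
  assumes "x \<in> vectors H"
  shows "(\<lambda>\<sigma>. Re (D (act a \<sigma> x) (act a \<sigma> x))) summable_on multiwords ns"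
proof (rule nonneg_bdd_above_summable_on)
  show nonneg: "0 \<le> Re (D (act a \<sigma> x) (act a \<sigma> x))" if "\<sigma> \<in> multiwords ns" for \<sigma>
    using that assms by (intro D.psd act_in)
  define S where "S N = (\<Sum>\<sigma>\<in>word_box N ns. Re (D (act a \<sigma> x) (act a \<sigma> x)))" for N
  have lim: "S \<longlonglongrightarrow> Re (ip H x x)"
    unfolding S_def using tendsto_Re[OF box_sum_limit[OF commuting assms assms]] by simp
  have mono: "S N \<le> S M" if "N \<le> M" for N M
    unfolding S_def
    using that nonneg word_box_subset by (intro sum_mono2 finite_word_box) (fastforce simp: word_box_def)+
  have "sum (\<lambda>\<sigma>. Re (D (act a \<sigma> x) (act a \<sigma> x))) F \<le> Re (ip H x x)"
    if F: "F \<subseteq> multiwords ns" "finite F" for F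
  proof -
    obtain N where N: "\<And>M. N \<le> M \<Longrightarrow> F \<subseteq> word_box M ns"
      using finite_subset_word_box[OF F(2,1)] by blast
    have "sum (\<lambda>\<sigma>. Re (D (act a \<sigma> x) (act a \<sigma> x))) F \<le> S N"
      unfolding S_def using N[of N] nonneg subsetD[OF word_box_subset] by (intro sum_mono2 finite_word_box) auto
    also have "S N \<le> Re (ip H x x)"
      by (rule incseq_le[OF _ lim]) (simp add: incseq_def mono)
    finally show ?thesis .
  qed
  then show "bdd_above (sum (\<lambda>\<sigma>. Re (D (act a \<sigma> x) (act a \<sigma> x))) ` {F. F \<subseteq> multiwords ns \<and> finite F})"
    by (intro bdd_aboveI[where M = "Re (ip H x x)"]) auto
qed

theorem poisson_has_sum:
  assumes "x \<in> vectors H" "y \<in> vectors H"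
  shows "((\<lambda>\<sigma>. D (act a \<sigma> x) (act a \<sigma> y)) has_sum ip H x y) (multiwords ns)"
proof -
  let ?f = "\<lambda>\<sigma>. D (act a \<sigma> x) (act a \<sigma> y)"
  let ?g = "\<lambda>\<sigma>. Re (D (act a \<sigma> x) (act a \<sigma> x)) + Re (D (act a \<sigma> y) (act a \<sigma> y))"
  have "?g summable_on multiwords ns"
    by (intro summable_on_add poisson_summable_diagonal assms)
  then have "(\<lambda>\<sigma>. ?g \<sigma> * (1/2)) summable_on multiwords ns"
    by (rule summable_on_cmult_left)
  then have "(\<lambda>\<sigma>. norm (?f \<sigma>)) summable_on multiwords ns"
  proof (rule summable_on_comparison_test)
    show "norm (?f \<sigma>) \<le> ?g \<sigma> * (1/2)" if "\<sigma> \<in> multiwords ns" for \<sigma>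
      using D.cmod_le_half[OF act_in act_in] assms that by simp
  qed simp
  then have "?f summable_on multiwords ns"
    by (rule abs_summable_summable)
  then have sum: "(?f has_sum infsum ?f (multiwords ns)) (multiwords ns)"
    by simp
  have "infsum ?f (multiwords ns) = ip H x y"
    by (rule LIMSEQ_unique[OF has_sum_box_limit[OF sum] box_sum_limit[OF commuting assms]])
  with sum show ?thesis by simp
qed

end

context hilbert_space
begin

definition adj_rows :: "(nat \<Rightarrow> nat \<Rightarrow> 'i cop) \<Rightarrow> nat \<Rightarrow> nat \<Rightarrow> 'i cop"
  where "adj_rows X i j x = (if x \<in> vectors H then adj H (X i j) x else 0)"

definition bounded_rows :: "nat list \<Rightarrow> (nat \<Rightarrow> nat \<Rightarrow> 'i cop) \<Rightarrow> bool"
  where "bounded_rows ns X \<longleftrightarrow> (\<forall>i<length ns. \<forall>j<ns ! i. bounded_op H (X i j))"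

lemma bounded_rows_Cons:
  assumes "bounded_rows (n # ns) X"
  shows "j < n \<Longrightarrow> bounded_op H (X 0 j)" "bounded_rows ns (\<lambda>i. X (Suc i))"
  using assms by (auto simp: bounded_rows_def dest: spec[of _ "Suc _"])

lemma adj_rows_Suc: "(\<lambda>i. adj_rows X (Suc i)) = adj_rows (\<lambda>i. X (Suc i))"
  by (intro ext) (simp add: adj_rows_def)

lemma \<Delta>_Cons:
  "\<Delta> H (n # ns) X Y = \<Delta> H ns (\<lambda>i. X (Suc i)) Y - \<Phi> H n (X 0) (\<Delta> H ns (\<lambda>i. X (Suc i)) Y)"
proof -
  have "[0..<length (n # ns)] = 0 # map Suc [0..<length ns]"
    by (simp add: map_Suc_upt upt_conv_Cons del: upt_Suc)
  then show ?thesis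
    by (simp add: \<Delta>_def op_prod_def comp_def del: upt_Suc)
qed

lemma \<Phi>_bounded:
  assumes "\<And>j. j < n \<Longrightarrow> bounded_op H (Z j)" "bounded_op H Y"
  shows "bounded_op H (\<Phi> H n Z Y)"
  unfolding \<Phi>_def using assms by (intro bounded_op_fsum bounded_op_comp adj_bounded) auto

lemma \<Phi>_ip:
  assumes Z: "\<And>j. j < n \<Longrightarrow> bounded_op H (Z j)" and Y: "bounded_op H Y"
    and "x \<in> vectors H" "y \<in> vectors H"
  shows "ip H (\<Phi> H n Z Y x) y = (\<Sum>j<n. ip H (Y (adj H (Z j) x)) (adj H (Z j) y))"
proof -
  have V: "Y (adj H (Z j) x) \<in> vectors H" if "j < n" for j
    using that assms by (simp add: adj_closed bounded_op_closed)
  have "ip H (\<Phi> H n Z Y x) y = (\<Sum>j<n. ip H (Z j (Y (adj H (Z j) x))) y)"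
    unfolding \<Phi>_def sum_fun_eval[of "\<lambda>j. Z j \<circ> Y \<circ> adj H (Z j)"] o_apply
    using V Z assms by (intro ip.sum_left) (auto simp: bounded_op_closed)
  also have "\<dots> = (\<Sum>j<n. ip H (Y (adj H (Z j) x)) (adj H (Z j) y))"
    using V Z assms by (intro sum.cong refl adj_ip[symmetric]) auto
  finally show ?thesis .
qed

lemma \<Delta>_bounded_ip:
  assumes "bounded_rows ns X"
  shows "bounded_op H (\<Delta> H ns X id) \<and>
    (\<forall>x\<in>vectors H. \<forall>y\<in>vectors H. ip H (\<Delta> H ns X id x) y = defect ns (adj_rows X) (ip H) x y)"
  using assms
proof (induction ns arbitrary: X)
  case Nil
  then show ?case by (simp add: \<Delta>_def op_prod_def bounded_op_id[unfolded id_def])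
next
  case (Cons n ns)
  let ?Y = "\<Delta> H ns (\<lambda>i. X (Suc i)) id"
  have IH: "bounded_op H ?Y"
      "\<And>x y. \<lbrakk>x \<in> vectors H; y \<in> vectors H\<rbrakk> \<Longrightarrow> ip H (?Y x) y = defect ns (\<lambda>i. adj_rows X (Suc i)) (ip H) x y"
    unfolding adj_rows_Suc using Cons.IH[OF bounded_rows_Cons(2)[OF Cons.prems]] by blast+
  have Z: "bounded_op H (X 0 j)" if "j < n" for j
    by (rule bounded_rows_Cons(1)[OF Cons.prems that])
  have \<Phi>: "bounded_op H (\<Phi> H n (X 0) ?Y)"
    by (rule \<Phi>_bounded[OF Z IH(1)])
  have "ip H (\<Delta> H (n # ns) X id x) y = defect (n # ns) (adj_rows X) (ip H) x y"
    if xy: "x \<in> vectors H" "y \<in> vectors H" for x y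
  proof -
    have "ip H (\<Delta> H (n # ns) X id x) y = ip H (?Y x) y - ip H (\<Phi> H n (X 0) ?Y x) y"
      unfolding \<Delta>_Cons minus_apply[of ?Y]
      by (intro ip.diff_left bounded_op_closed[OF IH(1)] bounded_op_closed[OF \<Phi>] xy)
    also have "ip H (\<Phi> H n (X 0) ?Y x) y = (\<Sum>j<n. ip H (?Y (adj H (X 0 j) x)) (adj H (X 0 j) y))"
      by (rule \<Phi>_ip[OF _ IH(1) xy]) (rule Z)
    also have "\<dots> = lift_form n (adj_rows X 0) (defect ns (\<lambda>i. adj_rows X (Suc i)) (ip H)) x y"
      unfolding lift_form_def
      using Z xy by (intro sum.cong refl) (simp add: IH(2) adj_closed adj_rows_def)
    finally show ?thesis unfolding IH(2)[OF xy] defect.simps .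
  qed
  moreover have "bounded_op H (\<Delta> H (n # ns) X id)"
    unfolding \<Delta>_Cons by (rule bounded_op_minus[OF IH(1) \<Phi>])
  ultimately show ?case by blast
qed

lemma positive_invertible_lower_bound:
  assumes T: "bounded_op H T" and psd: "psd_form (vectors H) (\<lambda>x y. ip H (T x) y)"
    and inv: "invertible_op H T"
  obtains \<delta> where "0 < \<delta>" "\<And>x. x \<in> vectors H \<Longrightarrow> \<delta> * (hnorm H x)\<^sup>2 \<le> Re (ip H (T x) x)"
proof -
  interpret b: psd_form "vectors H" "\<lambda>x y. ip H (T x) y" by (rule psd)
  obtain S where S: "bounded_op H S" "\<And>x. x \<in> vectors H \<Longrightarrow> S (T x) = x"
    using inv by (auto simp: invertible_op_def)
  obtain C where C: "0 \<le> C" "\<And>x. x \<in> vectors H \<Longrightarrow> hnorm H (S x) \<le> C * hnorm H x"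
    using bounded_op_bound[OF S(1)] by blast
  obtain M0 where M0: "0 \<le> M0" "\<And>x. x \<in> vectors H \<Longrightarrow> hnorm H (T x) \<le> M0 * hnorm H x"
    using bounded_op_bound[OF T] by blast
  define M where "M = M0 + 1"
  have M: "0 < M" using M0 by (simp add: M_def)
  define \<delta> where "\<delta> = 1 / (M * (C\<^sup>2 + 1))"
  have C1: "C\<^sup>2 + 1 > 0" by (simp add: add_nonneg_pos)
  have "\<delta> * (hnorm H x)\<^sup>2 \<le> Re (ip H (T x) x)" if x: "x \<in> vectors H" for x
  proof -
    have Tx: "T x \<in> vectors H" using T x by (rule bounded_op_closed)
    define n where "n = (hnorm H (T x))\<^sup>2"
    have n: "0 \<le> n" by (simp add: n_def)
    have "Re (ip H (T (T x)) (T x)) \<le> cmod (ip H (T (T x)) (T x))"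
      by (rule complex_Re_le_cmod)
    also have "\<dots> \<le> hnorm H (T (T x)) * hnorm H (T x)"
      using T Tx by (simp add: ip_bound bounded_op_closed)
    also have "\<dots> \<le> M0 * hnorm H (T x) * hnorm H (T x)"
      using M0(2)[OF Tx] Tx by (intro mult_right_mono) (auto simp: hnorm_nonneg)
    also have "\<dots> \<le> M * n"
      using n by (simp add: n_def M_def power2_eq_square algebra_simps)
    finally have 1: "Re (ip H (T (T x)) (T x)) \<le> M * n" .
    have "0 \<le> Re (ip H (T (x + (- of_real (1 / M)) \<cdot>\<^sub>C T x)) (x + (- of_real (1 / M)) \<cdot>\<^sub>C T x))"
      using x Tx by (intro b.psd V_intros)
    also have "\<dots> = Re (ip H (T x) x) - 2 / M * n + (1 / M)\<^sup>2 * Re (ip H (T (T x)) (T x))"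
      using b.Re_line[OF x Tx, of "- of_real (1 / M)"] Tx
      by (simp add: n_def ip_self norm_divide power_divide del: of_real_divide)
    also have "\<dots> \<le> Re (ip H (T x) x) - 2 / M * n + (1 / M)\<^sup>2 * (M * n)"
      using 1 by (intro add_left_mono mult_left_mono) auto
    also have "\<dots> = Re (ip H (T x) x) - n / M"
      using M by (simp add: field_simps power2_eq_square)
    finally have 2: "n / M \<le> Re (ip H (T x) x)" by simp
    have "hnorm H x \<le> C * hnorm H (T x)"
      using C(2)[OF Tx] S(2)[OF x] by simp
    then have "(hnorm H x)\<^sup>2 \<le> (C * hnorm H (T x))\<^sup>2"
      using x by (intro power_mono) (auto simp: hnorm_nonneg)
    also have "\<dots> \<le> (C\<^sup>2 + 1) * n"
      by (simp add: n_def power_mult_distrib algebra_simps)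
    finally have "\<delta> * (hnorm H x)\<^sup>2 \<le> \<delta> * ((C\<^sup>2 + 1) * n)"
      using M C1 by (intro mult_left_mono) (simp_all add: \<delta>_def)
    also have "\<dots> = n / M"
      using M C1 by (simp add: \<delta>_def)
    finally have "\<delta> * (hnorm H x)\<^sup>2 \<le> n / M" .
    with 2 show ?thesis by simp
  qed
  moreover have "0 < \<delta>" using M C1 by (simp add: \<delta>_def)
  ultimately show ?thesis using that by blast
qed

lemma polyball_bounded_rows: "X \<in> polyball ns H \<Longrightarrow> bounded_rows ns X"
  by (simp add: polyball_def bounded_rows_def)

lemma adj_rows_scale:
  assumes "bounded_op H (X i j)"
  shows "adj_rows X i j (c \<cdot>\<^sub>C x) = c \<cdot>\<^sub>C adj_rows X i j x"
proof (cases "c = 0")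
  case True
  then show ?thesis
    using bounded_op_zero[OF adj_bounded[OF assms]] by (simp add: adj_rows_def)
next
  case False
  then have "c \<cdot>\<^sub>C x \<in> vectors H \<longleftrightarrow> x \<in> vectors H"
    using V_scale[of x c] V_scale[of "c \<cdot>\<^sub>C x" "1 / c"] by (auto simp: cscale_algebra)
  then show ?thesis
    using bounded_op_scale[OF adj_bounded[OF assms]] by (auto simp: adj_rows_def)
qed

lemma polyball_commuting_rows:
  assumes X: "X \<in> polyball ns H"
  shows "commuting_rows ns (adj_rows X)"
  unfolding commuting_rows_def
proof (intro allI impI)
  fix i j p q x assume ij: "i < length ns" "j < length ns" "i \<noteq> j" and pq: "p < ns ! i" "q < ns ! j"
  have Bp: "bounded_op H (X i p)" and Bq: "bounded_op H (X j q)"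
    using polyball_bounded_rows[OF X] ij pq by (auto simp: bounded_rows_def)
  have comm: "X i p (X j q x) = X j q (X i p x)" if "x \<in> vectors H" for x
    using X ij pq that by (auto simp: polyball_def)
  show "adj_rows X i p (adj_rows X j q x) = adj_rows X j q (adj_rows X i p x)"
  proof (cases "x \<in> vectors H")
    case True
    have "adj H (X i p) (adj H (X j q) x) = adj H (X j q \<circ> X i p) x"
      by (rule adj_comp[OF Bq Bp True, symmetric])
    also have "\<dots> = adj H (X j q) (adj H (X i p) x)"
      using comm True Bp Bq
      by (intro adj_unique bounded_op_comp) (auto simp: adj_closed adj_ip bounded_op_closed)
    finally show ?thesis using True Bp Bq by (simp add: adj_rows_def adj_closed)
  next
    case False
    then show ?thesis
      using bounded_op_zero[OF adj_bounded[OF Bp]] bounded_op_zero[OF adj_bounded[OF Bq]]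
      by (simp add: adj_rows_def)
  qed
qed

theorem polyball_poisson_rows:
  assumes X: "X \<in> polyball ns H"
  obtains t q :: real where "1 < t"
    "poisson_rows H ns (\<lambda>i j x. of_real t \<cdot>\<^sub>C adj_rows X i j x) q"
proof -
  have B: "bounded_op H (X i j)" if "i < length ns" "j < ns ! i" for i j
    using X that by (auto simp: polyball_def)
  let ?a = "adj_rows X" and ?R = "\<lambda>i. \<Sum>j<ns ! i. X i j \<circ> adj H (X i j)"
  define q where "q = Max (insert 0 ((\<lambda>i. op_norm H (?R i)) ` {..<length ns}))"
  have q0: "0 \<le> q" by (simp add: q_def)
  have q1: "q < 1"
    using X by (auto simp: q_def polyball_def)
  have qi: "op_norm H (?R i) \<le> q" if "i < length ns" for i
    using that by (simp add: q_def)
  have contr: "(\<Sum>j<ns ! i. (hnorm H (?a i j x))\<^sup>2) \<le> q * (hnorm H x)\<^sup>2"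
    if i: "i < length ns" and x: "x \<in> vectors H" for i x
  proof -
    have R: "bounded_op H (?R i)"
      using B[OF i] by (intro bounded_op_fsum bounded_op_comp adj_bounded) auto
    have "(\<Sum>j<ns ! i. (hnorm H (?a i j x))\<^sup>2) = Re (\<Sum>j<ns ! i. ip H (adj H (X i j) x) (adj H (X i j) x))"
      using B[OF i] x by (simp add: hnorm_sq adj_rows_def adj_closed)
    also have "(\<Sum>j<ns ! i. ip H (adj H (X i j) x) (adj H (X i j) x)) = ip H (?R i x) x"
    proof -
      have "ip H (?R i x) x = ip H (\<Phi> H (ns ! i) (X i) id x) x"
        by (simp add: \<Phi>_def)
      then show ?thesis
        using \<Phi>_ip[OF B[OF i] bounded_op_id x x] by simp
    qed
    also have "Re (ip H (?R i x) x) \<le> hnorm H (?R i x) * hnorm H x"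
      using ip_bound[OF bounded_op_closed[OF R x] x] complex_Re_le_cmod order_trans by blast
    also have "\<dots> \<le> (op_norm H (?R i) * hnorm H x) * hnorm H x"
      by (intro mult_right_mono op_norm_bound R x hnorm_nonneg)
    also have "\<dots> \<le> q * (hnorm H x)\<^sup>2"
      using qi[OF i] x by (simp add: power2_eq_square mult.assoc mult_right_mono hnorm_nonneg)
    finally show ?thesis .
  qed
  have rows: "row_contractions H ns ?a q"
  proof unfold_locales
    fix i j x assume ij: "i < length ns" "j < ns ! i" and x: "x \<in> vectors H"
    note A = adj_bounded[OF B[OF ij]]
    show "?a i j x \<in> vectors H"
      using bounded_op_closed[OF A x] x by (simp add: adj_rows_def)
    show "?a i j (x + y) = ?a i j x + ?a i j y" if "y \<in> vectors H" for y
      using bounded_op_add[OF A x that] x that by (simp add: adj_rows_def V_add)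
    show "?a i j (c \<cdot>\<^sub>C x) = c \<cdot>\<^sub>C ?a i j x" for c
      using bounded_op_scale[OF A x] x by (simp add: adj_rows_def V_scale)
  qed (use contr q0 q1 in auto)
  interpret r: row_contractions H ns ?a q by (rule rows)
  let ?T = "\<Delta> H ns X id"
  have T: "bounded_op H ?T" "\<And>x y. \<lbrakk>x \<in> vectors H; y \<in> vectors H\<rbrakk> \<Longrightarrow> ip H (?T x) y = defect ns ?a (ip H) x y"
    using \<Delta>_bounded_ip[of ns X] B by (auto simp: bounded_rows_def)
  have Tpos: "positive_op H ?T" "invertible_op H ?T"
    using X by (auto simp: polyball_def)
  interpret d: sesq_form "vectors H" "defect ns ?a (ip H)"
    by (rule defect_sesq_form[OF ip.sesq_form_axioms]) (auto simp: r.a_closed r.a_add r.a_scale)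
  have "psd_form (vectors H) (\<lambda>x y. ip H (?T x) y)"
  proof unfold_locales
    fix x y assume "x \<in> vectors H" "y \<in> vectors H"
    then show "ip H (?T y) x = cnj (ip H (?T x) y)"
      unfolding T(2)[OF \<open>x \<in> vectors H\<close> \<open>y \<in> vectors H\<close>] T(2)[OF \<open>y \<in> vectors H\<close> \<open>x \<in> vectors H\<close>]
      by (rule d.herm)
  next
    fix x assume "x \<in> vectors H"
    then show "0 \<le> Re (ip H (?T x) x)"
      using Tpos(1) by (auto simp: positive_op_def nonneg_Reals_iff)
  qed (simp_all add: T(2) V_add V_scale d.add_left d.scale_left)
  then obtain \<delta> where \<delta>: "0 < \<delta>" "\<And>x. x \<in> vectors H \<Longrightarrow> \<delta> * (hnorm H x)\<^sup>2 \<le> Re (ip H (?T x) x)"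
    by (rule positive_invertible_lower_bound[OF T(1) _ Tpos(2)]) blast
  let ?k = "length ns"
  have "((\<lambda>t::real. (1 + t\<^sup>2) ^ ?k - 2 ^ ?k) \<longlongrightarrow> (1 + 1\<^sup>2) ^ ?k - 2 ^ ?k) (at_right 1)"
    by (intro tendsto_intros)
  then have "((\<lambda>t::real. (1 + t\<^sup>2) ^ ?k - 2 ^ ?k) \<longlongrightarrow> 0) (at_right 1)"
    by simp
  then have "eventually (\<lambda>t::real. (1 + t\<^sup>2) ^ ?k - 2 ^ ?k < \<delta>) (at_right 1)"
    using \<delta>(1) by (rule order_tendstoD)
  moreover have "((\<lambda>t::real. t\<^sup>2 * q) \<longlongrightarrow> 1\<^sup>2 * q) (at_right 1)"
    by (intro tendsto_intros)
  then have "eventually (\<lambda>t::real. t\<^sup>2 * q < 1) (at_right 1)"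
    using q1 by (intro order_tendstoD(2)) simp_all
  moreover have "eventually (\<lambda>t::real. 1 < t) (at_right 1)"
    by (rule eventually_at_right_less)
  ultimately have "eventually (\<lambda>t::real. (1 + t\<^sup>2) ^ ?k - 2 ^ ?k < \<delta> \<and> t\<^sup>2 * q < 1 \<and> 1 < t) (at_right 1)"
    by eventually_elim blast
  then obtain t :: real where t: "(1 + t\<^sup>2) ^ ?k - 2 ^ ?k < \<delta>" "t\<^sup>2 * q < 1" "1 < t"
    using eventually_happens'[of "at_right (1::real)"] trivial_limit_at_right_real by blast
  let ?at = "\<lambda>i j x. of_real t \<cdot>\<^sub>C ?a i j x"
  have "poisson_rows H ns ?at (t\<^sup>2 * q)"
  proof (intro poisson_rows.intro row_contractions.intro hilbert_space_axioms
      row_contractions_axioms.intro poisson_rows_axioms.intro)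
    fix i x assume i: "i < length ns" and x: "x \<in> vectors H"
    have "(\<Sum>j<ns ! i. (hnorm H (?at i j x))\<^sup>2) = t\<^sup>2 * (\<Sum>j<ns ! i. (hnorm H (?a i j x))\<^sup>2)"
      using i x by (simp add: r.a_closed hnorm_scale power_mult_distrib sum_distrib_left)
    also have "\<dots> \<le> t\<^sup>2 * (q * (hnorm H x)\<^sup>2)"
      by (intro mult_left_mono contr i x) simp
    finally show "(\<Sum>j<ns ! i. (hnorm H (?at i j x))\<^sup>2) \<le> t\<^sup>2 * q * (hnorm H x)\<^sup>2"
      by (simp add: mult.assoc)
  next
    show "commuting_rows ns ?at"
      using polyball_commuting_rows[OF X] adj_rows_scale[OF B] by (simp add: commuting_rows_def)
  next
    fix x assume x: "x \<in> vectors H"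
    have "cmod (defect ns ?at (ip H) x x - defect ns ?a (ip H) x x) \<le> ((1 + t\<^sup>2) ^ ?k - 2 ^ ?k) * (hnorm H x)\<^sup>2"
      using defect_scaled_close[OF rows, of t] t(3) x by simp
    also have "\<dots> \<le> \<delta> * (hnorm H x)\<^sup>2"
      using t(1) by (intro mult_right_mono) auto
    also have "\<dots> \<le> Re (defect ns ?a (ip H) x x)"
      using \<delta>(2)[OF x] T(2)[OF x x] by simp
    finally have "cmod (defect ns ?at (ip H) x x - defect ns ?a (ip H) x x) \<le> Re (defect ns ?a (ip H) x x)" .
    moreover have "Re (defect ns ?a (ip H) x x) - Re (defect ns ?at (ip H) x x)
        \<le> cmod (defect ns ?at (ip H) x x - defect ns ?a (ip H) x x)"
      using abs_Re_le_cmod[of "defect ns ?at (ip H) x x - defect ns ?a (ip H) x x"] by simp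
    ultimately show "0 \<le> Re (defect ns ?at (ip H) x x)" by linarith
  qed (use t q0 r.a_closed r.a_add r.a_scale in \<open>auto simp: V_scale cscale_algebra mult.commute\<close>)
  with t(3) show ?thesis using that by blast
qed

lemma word_op_Cons: "word_op Z (j # w) = Z j \<circ> word_op Z w"
  by (simp add: word_op_def op_prod_def)

lemma word_op_bounded: "(\<And>j. j \<in> set w \<Longrightarrow> bounded_op H (Z j)) \<Longrightarrow> bounded_op H (word_op Z w)"
  unfolding word_op_def by (intro bounded_op_op_prod) auto

lemma adj_word_op:
  assumes "\<forall>j\<in>set w. bounded_op H (X i j)" "x \<in> vectors H"
  shows "adj H (word_op (X i) w) x = fold (adj_rows X i) w x"
  using assms
proof (induction w arbitrary: x)
  case Nil
  then show ?case by (simp add: word_op_def op_prod_def adj_id[unfolded id_def])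
next
  case (Cons j w)
  then have "adj H (word_op (X i) (j # w)) x = adj H (word_op (X i) w) (adj H (X i j) x)"
    unfolding word_op_Cons by (intro adj_comp word_op_bounded) auto
  also have "\<dots> = fold (adj_rows X i) w (adj H (X i j) x)"
    using Cons by (intro Cons.IH adj_closed) auto
  also have "adj H (X i j) x = adj_rows X i j x"
    using Cons.prems by (simp add: adj_rows_def)
  finally show ?case by simp
qed

lemma op_prod_upt_Cons:
  "op_prod (map (\<lambda>i. f i ((w # \<sigma>) ! i)) [0..<length (w # \<sigma>)])
    = f 0 w \<circ> op_prod (map (\<lambda>i. f (Suc i) (\<sigma> ! i)) [0..<length \<sigma>])"
proof -
  have "[0..<length (w # \<sigma>)] = 0 # map Suc [0..<length \<sigma>]"
    by (simp add: map_Suc_upt upt_conv_Cons del: upt_Suc)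
  then show ?thesis by (simp add: op_prod_def comp_def del: upt_Suc)
qed

lemma adj_rows_closed: "bounded_op H (X i j) \<Longrightarrow> adj_rows X i j x \<in> vectors H"
  by (simp add: adj_rows_def adj_closed zero_closed)

lemma act_adj_rows_closed:
  assumes "bounded_rows ns X"
    and "\<sigma> \<in> multiwords ns" "x \<in> vectors H"
  shows "act (adj_rows X) \<sigma> x \<in> vectors H"
  by (rule act_closed[OF _ assms(2,3)]) (use assms(1) adj_rows_closed in \<open>simp add: bounded_rows_def\<close>)

lemma word_factor_bounded:
  assumes "bounded_rows ns X"
    and "\<sigma> \<in> multiwords ns" "i < length \<sigma>"
  shows "bounded_op H (word_op (X i) (\<sigma> ! i))"
  using assms by (intro word_op_bounded) (auto simp: in_multiwords_iff bounded_rows_def)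

lemma adj_factors:
  assumes "bounded_rows ns X"
    and "\<sigma> \<in> multiwords ns" "x \<in> vectors H"
  shows "op_prod (map (\<lambda>i. adj H (word_op (X i) (\<sigma> ! i))) [0..<length \<sigma>]) x = act (adj_rows X) \<sigma> x"
  using assms
proof (induction ns arbitrary: X \<sigma>)
  case Nil
  then show ?case by (simp add: multiwords_Nil op_prod_def)
next
  case (Cons n ns)
  from Cons.prems(2) obtain w \<rho> where \<sigma>: "\<sigma> = w # \<rho>" "w \<in> lists {..<n}" "\<rho> \<in> multiwords ns"
    by (auto simp: multiwords_Cons)
  note B1 = bounded_rows_Cons(2)[OF Cons.prems(1)]
  have B0: "\<forall>j\<in>set w. bounded_op H (X 0 j)"
    using bounded_rows_Cons(1)[OF Cons.prems(1)] \<sigma>(2) by auto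
  show ?case
    unfolding \<sigma>(1) op_prod_upt_Cons[where f = "\<lambda>i v. adj H (word_op (X i) v)"] o_apply
      Cons.IH[OF B1 \<sigma>(3) Cons.prems(3)]
    using adj_word_op[of w X 0, OF B0 act_adj_rows_closed[OF B1 \<sigma>(3) Cons.prems(3)]]
    by (simp add: adj_rows_Suc)
qed

lemma word_factors_ip:
  assumes "bounded_rows ns X"
    and "commuting_rows ns (adj_rows X)"
    and "\<sigma> \<in> multiwords ns" "x \<in> vectors H" "y \<in> vectors H"
  shows "ip H (op_prod (map (\<lambda>i. word_op (X i) (\<sigma> ! i)) [0..<length \<sigma>]) y) x
    = ip H y (act (adj_rows X) \<sigma> x)"
  using assms
proof (induction ns arbitrary: X \<sigma> x)
  case Nil
  then show ?case by (simp add: multiwords_Nil op_prod_def)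
next
  case (Cons n ns)
  from Cons.prems(3) obtain w \<rho> where \<sigma>: "\<sigma> = w # \<rho>" "w \<in> lists {..<n}" "\<rho> \<in> multiwords ns"
    by (auto simp: multiwords_Cons)
  note B1 = bounded_rows_Cons(2)[OF Cons.prems(1)]
  have B0: "\<forall>j\<in>set w. bounded_op H (X 0 j)"
    using bounded_rows_Cons(1)[OF Cons.prems(1)] \<sigma>(2) by auto
  have C1: "commuting_rows ns (adj_rows (\<lambda>i. X (Suc i)))"
    using commuting_rows_Cons(1)[OF Cons.prems(2)] by (simp add: adj_rows_Suc)
  have W: "bounded_op H (word_op (X 0) w)"
    using B0 by (intro word_op_bounded) simp
  let ?u = "op_prod (map (\<lambda>i. word_op (X (Suc i)) (\<rho> ! i)) [0..<length \<rho>]) y"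
  have "bounded_op H (op_prod (map (\<lambda>i. word_op (X (Suc i)) (\<rho> ! i)) [0..<length \<rho>]))"
    using word_factor_bounded[OF B1 \<sigma>(3)] by (intro bounded_op_op_prod) auto
  then have u: "?u \<in> vectors H"
    using Cons.prems(5) by (rule bounded_op_closed)
  have "ip H (word_op (X 0) w ?u) x = ip H ?u (adj H (word_op (X 0) w) x)"
    by (rule adj_ip[OF W Cons.prems(4) u, symmetric])
  also have "\<dots> = ip H y (act (adj_rows (\<lambda>i. X (Suc i))) \<rho> (adj H (word_op (X 0) w) x))"
    by (rule Cons.IH[OF B1 C1 \<sigma>(3) adj_closed[OF W Cons.prems(4)] Cons.prems(5)])
  also have "adj H (word_op (X 0) w) x = fold (adj_rows X 0) w x"
    by (rule adj_word_op[of w X 0, OF B0 Cons.prems(4)])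
  also have "act (adj_rows (\<lambda>i. X (Suc i))) \<rho> \<dots> = act (adj_rows X) \<sigma> x"
    using act_fold_commute[OF Cons.prems(2) \<sigma>(2,3), of x] by (simp add: \<sigma>(1) adj_rows_Suc)
  finally show ?case
    unfolding \<sigma>(1) op_prod_upt_Cons[where f = "\<lambda>i. word_op (X i)"] o_apply .
qed

lemma monomial_op_bounded:
  assumes "bounded_rows ns X"
    and "\<alpha> \<in> multiwords ns" "\<beta> \<in> multiwords ns"
  shows "bounded_op H (monomial_op H X \<alpha> \<beta>)"
  unfolding monomial_op_def
  using word_factor_bounded[OF assms(1,2)] word_factor_bounded[OF assms(1,3)]
  by (intro bounded_op_comp bounded_op_op_prod) (auto intro: adj_bounded)

lemma monomial_op_ip:
  assumes B: "bounded_rows ns X"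
    and C: "commuting_rows ns (adj_rows X)" and "\<alpha> \<in> multiwords ns" "\<beta> \<in> multiwords ns"
    and "x \<in> vectors H" "y \<in> vectors H"
  shows "ip H (monomial_op H X \<alpha> \<beta> x) y = ip H (act (adj_rows X) \<beta> x) (act (adj_rows X) \<alpha> y)"
  unfolding monomial_op_def o_apply adj_factors[OF B assms(4,5)]
  by (rule word_factors_ip[OF B C assms(3,6) act_adj_rows_closed[OF B assms(4,5)]])

end

section \<open>Positivity of the Poisson sum\<close>

lemma psd_kernel_sum:
  assumes \<Gamma>: "psd_kernel ns E \<Gamma>" and I: "finite I"
    and "\<And>i. i \<in> I \<Longrightarrow> \<sigma> i \<in> multiwords ns" "\<And>i. i \<in> I \<Longrightarrow> h i \<in> vectors E"
  shows "(\<Sum>i\<in>I. \<Sum>j\<in>I. ip E (\<Gamma> (\<sigma> i) (\<sigma> j) (h j)) (h i)) \<in> \<real>\<^sub>\<ge>\<^sub>0"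
proof -
  obtain f where f: "bij_betw f {0..<card I} I"
    using ex_bij_betw_nat_finite[OF I] by blast
  then have f: "bij_betw f {..<card I} I" by (simp add: lessThan_atLeast0)
  have fI: "f i \<in> I" if "i < card I" for i
    using f that by (auto simp: bij_betw_def)
  let ?g = "\<lambda>i j. ip E (\<Gamma> (\<sigma> i) (\<sigma> j) (h j)) (h i)"
  have "(\<Sum>i<card I. \<Sum>j<card I. ?g (f i) (f j)) \<in> \<real>\<^sub>\<ge>\<^sub>0"
    using \<Gamma>[unfolded psd_kernel_def, rule_format, of "card I" "\<lambda>i. \<sigma> (f i)" "\<lambda>i. h (f i)"] assms(3,4) fI
    by blast
  moreover have "(\<Sum>j<card I. ?g (f i) (f j)) = (\<Sum>j\<in>I. ?g (f i) j)" for i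
    by (rule sum.reindex_bij_betw[OF f])
  moreover have "(\<Sum>i<card I. \<Sum>j\<in>I. ?g (f i) j) = (\<Sum>i\<in>I. \<Sum>j\<in>I. ?g i j)"
    by (rule sum.reindex_bij_betw[OF f])
  ultimately show ?thesis by simp
qed

definition bounded_coeffs :: "nat list \<Rightarrow> 'e hilbert \<Rightarrow> 'e coeffs \<Rightarrow> bool"
  where "bounded_coeffs ns E A \<longleftrightarrow> (\<forall>ms. length ms = length ns \<longrightarrow>
    (\<forall>\<alpha>\<in>neg_words ns ms. \<forall>\<beta>\<in>pos_words ns ms. bounded_op E (A \<alpha> \<beta>)))"

lemma bounded_coeffsD:
  assumes "bounded_coeffs ns E A" "\<alpha> \<in> neg_words ns ms" "\<beta> \<in> pos_words ns ms"
  shows "bounded_op E (A \<alpha> \<beta>)"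
proof -
  have "length ms = length ns" using assms(2) by (simp add: in_level_words_iff)
  then show ?thesis using assms by (simp add: bounded_coeffs_def)
qed

lemma ph_kernel_cases:
  assumes "\<sigma> \<in> multiwords ns" "\<omega> \<in> multiwords ns"
  obtains "ph_kernel A \<sigma> \<omega> = 0"
  | \<alpha> \<beta> \<gamma> ms where "\<sigma> = \<alpha> @@ \<gamma>" "\<omega> = \<beta> @@ \<gamma>" "\<gamma> \<in> multiwords ns" "\<alpha> \<in> neg_words ns ms"
      "\<beta> \<in> pos_words ns ms" "ph_kernel A \<sigma> \<omega> = A \<alpha> \<beta>"
proof (cases "rcomparable \<sigma> \<omega>")
  case True
  obtain \<alpha> \<beta> \<gamma> where 1: "\<sigma> = \<alpha> @@ \<gamma>" "\<omega> = \<beta> @@ \<gamma>" "\<gamma> \<in> multiwords ns"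
    "\<alpha> \<in> neg_words ns (map2 (\<lambda>u v. int (length v) - int (length u)) \<sigma> \<omega>)"
    "\<beta> \<in> pos_words ns (map2 (\<lambda>u v. int (length v) - int (length u)) \<sigma> \<omega>)"
    by (rule rcomparable_level_cases[OF True assms])
  then have "ph_kernel A \<sigma> \<omega> = A \<alpha> \<beta>"
    using ph_kernel_append[OF 1(4,5) length_multiword[OF 1(3)]] by simp
  with 1 that(2) show ?thesis by blast
next
  case False
  then show ?thesis using that(1) by (simp add: ph_kernel_def)
qed

lemma ph_kernel_bounded:
  assumes "hilbert_space E" "bounded_coeffs ns E A" "\<sigma> \<in> multiwords ns" "\<omega> \<in> multiwords ns"
  shows "bounded_op E (ph_kernel A \<sigma> \<omega>)"
  using assms(3,4)
proof (cases rule: ph_kernel_cases[where A = A])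
  case 1
  then show ?thesis using hilbert_space.bounded_op_0[OF assms(1)] by simp
next
  case (2 \<alpha> \<beta> \<gamma> ms)
  then show ?thesis using bounded_coeffsD[OF assms(2)] by simp
qed

definition lower :: "int list \<Rightarrow> nat list \<Rightarrow> nat list"
  where "lower ms d = map2 (\<lambda>m x. nat (- m) + x) ms d"

definition upper :: "int list \<Rightarrow> nat list \<Rightarrow> nat list"
  where "upper ms d = map2 (\<lambda>m x. nat m + x) ms d"

definition weight :: "int list \<Rightarrow> nat"
  where "weight ms = (\<Sum>m\<leftarrow>ms. nat \<bar>m\<bar>)"

lemma length_lower [simp]: "length (lower ms d) = min (length ms) (length d)"
  and length_upper [simp]: "length (upper ms d) = min (length ms) (length d)"
  by (simp_all add: lower_def upper_def)

lemma nth_lower [simp]: "\<lbrakk>i < length ms; i < length d\<rbrakk> \<Longrightarrow> lower ms d ! i = nat (- (ms ! i)) + d ! i"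
  and nth_upper [simp]: "\<lbrakk>i < length ms; i < length d\<rbrakk> \<Longrightarrow> upper ms d ! i = nat (ms ! i) + d ! i"
  by (simp_all add: lower_def upper_def)

lemma lower_upper_inverse:
  assumes "length ms = k" "length d = k"
  shows "map2 (\<lambda>x y. int y - int x) (lower ms d) (upper ms d) = ms"
    and "map2 min (lower ms d) (upper ms d) = d"
  using assms by (auto intro!: nth_equalityI)

lemma lower_upper_surj:
  assumes "length d1 = k" "length d2 = k"
  shows "lower (map2 (\<lambda>x y. int y - int x) d1 d2) (map2 min d1 d2) = d1"
    and "upper (map2 (\<lambda>x y. int y - int x) d1 d2) (map2 min d1 d2) = d2"
  using assms by (auto intro!: nth_equalityI)

lemma lower_inj: "\<lbrakk>length d = length ms; length d' = length ms; lower ms d = lower ms d'\<rbrakk> \<Longrightarrow> d = d'"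
  by (rule nth_equalityI) (auto dest: arg_cong[of _ _ "\<lambda>l. l ! _"] simp: list_eq_iff_nth_eq[of "lower ms d"])

lemma upper_inj: "\<lbrakk>length d = length ms; length d' = length ms; upper ms d = upper ms d'\<rbrakk> \<Longrightarrow> d = d'"
  by (rule nth_equalityI) (auto dest: arg_cong[of _ _ "\<lambda>l. l ! _"] simp: list_eq_iff_nth_eq[of "upper ms d"])

lemma weight_words:
  assumes "\<alpha> \<in> neg_words ns ms" "\<beta> \<in> pos_words ns ms"
  shows "sum_list (map length \<alpha>) + sum_list (map length \<beta>) = weight ms"
proof -
  have 1: "map length \<alpha> = map (\<lambda>m. nat (- m)) ms" "map length \<beta> = map nat ms"
    using assms by (auto simp: level_words_def)
  have 2: "(\<Sum>m\<leftarrow>ms. nat (- m)) + (\<Sum>m\<leftarrow>ms. nat m) = (\<Sum>m\<leftarrow>ms. nat \<bar>m\<bar>)"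
    by (induction ms) auto
  show ?thesis
    unfolding 1 weight_def 2 ..
qed

lemma append_level:
  assumes "\<alpha> \<in> neg_words ns ms" "\<beta> \<in> pos_words ns ms" "\<omega> \<in> level_words ns d"
  shows "\<alpha> @@ \<omega> \<in> level_words ns (lower ms d)" "\<beta> @@ \<omega> \<in> level_words ns (upper ms d)"
  using assms by (auto simp: in_level_words_iff)

lemma multi_append_inject:
  assumes "\<alpha> \<in> level_words ns p" "\<alpha>' \<in> level_words ns p" "\<gamma> \<in> multiwords ns" "\<gamma>' \<in> multiwords ns"
    and "\<alpha> @@ \<gamma> = \<alpha>' @@ \<gamma>'"
  shows "\<alpha> = \<alpha>' \<and> \<gamma> = \<gamma>'"
proof -
  have "\<alpha> ! i = \<alpha>' ! i \<and> \<gamma> ! i = \<gamma>' ! i" if "i < length ns" for i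
  proof -
    have "(\<alpha> @@ \<gamma>) ! i = (\<alpha>' @@ \<gamma>') ! i" using assms(5) by simp
    then show ?thesis using assms(1-4) that by (simp add: in_level_words_iff length_multiword)
  qed
  then show ?thesis
    using assms(1-4) by (auto simp: in_level_words_iff length_multiword intro!: nth_equalityI)
qed

lemma summable_weight:
  fixes s :: real
  assumes "0 \<le> s" "s < 1"
  shows "(\<lambda>ms. s ^ weight ms) summable_on {ms. length ms = k}"
proof (induction k)
  case 0
  show ?case by (intro summable_on_finite) simp
next
  case (Suc k)
  have geo: "(\<lambda>n::nat. s ^ n) summable_on UNIV"
    using assms by (intro norm_summable_imp_summable_on) (simp add: norm_power)
  have int: "(\<lambda>m::int. s ^ nat \<bar>m\<bar>) summable_on UNIV"
    unfolding UNIV_int_split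
  proof (rule summable_on_Un_disjoint)
    show "(\<lambda>m::int. s ^ nat \<bar>m\<bar>) summable_on range int"
      using geo by (subst summable_on_reindex) (auto simp: o_def)
    have "(\<lambda>n::nat. s * s ^ n) summable_on UNIV"
      by (rule summable_on_cmult_right[OF geo])
    then show "(\<lambda>m::int. s ^ nat \<bar>m\<bar>) summable_on range (\<lambda>n. - int (Suc n))"
      by (subst summable_on_reindex) (auto simp: o_def inj_on_def nat_add_distrib)
  qed auto
  define Z where "Z = (\<Sum>\<^sub>\<infinity>ms\<in>{ms. length ms = k}. s ^ weight ms)"
  have "(\<lambda>(m, ms). s ^ nat \<bar>m\<bar> * s ^ weight ms) summable_on (UNIV \<times> {ms. length ms = k})"
  proof (rule summable_on_SigmaI[where g = "\<lambda>m. s ^ nat \<bar>m\<bar> * Z"])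
    show "((\<lambda>ms. case (m, ms) of (m, ms) \<Rightarrow> s ^ nat \<bar>m\<bar> * s ^ weight ms) has_sum s ^ nat \<bar>m\<bar> * Z)
        {ms. length ms = k}" for m
      using Suc.IH by (simp add: Z_def has_sum_cmult_right)
    show "(\<lambda>m. s ^ nat \<bar>m\<bar> * Z) summable_on UNIV"
      by (rule summable_on_cmult_left[OF int])
  qed (use assms in auto)
  then show ?case
    by (subst summable_on_reindex_bij_witness[where i = "\<lambda>(m, ms). m # ms" and j = "\<lambda>ms. (hd ms, tl ms)"
          and T = "UNIV \<times> {ms. length ms = k}" and h = "\<lambda>(m, ms). s ^ nat \<bar>m\<bar> * s ^ weight ms"])
      (auto simp: length_Suc_conv weight_def power_add)
qed

lemma has_sum_sum:
  fixes f :: "'a \<Rightarrow> 'b \<Rightarrow> 'c :: topological_comm_monoid_add"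
  assumes "\<And>i. i \<in> I \<Longrightarrow> (f i has_sum s i) A"
  shows "((\<lambda>x. \<Sum>i\<in>I. f i x) has_sum (\<Sum>i\<in>I. s i)) A"
  using assms by (induction I rule: infinite_finite_induct) (auto intro: has_sum_add)

lemma two_point_psd_bound:
  assumes "u \<in> \<real>\<^sub>\<ge>\<^sub>0" "v \<in> \<real>\<^sub>\<ge>\<^sub>0"
    and nonneg: "\<And>z. cmod z = 1 \<Longrightarrow> u + v + z * p + cnj z * p' \<in> \<real>\<^sub>\<ge>\<^sub>0"
  shows "cmod p \<le> (Re u + Re v) / 2"
proof -
  have uv: "Im u = 0" "Im v = 0" using assms by (auto simp: nonneg_Reals_iff)
  have p': "p' = cnj p"
    using nonneg[of 1] nonneg[of \<i>] uv by (auto simp: nonneg_Reals_iff complex_eq_iff)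
  show ?thesis
  proof (cases "p = 0")
    case True
    then show ?thesis using assms(1,2) by (auto simp: nonneg_Reals_iff)
  next
    case False
    define z where "z = - cnj (sgn p)"
    have z: "cmod z = 1" using False by (simp add: z_def norm_sgn)
    have "z * p = - of_real (cmod p)"
    proof -
      have "cnj p * p = of_real (cmod p) * of_real (cmod p)"
        using complex_norm_square[of p] by (simp add: power2_eq_square mult.commute)
      then show ?thesis using False by (simp add: z_def sgn_eq)
    qed
    moreover have "cnj z * p' = cnj (z * p)" by (simp add: p')
    ultimately have "u + v + z * p + cnj z * p' = u + v - 2 * of_real (cmod p)" by simp
    with nonneg[OF z] show ?thesis by (simp add: nonneg_Reals_iff)
  qed
qed

locale kernel_sum = poisson_rows H ns a q + E: hilbert_space E
  for H :: "'h hilbert" and ns a q and E :: "'e hilbert" +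
  fixes N :: nat and e :: "nat \<Rightarrow> 'e cfun" and h :: "nat \<Rightarrow> 'h cfun"
  assumes e: "p < N \<Longrightarrow> e p \<in> vectors E" and h: "p < N \<Longrightarrow> h p \<in> vectors H"
begin

definition \<kappa> :: "'e coeffs \<Rightarrow> multiword \<Rightarrow> multiword \<Rightarrow> complex"
  where "\<kappa> A \<sigma> \<omega> = (\<Sum>p<N. \<Sum>q<N.
    ip E (ph_kernel A \<sigma> \<omega> (e q)) (e p) * D (act a \<omega> (h q)) (act a \<sigma> (h p)))"

definition level_sum :: "'e coeffs \<Rightarrow> nat list \<Rightarrow> nat list \<Rightarrow> complex"
  where "level_sum A d1 d2 = (\<Sum>\<sigma>\<in>level_words ns d1. \<Sum>\<omega>\<in>level_words ns d2. \<kappa> A \<sigma> \<omega>)"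

definition part_value :: "'e coeffs \<Rightarrow> int list \<Rightarrow> complex"
  where "part_value A ms = (\<Sum>\<alpha>\<in>neg_words ns ms. \<Sum>\<beta>\<in>pos_words ns ms. \<Sum>p<N. \<Sum>q<N.
    ip E (A \<alpha> \<beta> (e q)) (e p) * ip H (act a \<beta> (h q)) (act a \<alpha> (h p)))"

lemma \<kappa>_psd:
  assumes A: "bounded_coeffs ns E A" and psd: "psd_kernel ns E (ph_kernel A)"
    and S: "finite S" "S \<subseteq> multiwords ns"
  shows "psd_matrix S (\<kappa> A)"
  unfolding psd_matrix_def
proof
  fix c :: "multiword \<Rightarrow> complex"
  let ?I = "S \<times> {..<N}"
  define P where "P i j = ip E (ph_kernel A (fst i) (fst j) (c (fst j) \<cdot>\<^sub>C e (snd j))) (c (fst i) \<cdot>\<^sub>C e (snd i))"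
    for i j :: "multiword \<times> nat"
  define v where "v i = act a (fst i) (h (snd i))" for i :: "multiword \<times> nat"
  have I: "finite ?I" using S by simp
  have v: "v i \<in> vectors H" if "i \<in> ?I" for i
    using that S h by (auto simp: v_def intro!: act_in)
  have B: "bounded_op E (ph_kernel A (fst i) (fst j))" if "i \<in> ?I" "j \<in> ?I" for i j
    using that S by (intro ph_kernel_bounded[OF E.hilbert_space_axioms A]) auto
  have eI: "e (snd i) \<in> vectors E" if "i \<in> ?I" for i
    using that e by auto
  have "psd_matrix ?I P"
    unfolding psd_matrix_def
  proof
    fix b :: "multiword \<times> nat \<Rightarrow> complex"
    have "(\<Sum>i\<in>?I. \<Sum>j\<in>?I. cnj (b i) * b j * P i j)
        = (\<Sum>i\<in>?I. \<Sum>j\<in>?I. ip E (ph_kernel A (fst i) (fst j) ((b j * c (fst j)) \<cdot>\<^sub>C e (snd j)))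
            ((b i * c (fst i)) \<cdot>\<^sub>C e (snd i)))"
      using B eI unfolding P_def
      by (intro sum.cong refl)
        (simp add: E.bounded_op_scale E.bounded_op_closed E.V_scale E.ip.scale_left E.ip.scale_right)
    also have "\<dots> \<in> \<real>\<^sub>\<ge>\<^sub>0"
      using S eI by (intro psd_kernel_sum[OF psd I]) (auto intro!: E.V_scale)
    finally show "(\<Sum>i\<in>?I. \<Sum>j\<in>?I. cnj (b i) * b j * P i j) \<in> \<real>\<^sub>\<ge>\<^sub>0" .
  qed
  moreover have "psd_matrix ?I (\<lambda>i j. D (v j) (v i))"
    by (rule psd_form_psd_matrix[OF D_psd_form I]) (rule v)
  moreover have "D (v i) (v j) = cnj (D (v j) (v i))" if "i \<in> ?I" "j \<in> ?I" for i j
    by (rule D.herm[OF v[OF that(2)] v[OF that(1)]])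
  ultimately have "(\<Sum>i\<in>?I. \<Sum>j\<in>?I. P i j * D (v j) (v i)) \<in> \<real>\<^sub>\<ge>\<^sub>0"
    by (rule schur_product[OF I])
  also have "(\<Sum>i\<in>?I. \<Sum>j\<in>?I. P i j * D (v j) (v i))
      = (\<Sum>\<sigma>\<in>S. \<Sum>p<N. \<Sum>\<omega>\<in>S. \<Sum>q<N. P (\<sigma>, p) (\<omega>, q) * D (v (\<omega>, q)) (v (\<sigma>, p)))"
    by (simp add: sum.cartesian_product')
  also have "\<dots> = (\<Sum>\<sigma>\<in>S. \<Sum>\<omega>\<in>S. \<Sum>p<N. \<Sum>q<N. P (\<sigma>, p) (\<omega>, q) * D (v (\<omega>, q)) (v (\<sigma>, p)))"
    by (intro sum.cong refl sum.swap)
  also have "\<dots> = (\<Sum>\<sigma>\<in>S. \<Sum>\<omega>\<in>S. cnj (c \<sigma>) * c \<omega> * \<kappa> A \<sigma> \<omega>)"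
    unfolding \<kappa>_def sum_distrib_left
  proof (intro sum.cong refl)
    fix \<sigma> \<omega> p q assume "\<sigma> \<in> S" "\<omega> \<in> S" "p \<in> {..<N}" "q \<in> {..<N}"
    then have "bounded_op E (ph_kernel A \<sigma> \<omega>)" "e p \<in> vectors E" "e q \<in> vectors E"
      using B[of "(\<sigma>, p)" "(\<omega>, q)"] e by auto
    then show "P (\<sigma>, p) (\<omega>, q) * D (v (\<omega>, q)) (v (\<sigma>, p))
        = cnj (c \<sigma>) * c \<omega> * (ip E (ph_kernel A \<sigma> \<omega> (e q)) (e p) * D (act a \<omega> (h q)) (act a \<sigma> (h p)))"
      by (simp add: P_def v_def E.bounded_op_scale E.bounded_op_closed E.V_scale E.ip.scale_left
          E.ip.scale_right)
  qed
  finally show "(\<Sum>\<sigma>\<in>S. \<Sum>\<omega>\<in>S. cnj (c \<sigma>) * c \<omega> * \<kappa> A \<sigma> \<omega>) \<in> \<real>\<^sub>\<ge>\<^sub>0" .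
qed

lemma level_sum_nonneg:
  assumes "bounded_coeffs ns E A" "psd_kernel ns E (ph_kernel A)"
  shows "level_sum A d d \<in> \<real>\<^sub>\<ge>\<^sub>0"
  using psd_matrixD[OF \<kappa>_psd[OF assms finite_level_words level_words_subset], of "\<lambda>_. 1" d]
  by (simp add: level_sum_def)

lemma level_sum_bound:
  assumes A: "bounded_coeffs ns E A" "psd_kernel ns E (ph_kernel A)"
  shows "cmod (level_sum A d1 d2) \<le> (Re (level_sum A d1 d1) + Re (level_sum A d2 d2)) / 2"
proof (cases "d1 = d2")
  case True
  then show ?thesis
    using level_sum_nonneg[OF A, of d2] by (auto simp: nonneg_Reals_iff cmod_eq_Re)
next
  case False
  let ?L = "level_words ns"
  have disj: "?L d1 \<inter> ?L d2 = {}" by (rule level_words_disjoint[OF False])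
  show ?thesis
  proof (rule two_point_psd_bound)
    fix z :: complex assume z: "cmod z = 1"
    define c where "c \<sigma> = (if \<sigma> \<in> ?L d1 then 1 else z)" for \<sigma>
    have c1: "c \<sigma> = 1" if "\<sigma> \<in> ?L d1" for \<sigma> using that by (simp add: c_def)
    have c2: "c \<sigma> = z" if "\<sigma> \<in> ?L d2" for \<sigma> using that disj by (auto simp: c_def)
    have zz: "cnj z * z = 1" using z complex_norm_square[of z] by (simp add: mult.commute)
    have split: "(\<Sum>\<sigma>\<in>?L d1 \<union> ?L d2. f \<sigma>) = (\<Sum>\<sigma>\<in>?L d1. f \<sigma>) + (\<Sum>\<sigma>\<in>?L d2. f \<sigma>)" for f :: "multiword \<Rightarrow> complex"
      by (rule sum.union_disjoint[OF finite_level_words finite_level_words disj])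
    have "(\<Sum>\<sigma>\<in>?L d1 \<union> ?L d2. \<Sum>\<omega>\<in>?L d1 \<union> ?L d2. cnj (c \<sigma>) * c \<omega> * \<kappa> A \<sigma> \<omega>)
        = level_sum A d1 d1 + z * level_sum A d1 d2 + cnj z * level_sum A d2 d1 + cnj z * z * level_sum A d2 d2"
      unfolding split level_sum_def
      by (simp add: c1 c2 sum.distrib sum_distrib_left mult.assoc cong: sum.cong)
    moreover have "(\<Sum>\<sigma>\<in>?L d1 \<union> ?L d2. \<Sum>\<omega>\<in>?L d1 \<union> ?L d2. cnj (c \<sigma>) * c \<omega> * \<kappa> A \<sigma> \<omega>) \<in> \<real>\<^sub>\<ge>\<^sub>0"
      using level_words_subset
      by (intro psd_matrixD \<kappa>_psd A) (auto simp: finite_level_words)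
    ultimately show "level_sum A d1 d1 + level_sum A d2 d2 + z * level_sum A d1 d2 + cnj z * level_sum A d2 d1 \<in> \<real>\<^sub>\<ge>\<^sub>0"
      by (simp add: zz add_ac)
  qed (rule level_sum_nonneg[OF A])+
qed

lemma \<kappa>_append:
  assumes "\<alpha> \<in> neg_words ns ms" "\<beta> \<in> pos_words ns ms" "\<omega> \<in> multiwords ns"
  shows "\<kappa> A (\<alpha> @@ \<omega>) (\<beta> @@ \<omega>) = (\<Sum>p<N. \<Sum>q<N.
    ip E (A \<alpha> \<beta> (e q)) (e p) * D (act a \<omega> (act a \<beta> (h q))) (act a \<omega> (act a \<alpha> (h p))))"
proof -
  have "\<alpha> \<in> multiwords ns" "\<beta> \<in> multiwords ns"
    using assms level_words_subset by blast+
  then show ?thesis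
    unfolding \<kappa>_def ph_kernel_append[OF assms(1,2) length_multiword[OF assms(3)]]
    using assms(3) by (simp add: act_append[OF commuting])
qed

lemma \<kappa>_noncomparable: "ph_kernel A \<sigma> \<omega> = 0 \<Longrightarrow> \<kappa> A \<sigma> \<omega> = 0"
  unfolding \<kappa>_def by (intro sum.neutral ballI) (simp add: fun_apply E.ip.zero_left e)

lemma level_sum_eq:
  assumes ms: "length ms = length ns" and d: "length d = length ns"
  shows "level_sum A (lower ms d) (upper ms d)
    = (\<Sum>\<omega>\<in>level_words ns d. \<Sum>\<alpha>\<in>neg_words ns ms. \<Sum>\<beta>\<in>pos_words ns ms. \<kappa> A (\<alpha> @@ \<omega>) (\<beta> @@ \<omega>))"
proof -
  let ?T = "level_words ns d \<times> neg_words ns ms \<times> pos_words ns ms"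
  let ?U = "level_words ns (lower ms d) \<times> level_words ns (upper ms d)"
  define j where "j = (\<lambda>(\<omega>, \<alpha>, \<beta>). (\<alpha> @@ \<omega>, \<beta> @@ \<omega>))"
  have inj: "inj_on j ?T"
  proof (rule inj_onI)
    fix x y assume "x \<in> ?T" "y \<in> ?T" "j x = j y"
    then obtain \<omega> \<alpha> \<beta> \<omega>' \<alpha>' \<beta>' where xy: "x = (\<omega>, \<alpha>, \<beta>)" "y = (\<omega>', \<alpha>', \<beta>')"
      and L: "\<omega> \<in> multiwords ns" "\<omega>' \<in> multiwords ns"
        "\<alpha> \<in> neg_words ns ms" "\<alpha>' \<in> neg_words ns ms" "\<beta> \<in> pos_words ns ms" "\<beta>' \<in> pos_words ns ms"
      and eq: "\<alpha> @@ \<omega> = \<alpha>' @@ \<omega>'" "\<beta> @@ \<omega> = \<beta>' @@ \<omega>'"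
      using level_words_subset[of ns d] by (cases x, cases y) (auto simp: j_def)
    show "x = y"
      using multi_append_inject[OF L(3,4,1,2) eq(1)] multi_append_inject[OF L(5,6,1,2) eq(2)]
      by (simp add: xy)
  qed
  have sub: "j ` ?T \<subseteq> ?U"
    using append_level by (auto simp: j_def)
  have zero: "\<kappa> A \<sigma> \<omega> = 0" if "(\<sigma>, \<omega>) \<in> ?U - j ` ?T" for \<sigma> \<omega>
  proof (rule \<kappa>_noncomparable, rule ccontr)
    assume nz: "ph_kernel A \<sigma> \<omega> \<noteq> 0"
    from that have L: "\<sigma> \<in> level_words ns (lower ms d)" "\<omega> \<in> level_words ns (upper ms d)" by auto
    then have MW: "\<sigma> \<in> multiwords ns" "\<omega> \<in> multiwords ns" using level_words_subset by blast+
    from nz have "rcomparable \<sigma> \<omega>" by (auto simp: ph_kernel_def split: if_splits)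
    then obtain \<alpha> \<beta> \<gamma> where 1: "\<sigma> = \<alpha> @@ \<gamma>" "\<omega> = \<beta> @@ \<gamma>" "\<gamma> \<in> multiwords ns"
      "\<alpha> \<in> neg_words ns (map2 (\<lambda>u v. int (length v) - int (length u)) \<sigma> \<omega>)"
      "\<beta> \<in> pos_words ns (map2 (\<lambda>u v. int (length v) - int (length u)) \<sigma> \<omega>)"
      by (rule rcomparable_level_cases[OF _ MW])
    have "map2 (\<lambda>u v. int (length v) - int (length u)) \<sigma> \<omega> = ms"
      using L ms d by (intro nth_equalityI) (auto simp: in_level_words_iff)
    with 1 have 2: "\<alpha> \<in> neg_words ns ms" "\<beta> \<in> pos_words ns ms" by auto
    have "length (\<gamma> ! i) = d ! i" if "i < length ns" for i
    proof -
      have "length (\<sigma> ! i) = nat (- (ms ! i)) + d ! i" "length (\<alpha> ! i) = nat (- (ms ! i))"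
        "\<sigma> ! i = \<alpha> ! i @ \<gamma> ! i"
        using L(1) 1(1,3) 2 that ms d by (auto simp: in_level_words_iff length_multiword)
      then show ?thesis by simp
    qed
    then have "\<gamma> \<in> level_words ns d"
      using 1(3) d by (simp add: in_level_words_iff in_multiwords_iff)
    then have "(\<sigma>, \<omega>) \<in> j ` ?T"
      using 1(1,2) 2 by (intro image_eqI[of _ _ "(\<gamma>, \<alpha>, \<beta>)"]) (auto simp: j_def)
    with that show False by simp
  qed
  have "level_sum A (lower ms d) (upper ms d) = (\<Sum>x\<in>?U. \<kappa> A (fst x) (snd x))"
    by (simp add: level_sum_def sum.cartesian_product')
  also have "\<dots> = (\<Sum>x\<in>j ` ?T. \<kappa> A (fst x) (snd x))"
    using zero sub by (intro sum.mono_neutral_right) (auto simp: finite_level_words)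
  also have "\<dots> = (\<Sum>x\<in>?T. \<kappa> A (fst (j x)) (snd (j x)))"
    by (subst sum.reindex[OF inj]) simp
  also have "\<dots> = (\<Sum>\<omega>\<in>level_words ns d. \<Sum>\<alpha>\<in>neg_words ns ms. \<Sum>\<beta>\<in>pos_words ns ms. \<kappa> A (\<alpha> @@ \<omega>) (\<beta> @@ \<omega>))"
    by (simp add: j_def sum.cartesian_product')
  finally show ?thesis .
qed

lemma part_value_has_sum:
  assumes ms: "length ms = length ns"
  shows "((\<lambda>d. level_sum A (lower ms d) (upper ms d)) has_sum part_value A ms) {d. length d = length ns}"
proof -
  let ?f = "\<lambda>\<omega>. \<Sum>\<alpha>\<in>neg_words ns ms. \<Sum>\<beta>\<in>pos_words ns ms. \<kappa> A (\<alpha> @@ \<omega>) (\<beta> @@ \<omega>)"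
  have "((\<lambda>\<omega>. \<Sum>\<alpha>\<in>neg_words ns ms. \<Sum>\<beta>\<in>pos_words ns ms. \<Sum>p<N. \<Sum>q<N.
      ip E (A \<alpha> \<beta> (e q)) (e p) * D (act a \<omega> (act a \<beta> (h q))) (act a \<omega> (act a \<alpha> (h p)))) has_sum part_value A ms)
    (multiwords ns)"
    unfolding part_value_def
  proof (intro has_sum_sum has_sum_cmult_right poisson_has_sum act_in h)
    fix \<alpha> \<beta> assume "\<alpha> \<in> neg_words ns ms" "\<beta> \<in> pos_words ns ms"
    then show "\<alpha> \<in> multiwords ns" "\<beta> \<in> multiwords ns" using level_words_subset by blast+
  qed auto
  then have f: "(?f has_sum part_value A ms) (multiwords ns)"
    by (rule has_sum_cong[THEN iffD1, rotated]) (simp add: \<kappa>_append cong: sum.cong)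
  have "((\<lambda>(d, \<omega>). ?f \<omega>) has_sum part_value A ms) (Sigma {d. length d = length ns} (level_words ns))"
    by (subst has_sum_reindex_bij_witness[where T = "multiwords ns" and h = ?f and s' = "part_value A ms"
          and i = "\<lambda>\<omega>. (map length \<omega>, \<omega>)" and j = snd])
      (use f in \<open>auto simp: level_words_def length_multiword\<close>)
  then have "((\<lambda>d. \<Sum>\<omega>\<in>level_words ns d. ?f \<omega>) has_sum part_value A ms) {d. length d = length ns}"
    by (rule has_sum_SigmaD) (auto simp: finite_level_words intro!: has_sum_finiteI)
  then show ?thesis
    by (rule has_sum_cong[THEN iffD1, rotated]) (simp add: level_sum_eq[OF ms])
qed

lemma level_sum_dilate:
  assumes A: "bounded_coeffs ns E A" and ms: "length ms = length ns" and d: "length d = length ns"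
  shows "level_sum (dilate r A) (lower ms d) (upper ms d)
    = of_real (r ^ weight ms) * level_sum A (lower ms d) (upper ms d)"
proof -
  have "\<kappa> (dilate r A) (\<alpha> @@ \<omega>) (\<beta> @@ \<omega>) = of_real (r ^ weight ms) * \<kappa> A (\<alpha> @@ \<omega>) (\<beta> @@ \<omega>)"
    if \<alpha>\<beta>: "\<alpha> \<in> neg_words ns ms" "\<beta> \<in> pos_words ns ms" and "\<omega> \<in> level_words ns d" for \<alpha> \<beta> \<omega>
  proof -
    have \<omega>: "\<omega> \<in> multiwords ns" using that level_words_subset by blast
    note B = bounded_coeffsD[OF A \<alpha>\<beta>]
    show ?thesis
      unfolding \<kappa>_append[OF \<alpha>\<beta> \<omega>] dilate_def weight_words[OF \<alpha>\<beta>] sum_distrib_left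
      using B e by (intro sum.cong refl) (simp add: E.ip.scale_left E.bounded_op_closed mult.assoc)
  qed
  then show ?thesis
    unfolding level_sum_eq[OF ms d] sum_distrib_left by (intro sum.cong refl) auto
qed

lemma word_box_levels:
  "word_box M ns = (\<Union>d\<in>{d. length d = length ns \<and> set d \<subseteq> {..<M}}. level_words ns d)"
  by (auto simp: word_box_def level_words_def length_multiword image_subset_iff)

lemma finite_level_box: "finite {d. length d = k \<and> set d \<subseteq> {..<M::nat}}"
  using finite_lists_length_eq[of "{..<M}" k] by (simp add: conj_commute)

lemma level_box_sum:
  "(\<Sum>\<sigma>\<in>word_box M ns. f \<sigma>) = (\<Sum>d | length d = length ns \<and> set d \<subseteq> {..<M}. \<Sum>\<sigma>\<in>level_words ns d. f \<sigma>)"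
  for f :: "multiword \<Rightarrow> complex"
  unfolding word_box_levels
  by (rule sum.UNION_disjoint) (use finite_level_box finite_level_words level_words_disjoint in auto)

lemma dilate_dilate: "dilate r (dilate s A) = dilate (r * s) A"
  by (intro ext) (simp add: dilate_def cscale_algebra power_mult_distrib)

theorem part_value_sum_nonneg:
  assumes A: "bounded_coeffs ns E A" and r: "0 \<le> r" "r < 1"
    and psd: "\<And>s. \<lbrakk>0 \<le> s; s < 1\<rbrakk> \<Longrightarrow> psd_kernel ns E (ph_kernel (dilate s A))"
  shows "\<exists>S\<in>\<real>\<^sub>\<ge>\<^sub>0. (part_value (dilate r A) has_sum S) {ms. length ms = length ns}"
proof -
  let ?k = "length ns"
  let ?Z = "{ms :: int list. length ms = ?k}" and ?N = "{d :: nat list. length d = ?k}"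
  define s where "s = sqrt r"
  have s: "0 \<le> s" "s < 1" "s * s = r" using r by (auto simp: s_def)
  define B where "B = dilate s A"
  have rB: "dilate r A = dilate s B" by (simp add: B_def dilate_dilate s)
  have dilate_bounded: "bounded_coeffs ns E (dilate t A)" for t
    unfolding bounded_coeffs_def dilate_def using A
    by (auto simp: bounded_coeffs_def intro!: E.bounded_op_scaled)
  have B: "bounded_coeffs ns E B" "psd_kernel ns E (ph_kernel B)"
    unfolding B_def using dilate_bounded psd[OF s(1,2)] by auto
  define w where "w d = Re (level_sum B d d)" for d
  have w0: "0 \<le> w d" for d
    using level_sum_nonneg[OF B, of d] by (simp add: w_def nonneg_Reals_iff)
  have w: "w summable_on ?N"
  proof -
    have eq: "lower (replicate ?k 0) d = d" "upper (replicate ?k 0) d = d" if "length d = ?k" for d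
      using that by (auto intro!: nth_equalityI)
    have "((\<lambda>d. Re (level_sum B (lower (replicate ?k 0) d) (upper (replicate ?k 0) d)))
        has_sum Re (part_value B (replicate ?k 0))) ?N"
      by (intro has_sum_Re part_value_has_sum) simp
    then have "(w has_sum Re (part_value B (replicate ?k 0))) ?N"
      by (rule has_sum_cong[THEN iffD1, rotated]) (simp add: w_def eq)
    then show ?thesis by (rule has_sum_imp_summable)
  qed
  define S0 where "S0 = infsum w ?N"
  have shifted: "(\<lambda>d. w (g d)) summable_on ?N \<and> infsum (\<lambda>d. w (g d)) ?N \<le> S0"
    if g: "inj_on g ?N" "g ` ?N \<subseteq> ?N" for g
  proof -
    have 1: "w summable_on g ` ?N" by (rule summable_on_subset_banach[OF w g(2)])
    then have "(w \<circ> g) summable_on ?N" using summable_on_reindex[OF g(1)] by blast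
    moreover have "infsum w (g ` ?N) \<le> S0"
      unfolding S0_def by (rule infsum_mono2[OF 1 w g(2)]) (use w0 in auto)
    ultimately show ?thesis using infsum_reindex[OF g(1), of w] by (simp add: o_def)
  qed
  define F where "F = (\<lambda>(ms, d). level_sum (dilate r A) (lower ms d) (upper ms d))"
  define G where "G = (\<lambda>(ms, d). s ^ weight ms * ((w (lower ms d) + w (upper ms d)) * (1 / 2)))"
  define g where "g ms = s ^ weight ms * ((infsum (\<lambda>d. w (lower ms d)) ?N + infsum (\<lambda>d. w (upper ms d)) ?N) * (1 / 2))" for ms
  have inj: "inj_on (lower ms) ?N" "inj_on (upper ms) ?N" if "ms \<in> ?Z" for ms
    using that by (auto intro!: inj_onI intro: lower_inj[of _ ms] upper_inj[of _ ms])
  have lo: "(\<lambda>d. w (lower ms d)) summable_on ?N \<and> infsum (\<lambda>d. w (lower ms d)) ?N \<le> S0"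
    and up: "(\<lambda>d. w (upper ms d)) summable_on ?N \<and> infsum (\<lambda>d. w (upper ms d)) ?N \<le> S0" if "ms \<in> ?Z" for ms
    by (rule shifted; use inj[OF that] that in auto)+
  have "G summable_on ?Z \<times> ?N"
  proof (rule summable_on_SigmaI)
    show "((\<lambda>d. G (ms, d)) has_sum g ms) ?N" if "ms \<in> ?Z" for ms
      unfolding G_def g_def prod.case
      using lo[OF that] up[OF that] by (intro has_sum_cmult_right has_sum_cmult_left has_sum_add) auto
    show "g summable_on ?Z"
    proof (rule summable_on_comparison_test)
      show "(\<lambda>ms. s ^ weight ms * S0) summable_on ?Z"
        by (rule summable_on_cmult_left[OF summable_weight[OF s(1,2)]])
      show "g ms \<le> s ^ weight ms * S0" if "ms \<in> ?Z" for ms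
        unfolding g_def using lo[OF that] up[OF that] s by (intro mult_left_mono) auto
      show "0 \<le> g ms" for ms
        unfolding g_def using s w0 by (intro mult_nonneg_nonneg add_nonneg_nonneg infsum_nonneg) auto
    qed
  qed (use s w0 in \<open>auto simp: G_def intro!: mult_nonneg_nonneg add_nonneg_nonneg\<close>)
  then have "(\<lambda>x. norm (F x)) summable_on ?Z \<times> ?N"
  proof (rule summable_on_comparison_test)
    show "norm (F x) \<le> G x" if "x \<in> ?Z \<times> ?N" for x
    proof -
      obtain ms d where x0: "x = (ms, d)" by (cases x)
      with that have x: "x = (ms, d)" "length ms = ?k" "length d = ?k" by auto
      have "norm (F x) = s ^ weight ms * cmod (level_sum B (lower ms d) (upper ms d))"
        using s by (simp add: F_def x rB level_sum_dilate[OF B(1)] norm_mult norm_power)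
      also have "\<dots> \<le> s ^ weight ms * ((w (lower ms d) + w (upper ms d)) / 2)"
        unfolding w_def using s by (intro mult_left_mono level_sum_bound B) auto
      finally show ?thesis by (simp add: G_def x)
    qed
  qed simp
  then have "F summable_on ?Z \<times> ?N" by (rule abs_summable_summable)
  then obtain S where S: "(F has_sum S) (?Z \<times> ?N)" by (auto simp: summable_on_def)
  have "(part_value (dilate r A) has_sum S) ?Z"
    by (rule has_sum_SigmaD[OF S]) (use part_value_has_sum in \<open>simp add: F_def\<close>)
  moreover have "S \<in> \<real>\<^sub>\<ge>\<^sub>0"
  proof -
    let ?C = "\<lambda>M. {d. length d = ?k \<and> set d \<subseteq> {..<M}}"
    let ?W = "\<lambda>(d1, d2). level_sum (dilate r A) d1 d2"
    have W: "(?W has_sum S) (?N \<times> ?N)"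
      by (subst has_sum_reindex_bij_witness[where T = "?Z \<times> ?N" and h = F and s' = S
            and i = "\<lambda>(ms, d). (lower ms d, upper ms d)"
            and j = "\<lambda>(d1, d2). (map2 (\<lambda>x y. int y - int x) d1 d2, map2 min d1 d2)"])
        (use S in \<open>auto simp: F_def lower_upper_surj lower_upper_inverse\<close>)
    have "(\<lambda>M. sum ?W (?C M \<times> ?C M)) \<longlonglongrightarrow> S"
    proof (rule has_sum_exhaustion[OF W])
      show "finite (?C M \<times> ?C M)" "?C M \<times> ?C M \<subseteq> ?N \<times> ?N" for M
        using finite_level_box by auto
      fix X assume X: "finite X" "X \<subseteq> ?N \<times> ?N"
      define R where "R = (\<Union>(d1, d2)\<in>X. set d1 \<union> set d2)"
      have R: "finite R" using X by (auto simp: R_def)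
      have "X \<subseteq> ?C M \<times> ?C M" if "Suc (Max (insert 0 R)) \<le> M" for M
      proof -
        have "x < M" if "x \<in> R" for x
        proof -
          have "x \<le> Max (insert 0 R)" using R that by (intro Max_ge) auto
          then show ?thesis using \<open>Suc (Max (insert 0 R)) \<le> M\<close> by linarith
        qed
        then show ?thesis using X(2) by (fastforce simp: R_def)
      qed
      then show "\<exists>M0. \<forall>M\<ge>M0. X \<subseteq> ?C M \<times> ?C M" by blast
    qed
    moreover have "sum ?W (?C M \<times> ?C M) \<in> \<real>\<^sub>\<ge>\<^sub>0" for M
    proof -
      have "sum ?W (?C M \<times> ?C M) = (\<Sum>d1\<in>?C M. \<Sum>d2\<in>?C M. level_sum (dilate r A) d1 d2)"
        by (simp add: sum.cartesian_product)
      also have "\<dots> = (\<Sum>d1\<in>?C M. \<Sum>\<sigma>\<in>level_words ns d1. \<Sum>d2\<in>?C M. \<Sum>\<omega>\<in>level_words ns d2. \<kappa> (dilate r A) \<sigma> \<omega>)"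
        unfolding level_sum_def by (intro sum.cong refl sum.swap)
      also have "\<dots> = (\<Sum>\<sigma>\<in>word_box M ns. \<Sum>\<omega>\<in>word_box M ns. \<kappa> (dilate r A) \<sigma> \<omega>)"
        unfolding level_box_sum ..
      also have "\<dots> \<in> \<real>\<^sub>\<ge>\<^sub>0"
        using psd_matrixD[OF \<kappa>_psd[OF dilate_bounded psd[OF r] finite_word_box word_box_subset], of "\<lambda>_. 1" M]
        by simp
      finally show ?thesis .
    qed
    ultimately show ?thesis
      by (intro Lim_in_closed_set[OF closed_nonneg_Reals_complex _ sequentially_bot]) auto
  qed
  ultimately show ?thesis by blast
qed

end

section \<open>Values of a free pluriharmonic function\<close>

context tensor_space
begin

lemma homogeneous_part_bounded:
  assumes "bounded_coeffs ns E A" "H.bounded_rows ns X"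
  shows "bounded_op K (homogeneous_part E H K \<tau> ns A X ms)"
  unfolding homogeneous_part_def
proof (intro K.bounded_op_fsum op_tensor_bounded)
  fix \<alpha> \<beta> assume "\<alpha> \<in> neg_words ns ms" "\<beta> \<in> pos_words ns ms"
  then show "bounded_op E (A \<alpha> \<beta>)" "bounded_op H (monomial_op H X \<alpha> \<beta>)"
    using bounded_coeffsD[OF assms(1)] H.monomial_op_bounded[OF assms(2)] level_words_subset by blast+
qed

lemma homogeneous_part_ip:
  assumes A: "bounded_coeffs ns E A" and X: "H.bounded_rows ns X"
    and V: "e \<in> vectors E" "e' \<in> vectors E" "h \<in> vectors H" "h' \<in> vectors H"
  shows "ip K (homogeneous_part E H K \<tau> ns A X ms (\<tau> e h)) (\<tau> e' h')
    = (\<Sum>\<alpha>\<in>neg_words ns ms. \<Sum>\<beta>\<in>pos_words ns ms.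
        ip E (A \<alpha> \<beta> e) e' * ip H (monomial_op H X \<alpha> \<beta> h) h')"
proof -
  have B: "bounded_op E (A \<alpha> \<beta>)" "bounded_op H (monomial_op H X \<alpha> \<beta>)"
    if "\<alpha> \<in> neg_words ns ms" "\<beta> \<in> pos_words ns ms" for \<alpha> \<beta>
    using that bounded_coeffsD[OF A] H.monomial_op_bounded[OF X] level_words_subset by blast+
  have val: "op_tensor E H K \<tau> (A \<alpha> \<beta>) (monomial_op H X \<alpha> \<beta>) (\<tau> e h) = \<tau> (A \<alpha> \<beta> e) (monomial_op H X \<alpha> \<beta> h)"
    if "\<alpha> \<in> neg_words ns ms" "\<beta> \<in> pos_words ns ms" for \<alpha> \<beta>
    by (rule op_tensor_apply[OF B[OF that] V(1,3)])
  have AV: "A \<alpha> \<beta> e \<in> vectors E" and XV: "monomial_op H X \<alpha> \<beta> h \<in> vectors H"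
    if "\<alpha> \<in> neg_words ns ms" "\<beta> \<in> pos_words ns ms" for \<alpha> \<beta>
    using E.bounded_op_closed[OF B(1)[OF that] V(1)] H.bounded_op_closed[OF B(2)[OF that] V(3)] .
  have mem: "\<tau> (A \<alpha> \<beta> e) (monomial_op H X \<alpha> \<beta> h) \<in> vectors K"
    if "\<alpha> \<in> neg_words ns ms" "\<beta> \<in> pos_words ns ms" for \<alpha> \<beta>
    by (rule \<tau>_closed[OF AV[OF that] XV[OF that]])
  have eq: "homogeneous_part E H K \<tau> ns A X ms (\<tau> e h)
      = (\<Sum>\<alpha>\<in>neg_words ns ms. \<Sum>\<beta>\<in>pos_words ns ms. \<tau> (A \<alpha> \<beta> e) (monomial_op H X \<alpha> \<beta> h))"
    unfolding homogeneous_part_def sum_fun_eval[where x = "\<tau> e h"] by (intro sum.cong refl val)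
  have "ip K (homogeneous_part E H K \<tau> ns A X ms (\<tau> e h)) (\<tau> e' h')
      = (\<Sum>\<alpha>\<in>neg_words ns ms. \<Sum>\<beta>\<in>pos_words ns ms.
        ip K (\<tau> (A \<alpha> \<beta> e) (monomial_op H X \<alpha> \<beta> h)) (\<tau> e' h'))"
    unfolding eq using mem V by (simp add: K.ip.sum_left K.V_sum \<tau>_closed)
  also have "\<dots> = (\<Sum>\<alpha>\<in>neg_words ns ms. \<Sum>\<beta>\<in>pos_words ns ms.
        ip E (A \<alpha> \<beta> e) e' * ip H (monomial_op H X \<alpha> \<beta> h) h')"
    using V by (intro sum.cong refl \<tau>_ip AV XV)
  finally show ?thesis .
qed

lemma represents_bounded:
  assumes "represents E H K \<tau> ns A X T" "bounded_coeffs ns E A" "H.bounded_rows ns X"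
  shows "bounded_op K T"
  using assms(1) K.iterated_op_sums_bounded homogeneous_part_bounded[OF assms(2,3)]
  unfolding represents_def by blast

lemma represents_ip:
  assumes T: "represents E H K \<tau> ns A X T" and A: "bounded_coeffs ns E A" and X: "H.bounded_rows ns X"
    and "x \<in> vectors K" "y \<in> vectors K"
    and "((\<lambda>ms. ip K (homogeneous_part E H K \<tau> ns A X ms x) y) has_sum s) {ms. length ms = length ns}"
  shows "ip K (T x) y = s"
  using T[unfolded represents_def] homogeneous_part_bounded[OF A X] assms(4-)
  by (rule K.iterated_op_sums_ip)

end

lemma free_pluriharmonic_bounded_coeffs:
  "free_pluriharmonic TYPE('h) ns E A \<Longrightarrow> bounded_coeffs ns E A"
  by (simp add: free_pluriharmonic_def bounded_coeffs_def)

lemma free_pluriharmonic_eval: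
  fixes H :: "'h hilbert"
  assumes "free_pluriharmonic TYPE('h) ns E A" "hilbert_space H" "hilbert_tensor E H K \<tau>" "X \<in> polyball ns H"
  shows "represents E H K \<tau> ns A X (ph_eval E H K \<tau> ns A X)"
proof -
  have "\<exists>T. represents E H K \<tau> ns A X T"
    using assms unfolding free_pluriharmonic_def by blast
  then show ?thesis unfolding ph_eval_def by (rule someI_ex)
qed

lemma tensor_space_intro:
  assumes "hilbert_space E" "hilbert_space H" "hilbert_tensor E H K \<tau>"
  shows "tensor_space E H K \<tau>"
  using assms by (auto simp: tensor_space_def tensor_space_axioms_def hilbert_tensor_def)

lemma sum_swap4:
  "(\<Sum>p\<in>P. \<Sum>q\<in>Q. \<Sum>a\<in>A. \<Sum>b\<in>B. f a b p q) = (\<Sum>a\<in>A. \<Sum>b\<in>B. \<Sum>p\<in>P. \<Sum>q\<in>Q. f a b p q)"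
proof -
  have "(\<Sum>p\<in>P. \<Sum>q\<in>Q. \<Sum>a\<in>A. \<Sum>b\<in>B. f a b p q) = (\<Sum>p\<in>P. \<Sum>a\<in>A. \<Sum>q\<in>Q. \<Sum>b\<in>B. f a b p q)"
    by (intro sum.cong refl sum.swap)
  also have "\<dots> = (\<Sum>a\<in>A. \<Sum>p\<in>P. \<Sum>b\<in>B. \<Sum>q\<in>Q. f a b p q)"
    by (subst sum.swap) (intro sum.cong refl sum.swap)
  also have "\<dots> = (\<Sum>a\<in>A. \<Sum>b\<in>B. \<Sum>p\<in>P. \<Sum>q\<in>Q. f a b p q)"
    by (intro sum.cong refl sum.swap)
  finally show ?thesis .
qed

theorem psd_kernel_imp_positive:
  assumes E: "hilbert_space E" and F: "free_pluriharmonic TYPE('h) ns E A"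
    and psd: "\<And>r. \<lbrakk>0 \<le> r; r < 1\<rbrakk> \<Longrightarrow> psd_kernel ns E (ph_kernel (dilate r A))"
  shows "ph_positive TYPE('h) ns E A"
  unfolding ph_positive_def
proof (intro allI impI)
  fix H :: "'h hilbert" and K \<tau> X
  assume asm: "hilbert_space H \<and> hilbert_tensor E H K \<tau> \<and> X \<in> polyball ns H"
  then interpret tensor_space E H K \<tau> by (intro tensor_space_intro E) auto
  have X: "X \<in> polyball ns H" using asm by blast
  note A = free_pluriharmonic_bounded_coeffs[OF F] and B = H.polyball_bounded_rows[OF X]
  let ?T = "ph_eval E H K \<tau> ns A X" and ?G = "homogeneous_part E H K \<tau> ns A X"
  have T: "represents E H K \<tau> ns A X ?T"
    using asm by (intro free_pluriharmonic_eval[OF F]) auto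
  obtain t q :: real where t: "1 < t"
    and P: "poisson_rows H ns (\<lambda>i j x. of_real t \<cdot>\<^sub>C H.adj_rows X i j x) q"
    using H.polyball_poisson_rows[OF X] by blast
  define r where "r = 1 / t"
  have r: "0 \<le> r" "r < 1" using t by (auto simp: r_def)
  show "positive_op K ?T"
  proof (rule positive_op_if_elementary)
    show "bounded_op K ?T" by (rule represents_bounded[OF T A B])
    fix N :: nat and e h
    assume e: "\<And>p. p < N \<Longrightarrow> e p \<in> vectors E" and h: "\<And>p. p < N \<Longrightarrow> h p \<in> vectors H"
    let ?a = "\<lambda>i j x. of_real t \<cdot>\<^sub>C H.adj_rows X i j x"
    interpret kernel_sum H ns ?a q E N e h
      by (intro kernel_sum.intro kernel_sum_axioms.intro P E.hilbert_space_axioms e h)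
    let ?u = "\<Sum>p<N. \<tau> (e p) (h p)"
    have \<tau>V: "\<tau> (e p) (h p) \<in> vectors K" if "p < N" for p
      by (rule \<tau>_closed[OF e[OF that] h[OF that]])
    have u: "?u \<in> vectors K" using \<tau>V by (intro K.V_sum) auto
    have act: "act ?a \<sigma> x = (of_real t ^ sum_list (map length \<sigma>)) \<cdot>\<^sub>C act (H.adj_rows X) \<sigma> x"
      if "\<sigma> \<in> multiwords ns" for \<sigma> x
      by (rule act_scaled[OF _ that]) (use B H.adj_rows_scale in \<open>simp add: H.bounded_rows_def\<close>)
    have scaled: "ip E (A \<alpha> \<beta> (e q)) (e p) * ip H (monomial_op H X \<alpha> \<beta> (h q)) (h p)
        = ip E (dilate r A \<alpha> \<beta> (e q)) (e p) * ip H (act ?a \<beta> (h q)) (act ?a \<alpha> (h p))"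
      if \<alpha>\<beta>: "\<alpha> \<in> neg_words ns ms" "\<beta> \<in> pos_words ns ms" and pq: "p < N" "q < N" for \<alpha> \<beta> ms p q
    proof -
      have W: "\<alpha> \<in> multiwords ns" "\<beta> \<in> multiwords ns" using \<alpha>\<beta> level_words_subset by blast+
      let ?l = "sum_list (map length \<alpha>)" and ?m = "sum_list (map length \<beta>)"
      have V: "act (H.adj_rows X) \<alpha> (h p) \<in> vectors H" "act (H.adj_rows X) \<beta> (h q) \<in> vectors H"
        using H.act_adj_rows_closed[OF B] W h pq by auto
      have "ip H (act ?a \<beta> (h q)) (act ?a \<alpha> (h p))
          = of_real t ^ (?l + ?m) * ip H (monomial_op H X \<alpha> \<beta> (h q)) (h p)"
        using V H.monomial_op_ip[OF B H.polyball_commuting_rows[OF X] W h[OF pq(2)] h[OF pq(1)]]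
        by (simp add: act W H.ip.scale_left H.ip.scale_right H.V_scale power_add)
      moreover have "ip E (dilate r A \<alpha> \<beta> (e q)) (e p) = of_real (r ^ (?l + ?m)) * ip E (A \<alpha> \<beta> (e q)) (e p)"
        unfolding dilate_def using bounded_coeffsD[OF A \<alpha>\<beta>] e pq
        by (simp add: E.ip.scale_left E.bounded_op_closed)
      moreover have "of_real (r ^ (?l + ?m)) * of_real t ^ (?l + ?m) = (1 :: complex)"
        using t by (simp add: r_def power_mult_distrib[symmetric] flip: of_real_power of_real_mult)
      ultimately show ?thesis by simp
    qed
    have part: "ip K (?G ms ?u) ?u = part_value (dilate r A) ms" for ms
    proof -
      have G: "bounded_op K (?G ms)" by (rule homogeneous_part_bounded[OF A B])
      have eq: "?G ms ?u = (\<Sum>q<N. ?G ms (\<tau> (e q) (h q)))"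
        using \<tau>V by (intro K.bounded_op_sum[OF G]) auto
      have "ip K (?G ms ?u) ?u = (\<Sum>q<N. ip K (?G ms (\<tau> (e q) (h q))) ?u)"
        unfolding eq using \<tau>V by (intro K.ip.sum_left u K.bounded_op_closed[OF G]) auto
      also have "\<dots> = (\<Sum>q<N. \<Sum>p<N. ip K (?G ms (\<tau> (e q) (h q))) (\<tau> (e p) (h p)))"
        using \<tau>V G by (intro sum.cong refl K.ip.sum_right) (auto simp: K.bounded_op_closed)
      also have "\<dots> = (\<Sum>p<N. \<Sum>q<N. \<Sum>\<alpha>\<in>neg_words ns ms. \<Sum>\<beta>\<in>pos_words ns ms.
          ip E (dilate r A \<alpha> \<beta> (e q)) (e p) * ip H (act ?a \<beta> (h q)) (act ?a \<alpha> (h p)))"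
      proof (subst sum.swap, intro sum.cong refl)
        fix p q assume "p \<in> {..<N}" "q \<in> {..<N}"
        then have pq: "p < N" "q < N" by auto
        show "ip K (?G ms (\<tau> (e q) (h q))) (\<tau> (e p) (h p)) = (\<Sum>\<alpha>\<in>neg_words ns ms. \<Sum>\<beta>\<in>pos_words ns ms.
            ip E (dilate r A \<alpha> \<beta> (e q)) (e p) * ip H (act ?a \<beta> (h q)) (act ?a \<alpha> (h p)))"
          unfolding homogeneous_part_ip[OF A B e[OF pq(2)] e[OF pq(1)] h[OF pq(2)] h[OF pq(1)]]
          by (intro sum.cong refl scaled pq)
      qed
      also have "\<dots> = part_value (dilate r A) ms"
        unfolding part_value_def by (rule sum_swap4)
      finally show ?thesis .
    qed
    obtain S where S: "S \<in> \<real>\<^sub>\<ge>\<^sub>0" "(part_value (dilate r A) has_sum S) {ms. length ms = length ns}"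
      using part_value_sum_nonneg[OF A r psd] by blast
    have "ip K (?T ?u) ?u = S"
      by (rule represents_ip[OF T A B u u]) (use S(2) in \<open>simp add: part\<close>)
    then show "ip K (?T ?u) ?u \<in> \<real>\<^sub>\<ge>\<^sub>0" using S(1) by simp
  qed
qed

section \<open>Square-summable families\<close>

text \<open>
  The coordinate \<open>a\<close> of the \<open>i\<close>-th member of the family \<open>f\<close> is stored as \<open>f (\<phi> i a)\<close>.
\<close>

locale l2_sum = E: hilbert_space E for E :: "'e hilbert" +
  fixes I :: "'x set" and \<phi> :: "'x \<Rightarrow> 'e \<Rightarrow> 'j"
  assumes \<phi>_inj: "\<lbrakk>i \<in> I; i' \<in> I; \<phi> i a = \<phi> i' a'\<rbrakk> \<Longrightarrow> i = i' \<and> a = a'"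
begin

definition coord :: "'x \<Rightarrow> 'j cfun \<Rightarrow> 'e cfun"
  where "coord i f = (\<lambda>a. f (\<phi> i a))"

definition embed :: "('x \<Rightarrow> 'e cfun) \<Rightarrow> 'j cfun"
  where "embed g j = (if \<exists>i\<in>I. \<exists>a. j = \<phi> i a
    then (let (i, a) = (SOME (i, a). i \<in> I \<and> j = \<phi> i a) in g i a) else 0)"

definition L2 :: "'j hilbert"
  where "L2 = \<lparr>vectors = {f. (\<forall>j. (\<forall>i\<in>I. \<forall>a. j \<noteq> \<phi> i a) \<longrightarrow> f j = 0) \<and>
      (\<forall>i\<in>I. coord i f \<in> vectors E) \<and> (\<lambda>i. (hnorm E (coord i f))\<^sup>2) summable_on I},
    ip = \<lambda>f g. \<Sum>\<^sub>\<infinity>i\<in>I. ip E (coord i f) (coord i g)\<rparr>"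

lemma coord_embed: "i \<in> I \<Longrightarrow> coord i (embed g) = g i"
proof
  fix a assume i: "i \<in> I"
  have "(SOME (i', a'). i' \<in> I \<and> \<phi> i a = \<phi> i' a') = (i, a)"
    using \<phi>_inj[OF i] i by (intro some_equality) auto
  then show "coord i (embed g) a = g i a"
    using i by (auto simp: coord_def embed_def)
qed

lemma embed_outside: "(\<forall>i\<in>I. \<forall>a. j \<noteq> \<phi> i a) \<Longrightarrow> embed g j = 0"
  by (auto simp: embed_def)

lemma coord_linear:
  "coord i 0 = 0" "coord i (f + g) = coord i f + coord i g" "coord i (f - g) = coord i f - coord i g"
  "coord i (c \<cdot>\<^sub>C f) = c \<cdot>\<^sub>C coord i f"
  by (simp_all add: coord_def fun_eq_iff fun_apply cscale_apply)

lemma coord_sum: "coord i (\<Sum>p\<in>P. f p) = (\<Sum>p\<in>P. coord i (f p))"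
  by (induction P rule: infinite_finite_induct) (simp_all add: coord_linear)

lemma L2_iff: "f \<in> vectors L2 \<longleftrightarrow> (\<forall>j. (\<forall>i\<in>I. \<forall>a. j \<noteq> \<phi> i a) \<longrightarrow> f j = 0) \<and>
    (\<forall>i\<in>I. coord i f \<in> vectors E) \<and> (\<lambda>i. (hnorm E (coord i f))\<^sup>2) summable_on I"
  by (simp add: L2_def)

lemma ip_L2: "ip L2 f g = (\<Sum>\<^sub>\<infinity>i\<in>I. ip E (coord i f) (coord i g))"
  by (simp add: L2_def)

lemma coord_in: "\<lbrakk>f \<in> vectors L2; i \<in> I\<rbrakk> \<Longrightarrow> coord i f \<in> vectors E"
  by (simp add: L2_iff)

lemma L2_summable: "f \<in> vectors L2 \<Longrightarrow> (\<lambda>i. (hnorm E (coord i f))\<^sup>2) summable_on I"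
  by (simp add: L2_iff)

lemma embed_in:
  assumes "\<And>i. i \<in> I \<Longrightarrow> g i \<in> vectors E" "(\<lambda>i. (hnorm E (g i))\<^sup>2) summable_on I"
  shows "embed g \<in> vectors L2"
  unfolding L2_iff
  using assms by (auto simp: embed_outside coord_embed cong: summable_on_cong)

lemma L2_eqI:
  assumes "f \<in> vectors L2" "g \<in> vectors L2" "\<And>i. i \<in> I \<Longrightarrow> coord i f = coord i g"
  shows "f = g"
proof
  fix j
  show "f j = g j"
  proof (cases "\<exists>i\<in>I. \<exists>a. j = \<phi> i a")
    case True
    then obtain i a where "i \<in> I" "j = \<phi> i a" by blast
    then show ?thesis using fun_cong[OF assms(3), of i a] by (simp add: coord_def)
  next
    case False
    then show ?thesis using assms(1,2) by (auto simp: L2_iff)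
  qed
qed

lemma ip_summable:
  assumes "f \<in> vectors L2" "g \<in> vectors L2"
  shows "(\<lambda>i. ip E (coord i f) (coord i g)) summable_on I"
proof (rule abs_summable_summable)
  have "(\<lambda>i. ((hnorm E (coord i f))\<^sup>2 + (hnorm E (coord i g))\<^sup>2) * (1/2)) summable_on I"
    by (intro summable_on_cmult_left summable_on_add L2_summable assms)
  then show "(\<lambda>i. norm (ip E (coord i f) (coord i g))) summable_on I"
  proof (rule summable_on_comparison_test)
    show "norm (ip E (coord i f) (coord i g)) \<le> ((hnorm E (coord i f))\<^sup>2 + (hnorm E (coord i g))\<^sup>2) * (1/2)"
      if "i \<in> I" for i
      using E.ip.cmod_le_half[OF coord_in coord_in] assms that by (simp add: E.hnorm_sq coord_in)
  qed simp
qed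

lemma L2_add:
  assumes "f \<in> vectors L2" "g \<in> vectors L2"
  shows "f + g \<in> vectors L2"
  unfolding L2_iff
proof (intro conjI)
  have "(\<lambda>i. ((hnorm E (coord i f))\<^sup>2 + (hnorm E (coord i g))\<^sup>2) * 2) summable_on I"
    by (intro summable_on_cmult_left summable_on_add L2_summable assms)
  then show "(\<lambda>i. (hnorm E (coord i (f + g)))\<^sup>2) summable_on I"
  proof (rule summable_on_comparison_test)
    show "(hnorm E (coord i (f + g)))\<^sup>2 \<le> ((hnorm E (coord i f))\<^sup>2 + (hnorm E (coord i g))\<^sup>2) * 2"
      if "i \<in> I" for i
    proof -
      have le: "p \<le> (r + t) * 2" if "p + q = 2 * r + 2 * t" "0 \<le> q" for p q r t :: real
        using that by simp
      show ?thesis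
        unfolding coord_linear
        by (rule le[OF E.parallelogram[OF coord_in[OF assms(1) that] coord_in[OF assms(2) that]]]) simp
    qed
  qed simp
qed (use assms in \<open>auto simp: L2_iff coord_linear E.V_add fun_apply\<close>)

lemma L2_scale:
  assumes "f \<in> vectors L2"
  shows "c \<cdot>\<^sub>C f \<in> vectors L2"
  unfolding L2_iff
proof (intro conjI)
  have "(\<lambda>i. (cmod c)\<^sup>2 * (hnorm E (coord i f))\<^sup>2) summable_on I"
    by (intro summable_on_cmult_right L2_summable assms)
  then show "(\<lambda>i. (hnorm E (coord i (c \<cdot>\<^sub>C f)))\<^sup>2) summable_on I"
    using assms by (simp add: coord_linear E.hnorm_scale coord_in power_mult_distrib cong: summable_on_cong)
qed (use assms in \<open>auto simp: L2_iff coord_linear E.V_scale cscale_apply\<close>)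

lemma L2_zero: "0 \<in> vectors L2"
  by (simp add: L2_iff coord_linear E.V_zero fun_apply)

lemma L2_diff: "\<lbrakk>f \<in> vectors L2; g \<in> vectors L2\<rbrakk> \<Longrightarrow> f - g \<in> vectors L2"
  using L2_add[of f "(-1) \<cdot>\<^sub>C g"] L2_scale[of g "-1"] by simp

lemma ip_L2_self:
  assumes "f \<in> vectors L2"
  shows "ip L2 f f = of_real (\<Sum>\<^sub>\<infinity>i\<in>I. (hnorm E (coord i f))\<^sup>2)"
proof -
  have "((\<lambda>i. complex_of_real ((hnorm E (coord i f))\<^sup>2)) has_sum
      of_real (\<Sum>\<^sub>\<infinity>i\<in>I. (hnorm E (coord i f))\<^sup>2)) I"
    using L2_summable[OF assms] by (intro has_sum_of_real) simp
  then have "((\<lambda>i. ip E (coord i f) (coord i f)) has_sum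
      of_real (\<Sum>\<^sub>\<infinity>i\<in>I. (hnorm E (coord i f))\<^sup>2)) I"
    by (rule has_sum_cong[THEN iffD1, rotated]) (simp add: E.ip_self coord_in[OF assms])
  then show ?thesis unfolding ip_L2 by (rule infsumI)
qed

lemma hnorm_L2_sq:
  assumes "f \<in> vectors L2"
  shows "(hnorm L2 f)\<^sup>2 = (\<Sum>\<^sub>\<infinity>i\<in>I. (hnorm E (coord i f))\<^sup>2)"
  unfolding hnorm_def[of L2] ip_L2_self[OF assms] by (simp add: infsum_nonneg)

lemma hnorm_L2_nonneg: "f \<in> vectors L2 \<Longrightarrow> 0 \<le> hnorm L2 f"
  unfolding hnorm_def[of L2] by (simp add: ip_L2_self infsum_nonneg)

lemma hnorm_coord_le:
  assumes f: "f \<in> vectors L2" and i: "i \<in> I"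
  shows "hnorm E (coord i f) \<le> hnorm L2 f"
proof (rule power2_le_imp_le)
  have "(\<Sum>i\<in>{i}. (hnorm E (coord i f))\<^sup>2) \<le> (\<Sum>\<^sub>\<infinity>i\<in>I. (hnorm E (coord i f))\<^sup>2)"
    by (rule finite_sum_le_infsum[OF L2_summable[OF f]]) (use i in auto)
  then show "(hnorm E (coord i f))\<^sup>2 \<le> (hnorm L2 f)\<^sup>2"
    by (simp add: hnorm_L2_sq[OF f])
qed (rule hnorm_L2_nonneg[OF f])

lemma L2_bounded_finite_sums:
  assumes "0 \<le> M" "\<And>i. i \<in> I \<Longrightarrow> g i \<in> vectors E"
    and "\<And>F. \<lbrakk>finite F; F \<subseteq> I\<rbrakk> \<Longrightarrow> (\<Sum>i\<in>F. (hnorm E (g i))\<^sup>2) \<le> M\<^sup>2"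
  shows "embed g \<in> vectors L2" "hnorm L2 (embed g) \<le> M"
proof -
  have sum: "(\<lambda>i. (hnorm E (g i))\<^sup>2) summable_on I"
    by (intro nonneg_bdd_above_summable_on bdd_aboveI[where M = "M\<^sup>2"]) (use assms(3) in auto)
  show mem: "embed g \<in> vectors L2" by (rule embed_in[OF assms(2) sum])
  have "(\<Sum>\<^sub>\<infinity>i\<in>I. (hnorm E (coord i (embed g)))\<^sup>2) = (\<Sum>\<^sub>\<infinity>i\<in>I. (hnorm E (g i))\<^sup>2)"
    by (rule infsum_cong) (simp add: coord_embed)
  also have "\<dots> \<le> M\<^sup>2"
    by (rule infsum_le_finite_sums[OF sum]) (use assms(3) in auto)
  finally have sq: "(hnorm L2 (embed g))\<^sup>2 \<le> M\<^sup>2"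
    by (simp add: hnorm_L2_sq[OF mem])
  show "hnorm L2 (embed g) \<le> M"
    by (rule power2_le_imp_le[OF sq assms(1)])
qed

lemma L2_complete:
  assumes s: "\<forall>n. s n \<in> vectors L2"
    and cauchy: "\<forall>e>0. \<exists>N. \<forall>m\<ge>N. \<forall>n\<ge>N. hnorm L2 (s m - s n) < e"
  shows "\<exists>x\<in>vectors L2. (\<lambda>n. hnorm L2 (s n - x)) \<longlonglongrightarrow> 0"
proof -
  have V: "coord i (s n) \<in> vectors E" if "i \<in> I" for i n using s that by (simp add: coord_in)
  have "\<exists>y\<in>vectors E. (\<lambda>n. hnorm E (coord i (s n) - y)) \<longlonglongrightarrow> 0" if i: "i \<in> I" for i
  proof (rule E.complete)
    show "\<forall>n. coord i (s n) \<in> vectors E" using V[OF i] by blast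
    show "\<forall>e>0. \<exists>N. \<forall>m\<ge>N. \<forall>n\<ge>N. hnorm E (coord i (s m) - coord i (s n)) < e"
    proof (intro allI impI)
      fix e :: real assume "0 < e"
      then obtain N where N: "\<forall>m\<ge>N. \<forall>n\<ge>N. hnorm L2 (s m - s n) < e" using cauchy by blast
      have "hnorm E (coord i (s m) - coord i (s n)) \<le> hnorm L2 (s m - s n)" for m n
        using hnorm_coord_le[OF L2_diff i, of "s m" "s n"] s by (simp add: coord_linear)
      then show "\<exists>N. \<forall>m\<ge>N. \<forall>n\<ge>N. hnorm E (coord i (s m) - coord i (s n)) < e"
        using N order_le_less_trans by blast
    qed
  qed
  then obtain g where g: "\<And>i. i \<in> I \<Longrightarrow> g i \<in> vectors E"
      "\<And>i. i \<in> I \<Longrightarrow> (\<lambda>n. hnorm E (coord i (s n) - g i)) \<longlonglongrightarrow> 0"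
    by metis
  have close: "embed (\<lambda>i. coord i (s m) - g i) \<in> vectors L2 \<and> hnorm L2 (embed (\<lambda>i. coord i (s m) - g i)) \<le> e"
    if e: "0 < e" and m: "\<forall>n\<ge>N. hnorm L2 (s m - s n) < e" for e m N
  proof (rule conjI; rule L2_bounded_finite_sums)
    show "0 \<le> e" "0 \<le> e" using e by auto
    show "coord i (s m) - g i \<in> vectors E" "coord i (s m) - g i \<in> vectors E" if "i \<in> I" for i
      using V g that by (simp_all add: E.V_diff)
    have "(\<Sum>i\<in>F. (hnorm E (coord i (s m) - g i))\<^sup>2) \<le> e\<^sup>2" if F: "finite F" "F \<subseteq> I" for F
    proof (rule LIMSEQ_le_const2)
      show "(\<lambda>n. \<Sum>i\<in>F. (hnorm E (coord i (s m) - coord i (s n)))\<^sup>2) \<longlonglongrightarrow> (\<Sum>i\<in>F. (hnorm E (coord i (s m) - g i))\<^sup>2)"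
      proof (intro tendsto_intros)
        fix i assume "i \<in> F"
        then have i: "i \<in> I" using F by auto
        have "(\<lambda>n. hnorm E (coord i (s m) - coord i (s n)) - hnorm E (coord i (s m) - g i)) \<longlonglongrightarrow> 0"
        proof (rule Lim_null_comparison[OF always_eventually g(2)[OF i]], rule allI)
          fix n
          have "\<bar>hnorm E (coord i (s m) - coord i (s n)) - hnorm E (coord i (s m) - g i)\<bar>
              \<le> hnorm E ((coord i (s m) - coord i (s n)) - (coord i (s m) - g i))"
            using V[OF i] g(1)[OF i] by (intro E.hnorm_triangle_abs E.V_diff)
          also have "(coord i (s m) - coord i (s n)) - (coord i (s m) - g i) = g i - coord i (s n)"
            by (simp add: algebra_simps)
          also have "hnorm E (g i - coord i (s n)) = hnorm E (coord i (s n) - g i)"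
            using V[OF i] g(1)[OF i] by (intro E.hnorm_minus_commute)
          finally show "norm (hnorm E (coord i (s m) - coord i (s n)) - hnorm E (coord i (s m) - g i))
              \<le> hnorm E (coord i (s n) - g i)" by simp
        qed
        then show "(\<lambda>n. hnorm E (coord i (s m) - coord i (s n))) \<longlonglongrightarrow> hnorm E (coord i (s m) - g i)"
          by (rule LIM_zero_cancel)
      qed
      have "(\<Sum>i\<in>F. (hnorm E (coord i (s m) - coord i (s n)))\<^sup>2) \<le> e\<^sup>2" if "n \<ge> N" for n
      proof -
        have d: "s m - s n \<in> vectors L2" using s by (simp add: L2_diff)
        have "(\<Sum>i\<in>F. (hnorm E (coord i (s m - s n)))\<^sup>2) \<le> (hnorm L2 (s m - s n))\<^sup>2"
          unfolding hnorm_L2_sq[OF d] by (rule finite_sum_le_infsum[OF L2_summable[OF d]]) (use F in auto)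
        also have "\<dots> \<le> e\<^sup>2"
          using m that hnorm_L2_nonneg[OF d] by (intro power_mono) (auto intro: less_imp_le)
        finally show ?thesis by (simp add: coord_linear)
      qed
      then show "\<exists>N. \<forall>n\<ge>N. (\<Sum>i\<in>F. (hnorm E (coord i (s m) - coord i (s n)))\<^sup>2) \<le> e\<^sup>2" by blast
    qed
    then show "\<lbrakk>finite F; F \<subseteq> I\<rbrakk> \<Longrightarrow> (\<Sum>i\<in>F. (hnorm E (coord i (s m) - g i))\<^sup>2) \<le> e\<^sup>2"
        "\<lbrakk>finite F; F \<subseteq> I\<rbrakk> \<Longrightarrow> (\<Sum>i\<in>F. (hnorm E (coord i (s m) - g i))\<^sup>2) \<le> e\<^sup>2" for F
      by blast+
  qed
  obtain N0 where N0: "\<forall>m\<ge>N0. \<forall>n\<ge>N0. hnorm L2 (s m - s n) < 1"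
    using cauchy zero_less_one by blast
  have c0: "embed (\<lambda>i. coord i (s N0) - g i) \<in> vectors L2"
    using close[of 1 N0 N0] N0 by simp
  define x where "x = s N0 - embed (\<lambda>i. coord i (s N0) - g i)"
  have x: "x \<in> vectors L2" unfolding x_def using s c0 by (intro L2_diff) auto
  have cx: "coord i x = g i" if "i \<in> I" for i
    by (simp add: x_def coord_linear coord_embed that)
  have "hnorm L2 (s m - x) \<le> e" if e: "0 < e" and m: "\<forall>n\<ge>N. hnorm L2 (s m - s n) < e" for e m N
  proof -
    have "s m - x = embed (\<lambda>i. coord i (s m) - g i)"
      using close[OF e m] s x by (intro L2_eqI L2_diff) (auto simp: coord_linear coord_embed cx)
    then show ?thesis using close[OF e m] by simp
  qed
  then have "\<exists>N. \<forall>m\<ge>N. norm (hnorm L2 (s m - x) - 0) < e" if e: "0 < e" for e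
  proof -
    obtain N where N: "\<forall>m\<ge>N. \<forall>n\<ge>N. hnorm L2 (s m - s n) < e / 2"
      using cauchy half_gt_zero[OF e] by blast
    have "hnorm L2 (s m - x) \<le> e / 2" if "m \<ge> N" for m
      using N that e \<open>\<And>e m N. \<lbrakk>0 < e; \<forall>n\<ge>N. hnorm L2 (s m - s n) < e\<rbrakk> \<Longrightarrow> hnorm L2 (s m - x) \<le> e\<close>[of "e / 2" N m]
      by simp
    moreover have "0 \<le> hnorm L2 (s m - x)" for m
      using s x by (intro hnorm_L2_nonneg L2_diff) auto
    ultimately show ?thesis using e by (intro exI[of _ N]) fastforce
  qed
  then have "(\<lambda>n. hnorm L2 (s n - x)) \<longlonglongrightarrow> 0"
    by (rule LIMSEQ_I)
  with x show ?thesis by blast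
qed

lemma L2_hilbert: "hilbert_space L2"
proof unfold_locales
  show "x + y \<in> vectors L2" if "x \<in> vectors L2" "y \<in> vectors L2" for x y using that by (rule L2_add)
  show "0 \<in> vectors L2" by (rule L2_zero)
  show "c \<cdot>\<^sub>C x \<in> vectors L2" if "x \<in> vectors L2" for c x using that by (rule L2_scale)
  show "ip L2 (x + y) z = ip L2 x z + ip L2 y z"
    if "x \<in> vectors L2" "y \<in> vectors L2" "z \<in> vectors L2" for x y z
  proof -
    have "ip L2 (x + y) z = (\<Sum>\<^sub>\<infinity>i\<in>I. ip E (coord i x) (coord i z) + ip E (coord i y) (coord i z))"
      unfolding ip_L2 using that by (intro infsum_cong) (simp add: coord_linear E.ip_add_left coord_in)
    also have "\<dots> = ip L2 x z + ip L2 y z"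
      unfolding ip_L2 using that by (intro infsum_add ip_summable)
    finally show ?thesis .
  qed
  show "ip L2 (c \<cdot>\<^sub>C x) y = c * ip L2 x y" if "x \<in> vectors L2" "y \<in> vectors L2" for c x y
  proof -
    have "ip L2 (c \<cdot>\<^sub>C x) y = (\<Sum>\<^sub>\<infinity>i\<in>I. c * ip E (coord i x) (coord i y))"
      unfolding ip_L2 using that by (intro infsum_cong) (simp add: coord_linear E.ip_scale_left coord_in)
    then show ?thesis unfolding ip_L2 by (simp add: infsum_cmult_right')
  qed
  show "ip L2 y x = cnj (ip L2 x y)" if "x \<in> vectors L2" "y \<in> vectors L2" for x y
  proof -
    have "ip L2 y x = (\<Sum>\<^sub>\<infinity>i\<in>I. cnj (ip E (coord i x) (coord i y)))"
      unfolding ip_L2 using that by (intro infsum_cong E.ip_commute coord_in)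
    then show ?thesis unfolding ip_L2 by simp
  qed
  show "ip L2 x x \<in> \<real>\<^sub>\<ge>\<^sub>0" if "x \<in> vectors L2" for x
    unfolding ip_L2_self[OF that] by (simp add: infsum_nonneg)
  show "x = 0" if x: "x \<in> vectors L2" and 0: "ip L2 x x = 0" for x
  proof (rule L2_eqI[OF x L2_zero])
    fix i assume i: "i \<in> I"
    have "hnorm L2 x = 0" by (simp add: hnorm_def[of L2] 0)
    then have "hnorm E (coord i x) = 0"
      using hnorm_coord_le[OF x i] E.hnorm_nonneg[OF coord_in[OF x i]] by simp
    then show "coord i x = coord i 0"
      using E.hnorm_eq_0[OF coord_in[OF x i]] by (simp add: coord_linear)
  qed
qed (rule L2_complete)

sublocale L2: hilbert_space L2
  by (rule L2_hilbert)

definition single :: "'x \<Rightarrow> 'e cfun \<Rightarrow> 'j cfun"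
  where "single i v = embed (\<lambda>i'. if i' = i then v else 0)"

lemma coord_single: "i' \<in> I \<Longrightarrow> coord i' (single i v) = (if i' = i then v else 0)"
  by (simp add: single_def coord_embed)

lemma single_in:
  assumes "v \<in> vectors E"
  shows "single i v \<in> vectors L2"
  unfolding single_def
proof (rule embed_in)
  show "(\<lambda>i'. (hnorm E (if i' = i then v else 0))\<^sup>2) summable_on I"
    by (rule finite_nonzero_values_imp_summable_on) (rule finite_subset[of _ "{i}"], auto split: if_splits)
qed (use assms E.V_zero in auto)

lemma ip_single_right:
  assumes "f \<in> vectors L2" "i \<in> I" "v \<in> vectors E"
  shows "ip L2 f (single i v) = ip E (coord i f) v"
proof -
  have "((\<lambda>i'. ip E (coord i' f) (coord i' (single i v))) has_sum ip E (coord i f) v) I"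
    by (rule has_sum_finite_neutralI[of "{i}"])
      (use assms in \<open>auto simp: coord_single E.ip.zero_right coord_in\<close>)
  then show ?thesis unfolding ip_L2 by (rule infsumI)
qed

lemma finite_approximation:
  assumes u: "u \<in> vectors L2" and "0 < \<epsilon>"
  obtains F where "finite F" "F \<subseteq> I" "hnorm L2 (u - (\<Sum>i\<in>F. single i (coord i u))) < \<epsilon>"
proof -
  let ?n = "\<lambda>i. (hnorm E (coord i u))\<^sup>2"
  have "0 < (\<epsilon> / 2)\<^sup>2" using \<open>0 < \<epsilon>\<close> by simp
  then obtain F where F: "finite F" "F \<subseteq> I" "dist (sum ?n F) (infsum ?n I) \<le> (\<epsilon> / 2)\<^sup>2"
    using infsum_finite_approximation[OF L2_summable[OF u]] by blast
  let ?d = "u - (\<Sum>i\<in>F. single i (coord i u))"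
  have V: "single i (coord i u) \<in> vectors L2" if "i \<in> F" for i
    using F that u by (intro single_in coord_in) auto
  have d: "?d \<in> vectors L2" using u V by (intro L2_diff L2.V_sum)
  have "coord i ?d = (if i \<in> F then 0 else coord i u)" if "i \<in> I" for i
    using F(1) that by (simp add: coord_linear coord_sum coord_single)
  then have "(hnorm L2 ?d)\<^sup>2 = (\<Sum>\<^sub>\<infinity>i\<in>I. if i \<in> F then 0 else ?n i)"
    unfolding hnorm_L2_sq[OF d] by (intro infsum_cong) simp
  also have "\<dots> = infsum ?n (I - F)"
    by (rule infsum_cong_neutral) auto
  also have "\<dots> = infsum ?n I - sum ?n F"
    using infsum_Diff[OF L2_summable[OF u] _ F(2)] F(1) by simp
  also have "\<dots> \<le> (\<epsilon> / 2)\<^sup>2"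
    using F(3) by (simp add: dist_real_def abs_le_iff)
  finally have sq: "(hnorm L2 ?d)\<^sup>2 \<le> (\<epsilon> / 2)\<^sup>2" .
  have "hnorm L2 ?d \<le> \<epsilon> / 2"
    by (rule power2_le_imp_le[OF sq]) (use \<open>0 < \<epsilon>\<close> in simp)
  then show ?thesis using that F \<open>0 < \<epsilon>\<close> by force
qed

end

section \<open>Creation operators on the Fock space\<close>

definition scalars :: "unit hilbert"
  where "scalars = \<lparr>vectors = UNIV, ip = \<lambda>x y. x () * cnj (y ())\<rparr>"

lemma scalars_simps [simp]: "vectors scalars = UNIV" "ip scalars x y = x () * cnj (y ())"
  by (simp_all add: scalars_def)

lemma hnorm_scalars: "hnorm scalars x = cmod (x ())"
  by (simp add: hnorm_def complex_mult_cnj cmod_def)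

lemma scalars_hilbert: "hilbert_space scalars"
proof unfold_locales
  fix s :: "nat \<Rightarrow> unit cfun"
  assume "\<forall>e>0. \<exists>N. \<forall>m\<ge>N. \<forall>n\<ge>N. hnorm scalars (s m - s n) < e"
  then have "Cauchy (\<lambda>n. s n ())"
    unfolding Cauchy_def by (simp add: hnorm_scalars fun_apply dist_norm)
  then obtain z where "(\<lambda>n. s n ()) \<longlonglongrightarrow> z"
    using Cauchy_convergent convergentD by blast
  then have "(\<lambda>n. hnorm scalars (s n - (\<lambda>_. z))) \<longlonglongrightarrow> 0"
    by (simp add: hnorm_scalars fun_apply LIM_zero tendsto_norm_zero)
  then show "\<exists>x\<in>vectors scalars. (\<lambda>n. hnorm scalars (s n - x)) \<longlonglongrightarrow> 0"
    by auto
next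
  fix x :: "unit cfun"
  assume "ip scalars x x = 0"
  then show "x = 0" by (auto simp: fun_eq_iff fun_apply)
qed (auto simp: fun_apply cscale_apply algebra_simps complex_mult_cnj nonneg_Reals_iff
    simp flip: of_real_power of_real_add)

definition lowering :: "nat list \<Rightarrow> (nat \<Rightarrow> nat \<Rightarrow> 'i cop) \<Rightarrow> (multiword \<Rightarrow> 'i cfun) \<Rightarrow> complex \<Rightarrow> bool"
  where "lowering ns a b r \<longleftrightarrow> (\<forall>i<length ns. \<forall>j<ns ! i. a i j 0 = 0 \<and>
    (\<forall>c. \<forall>\<mu>\<in>multiwords ns. a i j (c \<cdot>\<^sub>C b \<mu>) =
      (if \<mu> ! i \<noteq> [] \<and> hd (\<mu> ! i) = j then (c * r) \<cdot>\<^sub>C b (\<mu>[i := tl (\<mu> ! i)]) else 0)))"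

lemma lowering_Cons:
  assumes "lowering (n # ns) a b r"
  shows "u \<in> lists {..<n} \<Longrightarrow> lowering ns (\<lambda>i. a (Suc i)) (\<lambda>\<rho>. b (u # \<rho>)) r"
    and "j < n \<Longrightarrow> a 0 j 0 = 0"
    and "\<lbrakk>j < n; u \<in> lists {..<n}; \<rho> \<in> multiwords ns\<rbrakk> \<Longrightarrow> a 0 j (c \<cdot>\<^sub>C b (u # \<rho>)) =
      (if u \<noteq> [] \<and> hd u = j then (c * r) \<cdot>\<^sub>C b (tl u # \<rho>) else 0)"
proof -
  show "lowering ns (\<lambda>i. a (Suc i)) (\<lambda>\<rho>. b (u # \<rho>)) r" if u: "u \<in> lists {..<n}"
    unfolding lowering_def
  proof (intro allI impI conjI ballI)
    fix i j assume ij: "i < length ns" "j < ns ! i"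
    note L = assms[unfolded lowering_def, rule_format, of "Suc i" j]
    show "a (Suc i) j 0 = 0" using L ij by simp
    fix c \<mu> assume "\<mu> \<in> multiwords ns"
    then show "a (Suc i) j (c \<cdot>\<^sub>C b (u # \<mu>)) =
        (if \<mu> ! i \<noteq> [] \<and> hd (\<mu> ! i) = j then (c * r) \<cdot>\<^sub>C b (u # \<mu>[i := tl (\<mu> ! i)]) else 0)"
      using conjunct2[OF L, rule_format, of "u # \<mu>" c] ij u by simp
  qed
  show "a 0 j 0 = 0" if "j < n"
    using assms that by (simp add: lowering_def)
  show "a 0 j (c \<cdot>\<^sub>C b (u # \<rho>)) = (if u \<noteq> [] \<and> hd u = j then (c * r) \<cdot>\<^sub>C b (tl u # \<rho>) else 0)"
    if "j < n" "u \<in> lists {..<n}" "\<rho> \<in> multiwords ns"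
    using conjunct2[OF assms[unfolded lowering_def, rule_format, of 0 j], rule_format, of "u # \<rho>" c] that
    by simp
qed

lemma lowering_fold:
  assumes L: "lowering (n # ns) a b r" and w: "w \<in> lists {..<n}" and \<rho>: "\<rho> \<in> multiwords ns"
  shows "v \<in> lists {..<n} \<Longrightarrow> fold (a 0) w (c \<cdot>\<^sub>C b ((w @ v) # \<rho>)) = (c * r ^ length w) \<cdot>\<^sub>C b (v # \<rho>)"
    and "\<lbrakk>u \<in> lists {..<n}; \<not> prefix w u\<rbrakk> \<Longrightarrow> fold (a 0) w (c \<cdot>\<^sub>C b (u # \<rho>)) = 0"
    and "fold (a 0) w 0 = 0"
proof -
  have zero: "fold (a 0) w 0 = 0" if "w \<in> lists {..<n}" for w
    using that by (induction w) (auto simp: lowering_Cons(2)[OF L])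
  then show "fold (a 0) w 0 = 0" using w by blast
  show "fold (a 0) w (c \<cdot>\<^sub>C b ((w @ v) # \<rho>)) = (c * r ^ length w) \<cdot>\<^sub>C b (v # \<rho>)" if v: "v \<in> lists {..<n}"
    using w
  proof (induction w arbitrary: c)
    case (Cons j w)
    then have "a 0 j (c \<cdot>\<^sub>C b ((j # w @ v) # \<rho>)) = (c * r) \<cdot>\<^sub>C b ((w @ v) # \<rho>)"
      using lowering_Cons(3)[OF L, of j "j # w @ v" \<rho> c] v \<rho> by simp
    then show ?case using Cons by (simp add: mult.assoc)
  qed simp
  show "fold (a 0) w (c \<cdot>\<^sub>C b (u # \<rho>)) = 0" if "u \<in> lists {..<n}" "\<not> prefix w u"
    using w that
  proof (induction w arbitrary: c u)
    case (Cons j w)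
    have z: "fold (a 0) w 0 = 0" using Cons.hyps zero[of w] by auto
    show ?case
    proof (cases "u \<noteq> [] \<and> hd u = j")
      case True
      then obtain u' where "u = j # u'" by (cases u) auto
      then show ?thesis
        using Cons lowering_Cons(3)[OF L, of j u \<rho> c] \<rho> by simp
    next
      case False
      then have "a 0 j (c \<cdot>\<^sub>C b (u # \<rho>)) = 0"
        using Cons lowering_Cons(3)[OF L, of j u \<rho> c] \<rho> by auto
      then show ?thesis using z by simp
    qed
  qed simp
qed

lemma lowering_act:
  assumes "lowering ns a b r" "\<beta> \<in> multiwords ns" "\<gamma> \<in> multiwords ns"
  shows "act a \<beta> (c \<cdot>\<^sub>C b (\<beta> @@ \<gamma>)) = (c * r ^ sum_list (map length \<beta>)) \<cdot>\<^sub>C b \<gamma>"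
  using assms
proof (induction ns arbitrary: a b \<beta> \<gamma> c)
  case Nil
  then show ?case by (simp add: multiwords_Nil)
next
  case (Cons n ns)
  from Cons.prems(2,3) obtain w \<beta>' v \<gamma>' where
    \<beta>: "\<beta> = w # \<beta>'" "w \<in> lists {..<n}" "\<beta>' \<in> multiwords ns" and
    \<gamma>: "\<gamma> = v # \<gamma>'" "v \<in> lists {..<n}" "\<gamma>' \<in> multiwords ns"
    by (auto simp: multiwords_Cons)
  have "w @ v \<in> lists {..<n}" using \<beta> \<gamma> by auto
  from Cons.IH[OF lowering_Cons(1)[OF Cons.prems(1) this] \<beta>(3) \<gamma>(3), of c]
  show ?case
    by (simp add: \<beta>(1) \<gamma>(1) lowering_fold(1)[OF Cons.prems(1) \<beta>(2) \<gamma>(3,2)] power_add mult_ac)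
qed

lemma lowering_act_zero:
  assumes "lowering ns a b r" "\<beta> \<in> multiwords ns" "\<mu> \<in> multiwords ns"
    and "\<forall>\<gamma>\<in>multiwords ns. \<mu> \<noteq> \<beta> @@ \<gamma>"
  shows "act a \<beta> (c \<cdot>\<^sub>C b \<mu>) = 0"
  using assms
proof (induction ns arbitrary: a b \<beta> \<mu> c)
  case Nil
  then show ?case by (simp add: multiwords_Nil)
next
  case (Cons n ns)
  from Cons.prems(2,3) obtain w \<beta>' u \<rho> where
    \<beta>: "\<beta> = w # \<beta>'" "w \<in> lists {..<n}" "\<beta>' \<in> multiwords ns" and
    \<mu>: "\<mu> = u # \<rho>" "u \<in> lists {..<n}" "\<rho> \<in> multiwords ns"
    by (auto simp: multiwords_Cons)
  note L = lowering_Cons(1)[OF Cons.prems(1) \<mu>(2)]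
  show ?case
  proof (cases "\<exists>\<gamma>'\<in>multiwords ns. \<rho> = \<beta>' @@ \<gamma>'")
    case True
    then obtain \<gamma>' where \<gamma>': "\<gamma>' \<in> multiwords ns" "\<rho> = \<beta>' @@ \<gamma>'" by blast
    have "\<not> prefix w u"
    proof
      assume "prefix w u"
      then obtain v where v: "u = w @ v" by (auto simp: prefix_def)
      then have "v # \<gamma>' \<in> multiwords (n # ns)" using \<mu>(2) \<gamma>' by auto
      moreover have "\<mu> = \<beta> @@ (v # \<gamma>')" by (simp add: \<mu>(1) \<beta>(1) v \<gamma>')
      ultimately show False using Cons.prems(4) by blast
    qed
    moreover have "act (\<lambda>i. a (Suc i)) \<beta>' (c \<cdot>\<^sub>C b (u # \<rho>))
        = (c * r ^ sum_list (map length \<beta>')) \<cdot>\<^sub>C b (u # \<gamma>')"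
      using lowering_act[OF L \<beta>(3) \<gamma>'(1), of c] by (simp add: \<gamma>'(2))
    ultimately show ?thesis
      by (simp add: \<beta>(1) \<mu>(1) lowering_fold(2)[OF Cons.prems(1) \<beta>(2) \<gamma>'(1) \<mu>(2)])
  next
    case False
    then have "act (\<lambda>i. a (Suc i)) \<beta>' (c \<cdot>\<^sub>C b (u # \<rho>)) = 0"
      using Cons.IH[OF L \<beta>(3) \<mu>(3), of c] by simp
    then show ?thesis
      by (simp add: \<beta>(1) \<mu>(1) lowering_fold(3)[OF Cons.prems(1) \<beta>(2) \<mu>(3)])
  qed
qed

locale fock =
  fixes ns :: "nat list" and \<iota> :: "multiword \<Rightarrow> 'h"
  assumes \<iota>: "inj_on \<iota> (multiwords ns)"
begin

sublocale F: l2_sum scalars "multiwords ns" "\<lambda>\<mu> (_ :: unit). \<iota> \<mu>"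
proof (rule l2_sum.intro[OF scalars_hilbert], unfold_locales)
  show "\<mu> = \<mu>' \<and> a = a'" if "\<mu> \<in> multiwords ns" "\<mu>' \<in> multiwords ns" "\<iota> \<mu> = \<iota> \<mu>'" for \<mu> \<mu>' and a a' :: unit
    using \<iota> that by (auto dest: inj_onD)
qed

abbreviation "MW \<equiv> multiwords ns"
abbreviation "H \<equiv> F.L2"

lemma coord_eq: "F.coord \<mu> f = (\<lambda>_. f (\<iota> \<mu>))"
  by (simp add: F.coord_def)

lemma fock_eqI:
  assumes "f \<in> vectors H" "g \<in> vectors H" "\<And>\<mu>. \<mu> \<in> MW \<Longrightarrow> f (\<iota> \<mu>) = g (\<iota> \<mu>)"
  shows "f = g"
  using assms by (intro F.L2_eqI) (auto simp: coord_eq)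

lemma ip_fock: "ip H f g = (\<Sum>\<^sub>\<infinity>\<mu>\<in>MW. f (\<iota> \<mu>) * cnj (g (\<iota> \<mu>)))"
  by (simp add: F.ip_L2 coord_eq)

definition \<delta> :: "multiword \<Rightarrow> 'h cfun"
  where "\<delta> \<mu> = F.single \<mu> (\<lambda>_. 1)"

lemma \<delta>_in: "\<delta> \<mu> \<in> vectors H"
  unfolding \<delta>_def by (rule F.single_in) simp

lemma \<delta>_val: "\<mu>' \<in> MW \<Longrightarrow> \<delta> \<mu> (\<iota> \<mu>') = (if \<mu>' = \<mu> then 1 else 0)"
  using fun_cong[OF F.coord_single[of \<mu>' \<mu> "\<lambda>_. 1"]] by (simp add: \<delta>_def coord_eq fun_apply)

lemma ip_\<delta>: "\<lbrakk>f \<in> vectors H; \<mu> \<in> MW\<rbrakk> \<Longrightarrow> ip H f (\<delta> \<mu>) = f (\<iota> \<mu>)"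
  unfolding \<delta>_def by (subst F.ip_single_right) (simp_all add: coord_eq)

definition wshift :: "multiword set \<Rightarrow> (multiword \<Rightarrow> multiword) \<Rightarrow> (multiword \<Rightarrow> complex) \<Rightarrow> 'h cop"
  where "wshift P \<psi> c f = F.embed (\<lambda>\<mu> _. if \<mu> \<in> P then c \<mu> * f (\<iota> (\<psi> \<mu>)) else 0)"

lemma wshift_val: "\<mu> \<in> MW \<Longrightarrow> wshift P \<psi> c f (\<iota> \<mu>) = (if \<mu> \<in> P then c \<mu> * f (\<iota> (\<psi> \<mu>)) else 0)"
  using fun_cong[OF F.coord_embed[of \<mu> "\<lambda>\<mu> _. if \<mu> \<in> P then c \<mu> * f (\<iota> (\<psi> \<mu>)) else 0"]]
  by (simp add: wshift_def coord_eq)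

lemma wshift_props:
  assumes \<psi>: "\<psi> ` P \<subseteq> MW" "inj_on \<psi> P" and c: "\<And>\<mu>. \<mu> \<in> P \<Longrightarrow> cmod (c \<mu>) \<le> C" and C: "0 \<le> C"
  shows wshift_bounded: "bounded_op H (wshift P \<psi> c)"
    and wshift_norm: "f \<in> vectors H \<Longrightarrow> hnorm H (wshift P \<psi> c f) \<le> C * hnorm H f"
proof -
  have *: "wshift P \<psi> c f \<in> vectors H \<and> hnorm H (wshift P \<psi> c f) \<le> C * hnorm H f" if f: "f \<in> vectors H" for f
    unfolding wshift_def
  proof (intro conjI; rule F.L2_bounded_finite_sums)
    have bd: "(\<Sum>\<mu>\<in>A. (hnorm scalars (\<lambda>_. if \<mu> \<in> P then c \<mu> * f (\<iota> (\<psi> \<mu>)) else 0))\<^sup>2) \<le> (C * hnorm H f)\<^sup>2"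
      if A: "finite A" "A \<subseteq> MW" for A
    proof -
      have "(\<Sum>\<mu>\<in>A. (hnorm scalars (\<lambda>_. if \<mu> \<in> P then c \<mu> * f (\<iota> (\<psi> \<mu>)) else 0))\<^sup>2)
          = (\<Sum>\<mu>\<in>A \<inter> P. (cmod (c \<mu> * f (\<iota> (\<psi> \<mu>))))\<^sup>2)"
        using A by (intro sum.mono_neutral_cong_right) (auto simp: hnorm_scalars)
      also have "\<dots> \<le> (\<Sum>\<mu>\<in>A \<inter> P. C\<^sup>2 * (cmod (f (\<iota> (\<psi> \<mu>))))\<^sup>2)"
        using c by (intro sum_mono) (auto simp: norm_mult power_mult_distrib intro!: mult_right_mono power_mono)
      also have "\<dots> = C\<^sup>2 * (\<Sum>\<mu>\<in>\<psi> ` (A \<inter> P). (cmod (f (\<iota> \<mu>)))\<^sup>2)"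
        using \<psi>(2) by (subst sum.reindex) (auto simp: sum_distrib_left inj_on_Int)
      also have "(\<Sum>\<mu>\<in>\<psi> ` (A \<inter> P). (cmod (f (\<iota> \<mu>)))\<^sup>2) \<le> (hnorm H f)\<^sup>2"
      proof -
        have "(\<Sum>\<mu>\<in>\<psi> ` (A \<inter> P). (hnorm scalars (F.coord \<mu> f))\<^sup>2) \<le> (hnorm H f)\<^sup>2"
          unfolding F.hnorm_L2_sq[OF f]
          by (rule finite_sum_le_infsum[OF F.L2_summable[OF f]]) (use A \<psi> in auto)
        then show ?thesis by (simp add: hnorm_scalars coord_eq)
      qed
      finally show ?thesis using C by (simp add: power_mult_distrib mult_left_mono)
    qed
    show "0 \<le> C * hnorm H f" "0 \<le> C * hnorm H f" using C F.hnorm_L2_nonneg[OF f] by auto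
    show "(\<lambda>_. if i \<in> P then c i * f (\<iota> (\<psi> i)) else 0) \<in> vectors scalars"
      "(\<lambda>_. if i \<in> P then c i * f (\<iota> (\<psi> i)) else 0) \<in> vectors scalars" for i
      by simp_all
    show "(\<Sum>\<mu>\<in>A. (hnorm scalars (\<lambda>_. if \<mu> \<in> P then c \<mu> * f (\<iota> (\<psi> \<mu>)) else 0))\<^sup>2) \<le> (C * hnorm H f)\<^sup>2"
      "(\<Sum>\<mu>\<in>A. (hnorm scalars (\<lambda>_. if \<mu> \<in> P then c \<mu> * f (\<iota> (\<psi> \<mu>)) else 0))\<^sup>2) \<le> (C * hnorm H f)\<^sup>2"
      if "finite A" "A \<subseteq> MW" for A
      by (rule bd[OF that])+
  qed
  then show "f \<in> vectors H \<Longrightarrow> hnorm H (wshift P \<psi> c f) \<le> C * hnorm H f" by blast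
  show "bounded_op H (wshift P \<psi> c)"
  proof (rule F.L2.bounded_opI[where C = C])
    show "wshift P \<psi> c (f + g) = wshift P \<psi> c f + wshift P \<psi> c g" if "f \<in> vectors H" "g \<in> vectors H" for f g
      using that *[of f] *[of g] *[of "f + g"]
      by (intro fock_eqI) (auto simp: F.L2_add wshift_val fun_apply algebra_simps)
    show "wshift P \<psi> c (b \<cdot>\<^sub>C f) = b \<cdot>\<^sub>C wshift P \<psi> c f" if "f \<in> vectors H" for b f
      using that *[of f] *[of "b \<cdot>\<^sub>C f"]
      by (intro fock_eqI) (auto simp: F.L2_scale wshift_val cscale_apply)
  qed (use * in auto)
qed

lemma update_in: "\<lbrakk>\<mu> \<in> MW; i < length ns; w \<in> lists {..<ns ! i}\<rbrakk> \<Longrightarrow> \<mu>[i := w] \<in> MW"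
  by (auto simp: in_multiwords_iff nth_list_update)

definition creation :: "real \<Rightarrow> nat \<Rightarrow> nat \<Rightarrow> 'h cop"
  where "creation r i j = wshift {\<mu> \<in> MW. \<mu> ! i \<noteq> [] \<and> hd (\<mu> ! i) = j} (\<lambda>\<mu>. \<mu>[i := tl (\<mu> ! i)]) (\<lambda>_. of_real r)"

lemma creation_val:
  "\<mu> \<in> MW \<Longrightarrow> creation r i j f (\<iota> \<mu>)
    = (if \<mu> ! i \<noteq> [] \<and> hd (\<mu> ! i) = j then of_real r * f (\<iota> (\<mu>[i := tl (\<mu> ! i)])) else 0)"
  by (simp add: creation_def wshift_val)

lemma tl_in: "\<lbrakk>\<mu> \<in> MW; i < length ns\<rbrakk> \<Longrightarrow> \<mu>[i := tl (\<mu> ! i)] \<in> MW"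
proof (rule update_in)
  assume "\<mu> \<in> MW" "i < length ns"
  then have "\<mu> ! i \<in> lists {..<ns ! i}" by (simp add: in_multiwords_iff)
  then show "tl (\<mu> ! i) \<in> lists {..<ns ! i}" by (cases "\<mu> ! i") auto
qed

lemma cons_in: "\<lbrakk>\<mu> \<in> MW; i < length ns; j < ns ! i\<rbrakk> \<Longrightarrow> \<mu>[i := j # \<mu> ! i] \<in> MW"
proof (rule update_in)
  assume "\<mu> \<in> MW" "i < length ns" "j < ns ! i"
  then have "\<mu> ! i \<in> lists {..<ns ! i}" by (simp add: in_multiwords_iff)
  with \<open>j < ns ! i\<close> show "j # \<mu> ! i \<in> lists {..<ns ! i}" by auto
qed

lemma tl_cons_iff:
  assumes "\<mu> \<in> MW" "\<sigma> \<in> MW" "i < length ns"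
  shows "\<mu>[i := j # \<mu> ! i] = \<sigma> \<longleftrightarrow> \<sigma> ! i \<noteq> [] \<and> hd (\<sigma> ! i) = j \<and> \<sigma>[i := tl (\<sigma> ! i)] = \<mu>"
proof
  have len: "length \<mu> = length ns" "length \<sigma> = length ns" using assms by (auto simp: length_multiword)
  show "\<sigma> ! i \<noteq> [] \<and> hd (\<sigma> ! i) = j \<and> \<sigma>[i := tl (\<sigma> ! i)] = \<mu>" if "\<mu>[i := j # \<mu> ! i] = \<sigma>"
    using assms len by (simp add: that[symmetric])
  show "\<mu>[i := j # \<mu> ! i] = \<sigma>" if "\<sigma> ! i \<noteq> [] \<and> hd (\<sigma> ! i) = j \<and> \<sigma>[i := tl (\<sigma> ! i)] = \<mu>"
  proof -
    have "\<mu> ! i = tl (\<sigma> ! i)" using that assms len by auto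
    moreover have "j # tl (\<sigma> ! i) = \<sigma> ! i" using that by auto
    moreover have "\<mu>[i := \<sigma> ! i] = \<sigma>" using that by auto
    ultimately show ?thesis by simp
  qed
qed

lemma creation_bounded:
  assumes "i < length ns" "0 \<le> r"
  shows "bounded_op H (creation r i j)"
proof -
  let ?P = "{\<mu> \<in> MW. \<mu> ! i \<noteq> [] \<and> hd (\<mu> ! i) = j}"
  have im: "(\<lambda>\<mu>. \<mu>[i := tl (\<mu> ! i)]) ` ?P \<subseteq> MW"
    using tl_in assms(1) by auto
  have inj: "inj_on (\<lambda>\<mu>. \<mu>[i := tl (\<mu> ! i)]) ?P"
  proof (rule inj_onI)
    fix \<mu> \<sigma> assume "\<mu> \<in> ?P" "\<sigma> \<in> ?P" and eq: "\<mu>[i := tl (\<mu> ! i)] = \<sigma>[i := tl (\<sigma> ! i)]"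
    then have "(\<mu>[i := tl (\<mu> ! i)])[i := j # (\<mu>[i := tl (\<mu> ! i)]) ! i] = \<mu>"
        "(\<mu>[i := tl (\<mu> ! i)])[i := j # (\<mu>[i := tl (\<mu> ! i)]) ! i] = \<sigma>"
      using tl_in assms(1) by (subst tl_cons_iff; auto)+
    then show "\<mu> = \<sigma>" by simp
  qed
  show ?thesis
    unfolding creation_def using wshift_bounded[OF im inj, of "\<lambda>_. of_real r" r] assms(2) by simp
qed

context
  fixes r :: real and X :: "nat \<Rightarrow> nat \<Rightarrow> 'h cop"
  assumes r: "0 \<le> r" "r < 1"
  defines "X \<equiv> creation r"
begin

lemma X_bounded: "i < length ns \<Longrightarrow> bounded_op H (X i j)"
  unfolding X_def using r by (intro creation_bounded)

lemma X_\<delta>: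
  assumes "i < length ns" "j < ns ! i" "\<mu> \<in> MW"
  shows "X i j (\<delta> \<mu>) = of_real r \<cdot>\<^sub>C \<delta> (\<mu>[i := j # \<mu> ! i])"
proof (rule fock_eqI)
  show "X i j (\<delta> \<mu>) \<in> vectors H" by (rule F.L2.bounded_op_closed[OF X_bounded[OF assms(1)] \<delta>_in])
  show "of_real r \<cdot>\<^sub>C \<delta> (\<mu>[i := j # \<mu> ! i]) \<in> vectors H" by (intro F.L2_scale \<delta>_in)
  fix \<sigma> assume "\<sigma> \<in> MW"
  then show "X i j (\<delta> \<mu>) (\<iota> \<sigma>) = (of_real r \<cdot>\<^sub>C \<delta> (\<mu>[i := j # \<mu> ! i])) (\<iota> \<sigma>)"
    using tl_cons_iff[OF assms(3) _ assms(1), of \<sigma> j] assms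
    by (auto simp: X_def creation_val \<delta>_val tl_in cscale_apply)
qed

lemma adj_X_val:
  assumes "i < length ns" "j < ns ! i" "\<mu> \<in> MW" "f \<in> vectors H"
  shows "adj H (X i j) f (\<iota> \<mu>) = of_real r * f (\<iota> (\<mu>[i := j # \<mu> ! i]))"
proof -
  note B = X_bounded[OF assms(1), of j]
  have "adj H (X i j) f (\<iota> \<mu>) = ip H (adj H (X i j) f) (\<delta> \<mu>)"
    by (rule ip_\<delta>[OF F.L2.adj_closed[OF B assms(4)] assms(3), symmetric])
  also have "\<dots> = ip H f (X i j (\<delta> \<mu>))"
    by (rule F.L2.adj_ip_left[OF B \<delta>_in assms(4)])
  also have "\<dots> = of_real r * f (\<iota> (\<mu>[i := j # \<mu> ! i]))"
    using assms by (simp add: X_\<delta> F.L2.ip.scale_right \<delta>_in ip_\<delta> cons_in)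
  finally show ?thesis .
qed

lemma creation_lowering: "lowering ns (F.L2.adj_rows X) \<delta> (of_real r)"
  unfolding lowering_def
proof (intro allI impI conjI ballI)
  fix i j assume ij: "i < length ns" "j < ns ! i"
  note B = X_bounded[OF ij(1), of j]
  show "F.L2.adj_rows X i j 0 = 0"
    using F.L2.adj_rows_scale[of X i j, OF B, of 0 0] by simp
  fix c \<mu> assume \<mu>: "\<mu> \<in> MW"
  have "F.L2.adj_rows X i j (\<delta> \<mu>) =
      (if \<mu> ! i \<noteq> [] \<and> hd (\<mu> ! i) = j then of_real r \<cdot>\<^sub>C \<delta> (\<mu>[i := tl (\<mu> ! i)]) else 0)"
  proof (rule fock_eqI)
    show "F.L2.adj_rows X i j (\<delta> \<mu>) \<in> vectors H" by (rule F.L2.adj_rows_closed[of X i j, OF B])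
    show "(if \<mu> ! i \<noteq> [] \<and> hd (\<mu> ! i) = j then of_real r \<cdot>\<^sub>C \<delta> (\<mu>[i := tl (\<mu> ! i)]) else 0) \<in> vectors H"
      by (simp add: F.L2_scale \<delta>_in F.L2_zero)
    fix \<sigma> assume \<sigma>: "\<sigma> \<in> MW"
    have "F.L2.adj_rows X i j (\<delta> \<mu>) (\<iota> \<sigma>) = of_real r * \<delta> \<mu> (\<iota> (\<sigma>[i := j # \<sigma> ! i]))"
      using adj_X_val[OF ij \<sigma> \<delta>_in] by (simp add: F.L2.adj_rows_def \<delta>_in)
    also have "\<dots> = (if \<sigma>[i := j # \<sigma> ! i] = \<mu> then of_real r else 0)"
      using cons_in[OF \<sigma> ij] by (simp add: \<delta>_val)
    finally show "F.L2.adj_rows X i j (\<delta> \<mu>) (\<iota> \<sigma>) =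
        (if \<mu> ! i \<noteq> [] \<and> hd (\<mu> ! i) = j then of_real r \<cdot>\<^sub>C \<delta> (\<mu>[i := tl (\<mu> ! i)]) else 0) (\<iota> \<sigma>)"
      using tl_cons_iff[OF \<sigma> \<mu> ij(1), of j] \<sigma>
      by (auto simp: cscale_apply \<delta>_val fun_apply)
  qed
  then show "F.L2.adj_rows X i j (c \<cdot>\<^sub>C \<delta> \<mu>) =
      (if \<mu> ! i \<noteq> [] \<and> hd (\<mu> ! i) = j then (c * of_real r) \<cdot>\<^sub>C \<delta> (\<mu>[i := tl (\<mu> ! i)]) else 0)"
    by (simp add: F.L2.adj_rows_scale[of X i j, OF B] cscale_algebra)
qed

lemma \<Phi>_val:
  assumes i: "i < length ns" and Y: "bounded_op H Y" and f: "f \<in> vectors H" and \<mu>: "\<mu> \<in> MW"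
    and val: "\<And>g \<sigma>. \<lbrakk>g \<in> vectors H; \<sigma> \<in> MW\<rbrakk> \<Longrightarrow> Y g (\<iota> \<sigma>) = d \<sigma> * g (\<iota> \<sigma>)"
    and d: "\<And>\<sigma> w. d (\<sigma>[i := w]) = d \<sigma>"
  shows "\<Phi> H (ns ! i) (X i) Y f (\<iota> \<mu>) = (if \<mu> ! i = [] then 0 else of_real (r\<^sup>2) * d \<mu> * f (\<iota> \<mu>))"
proof -
  have entry: "X i j (Y (adj H (X i j) f)) (\<iota> \<mu>)
      = (if \<mu> ! i \<noteq> [] \<and> hd (\<mu> ! i) = j then of_real (r\<^sup>2) * d \<mu> * f (\<iota> \<mu>) else 0)" if j: "j < ns ! i" for j
  proof (cases "\<mu> ! i \<noteq> [] \<and> hd (\<mu> ! i) = j")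
    case True
    let ?\<sigma> = "\<mu>[i := tl (\<mu> ! i)]"
    have \<sigma>: "?\<sigma> \<in> MW" by (rule tl_in[OF \<mu> i])
    have restore: "?\<sigma>[i := j # ?\<sigma> ! i] = \<mu>"
      using tl_cons_iff[OF \<sigma> \<mu> i, of j] True by blast
    have "X i j (Y (adj H (X i j) f)) (\<iota> \<mu>) = of_real r * Y (adj H (X i j) f) (\<iota> ?\<sigma>)"
      using True \<mu> by (simp add: X_def creation_val)
    also have "Y (adj H (X i j) f) (\<iota> ?\<sigma>) = d \<mu> * adj H (X i j) f (\<iota> ?\<sigma>)"
      using val[OF F.L2.adj_closed[OF X_bounded[OF i] f] \<sigma>] by (simp add: d)
    also have "adj H (X i j) f (\<iota> ?\<sigma>) = of_real r * f (\<iota> \<mu>)"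
      unfolding adj_X_val[OF i j \<sigma> f] restore ..
    finally show ?thesis using True by (simp add: power2_eq_square)
  next
    case False
    then show ?thesis using \<mu> by (auto simp: X_def creation_val)
  qed
  have "\<Phi> H (ns ! i) (X i) Y f (\<iota> \<mu>) = (\<Sum>j<ns ! i. X i j (Y (adj H (X i j) f)) (\<iota> \<mu>))"
    unfolding \<Phi>_def sum_fun_eval[of "\<lambda>j. X i j \<circ> Y \<circ> adj H (X i j)"]
      sum_fun_eval[of "\<lambda>j. (X i j \<circ> Y \<circ> adj H (X i j)) f"] by simp
  also have "\<dots> = (\<Sum>j<ns ! i. if \<mu> ! i \<noteq> [] \<and> hd (\<mu> ! i) = j then of_real (r\<^sup>2) * d \<mu> * f (\<iota> \<mu>) else 0)"
    by (intro sum.cong refl entry) simp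
  also have "\<dots> = (if \<mu> ! i = [] then 0 else of_real (r\<^sup>2) * d \<mu> * f (\<iota> \<mu>))"
  proof (cases "\<mu> ! i = []")
    case False
    have "\<mu> ! i \<in> lists {..<ns ! i}" using \<mu> i by (simp add: in_multiwords_iff)
    then have "hd (\<mu> ! i) < ns ! i" using False by (cases "\<mu> ! i") auto
    then show ?thesis using False by (simp add: sum.delta)
  qed simp
  finally show ?thesis .
qed

definition defect_weight :: "nat list \<Rightarrow> multiword \<Rightarrow> real"
  where "defect_weight is \<mu> = (\<Prod>i\<leftarrow>is. if \<mu> ! i = [] then 1 else 1 - r\<^sup>2)"

lemma r2: "0 < 1 - r\<^sup>2" "1 - r\<^sup>2 \<le> 1"
  using r by (simp_all add: power_less_one_iff)

lemma defect_weight_bounds: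
  "(1 - r\<^sup>2) ^ length is \<le> defect_weight is \<mu>" "defect_weight is \<mu> \<le> 1" "0 < defect_weight is \<mu>"
proof -
  have "(1 - r\<^sup>2) ^ length is \<le> defect_weight is \<mu> \<and> defect_weight is \<mu> \<le> 1"
  proof (induction "is")
    case (Cons i "is")
    let ?t = "if \<mu> ! i = [] then 1 else 1 - r\<^sup>2"
    have t: "1 - r\<^sup>2 \<le> ?t" "?t \<le> 1" "0 \<le> ?t" using r2 by auto
    have "(1 - r\<^sup>2) * (1 - r\<^sup>2) ^ length is \<le> ?t * defect_weight is \<mu>"
      using t Cons r2 by (intro mult_mono) auto
    moreover have "0 \<le> defect_weight is \<mu>"
      using Cons r2 zero_le_power[of "1 - r\<^sup>2" "length is"] by linarith
    then have "?t * defect_weight is \<mu> \<le> 1"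
      using t Cons by (intro mult_le_one) auto
    ultimately show ?case by (simp add: defect_weight_def)
  qed (simp add: defect_weight_def)
  moreover have "0 < (1 - r\<^sup>2) ^ length is" using r2 by simp
  ultimately show "(1 - r\<^sup>2) ^ length is \<le> defect_weight is \<mu>" "defect_weight is \<mu> \<le> 1" "0 < defect_weight is \<mu>"
    by linarith+
qed

lemma \<Delta>_val:
  assumes "distinct is" "set is \<subseteq> {..<length ns}"
  shows "bounded_op H (op_prod (map (\<lambda>i Y. Y - \<Phi> H (ns ! i) (X i) Y) is) id) \<and>
    (\<forall>f\<in>vectors H. \<forall>\<mu>\<in>MW. op_prod (map (\<lambda>i Y. Y - \<Phi> H (ns ! i) (X i) Y) is) id f (\<iota> \<mu>)
      = of_real (defect_weight is \<mu>) * f (\<iota> \<mu>))"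
  using assms
proof (induction "is")
  case Nil
  then show ?case by (simp add: op_prod_def F.L2.bounded_op_id[unfolded id_def] defect_weight_def)
next
  case (Cons i "is")
  let ?Y = "op_prod (map (\<lambda>i Y. Y - \<Phi> H (ns ! i) (X i) Y) is) id"
  let ?d = "\<lambda>\<mu>. complex_of_real (defect_weight is \<mu>)"
  have i: "i < length ns" "i \<notin> set is" using Cons.prems by auto
  have Y: "bounded_op H ?Y" and val: "\<And>f \<mu>. \<lbrakk>f \<in> vectors H; \<mu> \<in> MW\<rbrakk> \<Longrightarrow> ?Y f (\<iota> \<mu>) = ?d \<mu> * f (\<iota> \<mu>)"
  proof -
    have "distinct is" "set is \<subseteq> {..<length ns}" using Cons.prems by auto
    note IH = Cons.IH[OF this]
    show "bounded_op H ?Y" by (rule conjunct1[OF IH])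
    show "\<And>f \<mu>. \<lbrakk>f \<in> vectors H; \<mu> \<in> MW\<rbrakk> \<Longrightarrow> ?Y f (\<iota> \<mu>) = ?d \<mu> * f (\<iota> \<mu>)"
      using conjunct2[OF IH] by blast
  qed
  have d: "?d (\<sigma>[i := w]) = ?d \<sigma>" for \<sigma> w
  proof -
    have "\<sigma>[i := w] ! k = \<sigma> ! k" if "k \<in> set is" for k
      using that i by (metis nth_list_update_neq)
    then show ?thesis unfolding defect_weight_def by (simp cong: map_cong)
  qed
  have eq: "op_prod (map (\<lambda>i Y. Y - \<Phi> H (ns ! i) (X i) Y) (i # is)) id = ?Y - \<Phi> H (ns ! i) (X i) ?Y"
    by (simp add: op_prod_def)
  have "bounded_op H (?Y - \<Phi> H (ns ! i) (X i) ?Y)"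
    by (intro F.L2.bounded_op_minus Y F.L2.\<Phi>_bounded X_bounded i)
  moreover have "(?Y - \<Phi> H (ns ! i) (X i) ?Y) f (\<iota> \<mu>) = of_real (defect_weight (i # is) \<mu>) * f (\<iota> \<mu>)"
    if f: "f \<in> vectors H" and \<mu>: "\<mu> \<in> MW" for f \<mu>
  proof -
    have "\<Phi> H (ns ! i) (X i) ?Y f (\<iota> \<mu>) = (if \<mu> ! i = [] then 0 else of_real (r\<^sup>2) * ?d \<mu> * f (\<iota> \<mu>))"
      by (rule \<Phi>_val[OF i(1) Y f \<mu>, where d = ?d]) (rule val, assumption+, rule d)
    then show ?thesis
      unfolding minus_apply[of ?Y] minus_apply[of "?Y f"] val[OF f \<mu>]
      by (simp add: defect_weight_def algebra_simps)
  qed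
  ultimately show ?case unfolding eq by blast
qed

lemma creation_in_polyball: "X \<in> polyball ns H"
  unfolding polyball_def mem_Collect_eq
proof (intro conjI allI impI ballI)
  show "bounded_op H (X i j)" if "i < length ns" for i j
    by (rule X_bounded[OF that])
next
  fix s t p q x assume st: "s < length ns" "t < length ns" "s \<noteq> t" and x: "x \<in> vectors H"
  show "X s p (X t q x) = X t q (X s p x)"
  proof (rule fock_eqI)
    show "X s p (X t q x) \<in> vectors H" "X t q (X s p x) \<in> vectors H"
      using X_bounded st x by (auto intro!: F.L2.bounded_op_closed[OF X_bounded])
    fix \<mu> assume \<mu>: "\<mu> \<in> MW"
    then show "X s p (X t q x) (\<iota> \<mu>) = X t q (X s p x) (\<iota> \<mu>)"
      using st by (simp add: X_def creation_val tl_in list_update_swap)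
  qed
next
  fix i assume i: "i < length ns"
  have "op_norm H (\<Sum>j<ns ! i. X i j \<circ> adj H (X i j)) \<le> r\<^sup>2"
  proof (rule F.L2.op_norm_le)
    fix f assume f: "f \<in> vectors H"
    let ?P = "{\<mu> \<in> MW. \<mu> ! i \<noteq> []}"
    have R: "bounded_op H (\<Phi> H (ns ! i) (X i) id)"
      by (intro F.L2.\<Phi>_bounded X_bounded i F.L2.bounded_op_id)
    have W: "bounded_op H (wshift ?P (\<lambda>\<mu>. \<mu>) (\<lambda>_. of_real (r\<^sup>2)))"
        "hnorm H (wshift ?P (\<lambda>\<mu>. \<mu>) (\<lambda>_. of_real (r\<^sup>2)) f) \<le> r\<^sup>2 * hnorm H f"
      using wshift_props[of "\<lambda>\<mu>. \<mu>" ?P "\<lambda>_. of_real (r\<^sup>2)" "r\<^sup>2"] f by (auto simp: norm_power)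
    have "(\<Sum>j<ns ! i. X i j \<circ> adj H (X i j)) f = \<Phi> H (ns ! i) (X i) id f"
      by (simp add: \<Phi>_def)
    also have "\<dots> = wshift ?P (\<lambda>\<mu>. \<mu>) (\<lambda>_. of_real (r\<^sup>2)) f"
    proof (rule fock_eqI)
      show "\<Phi> H (ns ! i) (X i) id f \<in> vectors H" "wshift ?P (\<lambda>\<mu>. \<mu>) (\<lambda>_. of_real (r\<^sup>2)) f \<in> vectors H"
        using F.L2.bounded_op_closed[OF R f] F.L2.bounded_op_closed[OF W(1) f] .
      show "\<Phi> H (ns ! i) (X i) id f (\<iota> \<mu>) = wshift ?P (\<lambda>\<mu>. \<mu>) (\<lambda>_. of_real (r\<^sup>2)) f (\<iota> \<mu>)" if "\<mu> \<in> MW" for \<mu>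
        using \<Phi>_val[OF i F.L2.bounded_op_id f that, of "\<lambda>_. 1"] that by (simp add: wshift_val)
    qed
    finally show "hnorm H ((\<Sum>j<ns ! i. X i j \<circ> adj H (X i j)) f) \<le> r\<^sup>2 * hnorm H f"
      using W(2) by simp
  qed simp
  also have "r\<^sup>2 < 1" using r2 by simp
  finally show "op_norm H (\<Sum>j<ns ! i. X i j \<circ> adj H (X i j)) < 1" .
next
  let ?w = "defect_weight [0..<length ns]"
  have D: "bounded_op H (\<Delta> H ns X id)"
    and val: "\<And>f \<mu>. \<lbrakk>f \<in> vectors H; \<mu> \<in> MW\<rbrakk> \<Longrightarrow> \<Delta> H ns X id f (\<iota> \<mu>) = of_real (?w \<mu>) * f (\<iota> \<mu>)"
  proof -
    have "distinct [0..<length ns]" "set [0..<length ns] \<subseteq> {..<length ns}" by auto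
    note V = \<Delta>_val[OF this, folded \<Delta>_def]
    show "bounded_op H (\<Delta> H ns X id)" by (rule conjunct1[OF V])
    show "\<And>f \<mu>. \<lbrakk>f \<in> vectors H; \<mu> \<in> MW\<rbrakk> \<Longrightarrow> \<Delta> H ns X id f (\<iota> \<mu>) = of_real (?w \<mu>) * f (\<iota> \<mu>)"
      using conjunct2[OF V] by blast
  qed
  note w = defect_weight_bounds[of "[0..<length ns]"]
  show "positive_op H (\<Delta> H ns X id)"
    unfolding positive_op_def
  proof
    fix f assume f: "f \<in> vectors H"
    have Df: "\<Delta> H ns X id f \<in> vectors H" by (rule F.L2.bounded_op_closed[OF D f])
    have "0 \<le> (\<Sum>\<^sub>\<infinity>\<mu>\<in>MW. ip scalars (F.coord \<mu> (\<Delta> H ns X id f)) (F.coord \<mu> f))"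
    proof (rule infsum_nonneg_complex[OF F.ip_summable[OF Df f]])
      fix \<mu> assume \<mu>: "\<mu> \<in> MW"
      have "ip scalars (F.coord \<mu> (\<Delta> H ns X id f)) (F.coord \<mu> f) = of_real (?w \<mu> * (cmod (f (\<iota> \<mu>)))\<^sup>2)"
        using complex_norm_square[of "f (\<iota> \<mu>)"] by (simp add: coord_eq val[OF f \<mu>] mult.assoc)
      also have "0 \<le> \<dots>"
        using w(3)[of \<mu>] by (simp add: less_eq_complex_def)
      finally show "0 \<le> ip scalars (F.coord \<mu> (\<Delta> H ns X id f)) (F.coord \<mu> f)" .
    qed
    then show "ip H (\<Delta> H ns X id f) f \<in> \<real>\<^sub>\<ge>\<^sub>0"
      by (simp add: F.ip_L2 nonneg_Reals_iff less_eq_complex_def)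
  qed
  show "invertible_op H (\<Delta> H ns X id)"
    unfolding invertible_op_def
  proof (intro exI conjI ballI)
    let ?C = "1 / (1 - r\<^sup>2) ^ length ns"
    let ?S = "wshift MW (\<lambda>\<mu>. \<mu>) (\<lambda>\<mu>. of_real (1 / ?w \<mu>))"
    have "1 / ?w \<mu> \<le> ?C" for \<mu>
      using w(1,3)[of \<mu>] r2 by (intro divide_left_mono) (auto intro!: mult_pos_pos)
    then show S: "bounded_op H ?S"
      using w(3) r2 less_imp_le[OF w(3)]
      by (intro wshift_bounded[where C = ?C]) (auto simp: norm_divide abs_of_pos)
    fix f assume f: "f \<in> vectors H"
    have Df: "\<Delta> H ns X id f \<in> vectors H" and Sf: "?S f \<in> vectors H"
      using F.L2.bounded_op_closed[OF D f] F.L2.bounded_op_closed[OF S f] .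
    have nz: "complex_of_real (?w \<mu>) \<noteq> 0" for \<mu> using w(3)[of \<mu>] by simp
    show "?S (\<Delta> H ns X id f) = f"
      using F.L2.bounded_op_closed[OF S Df] f nz by (intro fock_eqI) (auto simp: wshift_val val)
    show "\<Delta> H ns X id (?S f) = f"
      using F.L2.bounded_op_closed[OF D Sf] f nz Sf by (intro fock_eqI) (auto simp: wshift_val val)
  qed
qed

lemma creation_act:
  assumes "\<beta> \<in> MW" "\<gamma> \<in> MW"
  shows "act (F.L2.adj_rows X) \<beta> (\<delta> (\<beta> @@ \<gamma>)) = of_real (r ^ sum_list (map length \<beta>)) \<cdot>\<^sub>C \<delta> \<gamma>"
  using lowering_act[OF creation_lowering assms, of 1] by simp

lemma creation_act_zero:
  assumes "\<beta> \<in> MW" "\<mu> \<in> MW" "\<forall>\<gamma>\<in>MW. \<mu> \<noteq> \<beta> @@ \<gamma>"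
  shows "act (F.L2.adj_rows X) \<beta> (\<delta> \<mu>) = 0"
  using lowering_act_zero[OF creation_lowering assms, of 1] by simp

end

end

section \<open>The kernel as a compression of \<open>F(rS)\<close>\<close>

lemma shift_unique:
  assumes "\<alpha> \<in> neg_words ns ms" "\<beta> \<in> pos_words ns ms" "\<gamma> \<in> multiwords ns"
  shows "map2 (\<lambda>u v. int (length v) - int (length u)) (\<alpha> @@ \<gamma>) (\<beta> @@ \<gamma>) = ms"
  using assms by (intro nth_equalityI) (auto simp: in_level_words_iff length_multiword)

context fock
begin

lemma monomial_\<delta>_ip:
  assumes r: "0 \<le> r" "r < 1" and \<alpha>\<beta>: "\<alpha> \<in> neg_words ns ms" "\<beta> \<in> pos_words ns ms"
    and \<sigma>: "\<sigma> \<in> MW" and \<mu>: "\<mu> \<in> MW"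
  shows "ip H (monomial_op H (creation r) \<alpha> \<beta> (\<delta> \<mu>)) (\<delta> \<sigma>)
    = (if \<exists>\<gamma>\<in>MW. \<sigma> = \<alpha> @@ \<gamma> \<and> \<mu> = \<beta> @@ \<gamma>
        then of_real (r ^ (sum_list (map length \<alpha>) + sum_list (map length \<beta>))) else 0)"
proof -
  note P = creation_in_polyball[OF r]
  have W: "\<alpha> \<in> MW" "\<beta> \<in> MW" using \<alpha>\<beta> level_words_subset by blast+
  let ?a = "act (F.L2.adj_rows (creation r))"
  have eq: "ip H (monomial_op H (creation r) \<alpha> \<beta> (\<delta> \<mu>)) (\<delta> \<sigma>) = ip H (?a \<beta> (\<delta> \<mu>)) (?a \<alpha> (\<delta> \<sigma>))"
    by (rule F.L2.monomial_op_ip[OF F.L2.polyball_bounded_rows[OF P] F.L2.polyball_commuting_rows[OF P] W \<delta>_in \<delta>_in])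
  have V: "?a \<rho> (\<delta> \<nu>) \<in> vectors H" if "\<rho> \<in> MW" for \<rho> \<nu>
    by (rule F.L2.act_adj_rows_closed[OF F.L2.polyball_bounded_rows[OF P] that \<delta>_in])
  have "ip H (?a \<beta> (\<delta> \<mu>)) (?a \<alpha> (\<delta> \<sigma>)) = (if \<exists>\<gamma>\<in>MW. \<sigma> = \<alpha> @@ \<gamma> \<and> \<mu> = \<beta> @@ \<gamma>
        then of_real (r ^ (sum_list (map length \<alpha>) + sum_list (map length \<beta>))) else 0)"
  proof (cases "(\<exists>\<gamma>\<in>MW. \<sigma> = \<alpha> @@ \<gamma>) \<and> (\<exists>\<gamma>\<in>MW. \<mu> = \<beta> @@ \<gamma>)")
    case True
    then obtain \<gamma> \<gamma>' where \<gamma>: "\<gamma> \<in> MW" "\<sigma> = \<alpha> @@ \<gamma>" and \<gamma>': "\<gamma>' \<in> MW" "\<mu> = \<beta> @@ \<gamma>'" by blast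
    have "ip H (?a \<beta> (\<delta> \<mu>)) (?a \<alpha> (\<delta> \<sigma>))
        = of_real (r ^ (sum_list (map length \<alpha>) + sum_list (map length \<beta>))) * \<delta> \<gamma>' (\<iota> \<gamma>)"
      unfolding \<gamma>(2) \<gamma>'(2) creation_act[OF r W(1) \<gamma>(1)] creation_act[OF r W(2) \<gamma>'(1)]
      by (simp add: F.L2.ip.scale_left F.L2.ip.scale_right \<delta>_in F.L2_scale ip_\<delta> \<gamma>(1) power_add cscale_apply)
    moreover have "(\<exists>\<gamma>\<in>MW. \<sigma> = \<alpha> @@ \<gamma> \<and> \<mu> = \<beta> @@ \<gamma>) \<longleftrightarrow> \<gamma> = \<gamma>'"
      using multi_append_inject[OF \<alpha>\<beta>(1,1) \<gamma>(1)] multi_append_inject[OF \<alpha>\<beta>(2,2) \<gamma>'(1)] \<gamma> \<gamma>'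
      by metis
    ultimately show ?thesis using \<gamma> by (auto simp: \<delta>_val)
  next
    case False
    then have "?a \<alpha> (\<delta> \<sigma>) = 0 \<or> ?a \<beta> (\<delta> \<mu>) = 0"
      using creation_act_zero[OF r W(1) \<sigma>] creation_act_zero[OF r W(2) \<mu>] by blast
    then have "ip H (?a \<beta> (\<delta> \<mu>)) (?a \<alpha> (\<delta> \<sigma>)) = 0"
      using V[OF W(1), of \<sigma>] V[OF W(2), of \<mu>] by (auto simp: F.L2.ip.zero_left F.L2.ip.zero_right)
    then show ?thesis using False by auto
  qed
  with eq show ?thesis by simp
qed

lemma kernel_has_sum:
  assumes E: "hilbert_space E" and A: "bounded_coeffs ns E A" and r: "0 \<le> r" "r < 1"
    and \<sigma>: "\<sigma> \<in> MW" and \<mu>: "\<mu> \<in> MW" and e: "e \<in> vectors E" "e' \<in> vectors E"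
  shows "((\<lambda>ms. \<Sum>\<alpha>\<in>neg_words ns ms. \<Sum>\<beta>\<in>pos_words ns ms.
      ip E (A \<alpha> \<beta> e) e' * ip H (monomial_op H (creation r) \<alpha> \<beta> (\<delta> \<mu>)) (\<delta> \<sigma>))
    has_sum ip E (ph_kernel (dilate r A) \<sigma> \<mu> e) e') {ms. length ms = length ns}"
proof -
  interpret E: hilbert_space E by (rule E)
  let ?m = "\<lambda>\<alpha> \<beta>. ip E (A \<alpha> \<beta> e) e' * ip H (monomial_op H (creation r) \<alpha> \<beta> (\<delta> \<mu>)) (\<delta> \<sigma>)"
  let ?g = "\<lambda>ms. \<Sum>\<alpha>\<in>neg_words ns ms. \<Sum>\<beta>\<in>pos_words ns ms. ?m \<alpha> \<beta>"
  show ?thesis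
  proof (cases "rcomparable \<sigma> \<mu>")
    case False
    have "?m \<alpha> \<beta> = 0" if "\<alpha> \<in> neg_words ns ms" "\<beta> \<in> pos_words ns ms" for ms \<alpha> \<beta>
      using rcomparable_append[OF that] False
      by (auto simp: monomial_\<delta>_ip[OF r that \<sigma> \<mu>] length_multiword)
    then have "(?g has_sum 0) {ms. length ms = length ns}"
      by (intro has_sum_0 sum.neutral ballI) simp
    then show ?thesis
      using False e by (simp add: ph_kernel_def fun_apply E.ip.zero_left)
  next
    case True
    define ms0 where "ms0 = map2 (\<lambda>u v. int (length v) - int (length u)) \<sigma> \<mu>"
    obtain \<alpha> \<beta> \<gamma> where 1: "\<sigma> = \<alpha> @@ \<gamma>" "\<mu> = \<beta> @@ \<gamma>" "\<gamma> \<in> MW"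
      and \<alpha>\<beta>: "\<alpha> \<in> neg_words ns ms0" "\<beta> \<in> pos_words ns ms0"
      unfolding ms0_def by (rule rcomparable_level_cases[OF True \<sigma> \<mu>])
    have zero: "?m \<alpha>' \<beta>' = 0"
      if \<alpha>\<beta>': "\<alpha>' \<in> neg_words ns ms" "\<beta>' \<in> pos_words ns ms" and ne: "ms \<noteq> ms0 \<or> \<alpha>' \<noteq> \<alpha> \<or> \<beta>' \<noteq> \<beta>" for ms \<alpha>' \<beta>'
    proof -
      have "\<not> (\<exists>\<gamma>\<in>MW. \<sigma> = \<alpha>' @@ \<gamma> \<and> \<mu> = \<beta>' @@ \<gamma>)"
      proof
        assume "\<exists>\<gamma>\<in>MW. \<sigma> = \<alpha>' @@ \<gamma> \<and> \<mu> = \<beta>' @@ \<gamma>"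
        then obtain \<gamma>' where \<gamma>': "\<gamma>' \<in> MW" "\<sigma> = \<alpha>' @@ \<gamma>'" "\<mu> = \<beta>' @@ \<gamma>'" by blast
        have ms: "ms0 = ms" unfolding ms0_def \<gamma>'(2,3) by (rule shift_unique[OF \<alpha>\<beta>' \<gamma>'(1)])
        have "\<alpha> = \<alpha>'"
          using multi_append_inject[OF _ _ 1(3) \<gamma>'(1)] \<alpha>\<beta>(1) \<alpha>\<beta>'(1) 1(1) \<gamma>'(2) unfolding ms by blast
        moreover have "\<beta> = \<beta>'"
          using multi_append_inject[OF _ _ 1(3) \<gamma>'(1)] \<alpha>\<beta>(2) \<alpha>\<beta>'(2) 1(2) \<gamma>'(3) unfolding ms by blast
        ultimately show False using ne ms by blast
      qed
      then show ?thesis unfolding monomial_\<delta>_ip[OF r \<alpha>\<beta>' \<sigma> \<mu>] by (simp only: if_False mult_zero_right)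
    qed
    have "?g ms0 = (\<Sum>\<alpha>'\<in>{\<alpha>}. \<Sum>\<beta>'\<in>pos_words ns ms0. ?m \<alpha>' \<beta>')"
      using \<alpha>\<beta> zero[of _ ms0] by (intro sum.mono_neutral_right finite_level_words ballI sum.neutral) auto
    also have "\<dots> = (\<Sum>\<beta>'\<in>pos_words ns ms0. ?m \<alpha> \<beta>')" by simp
    also have "\<dots> = (\<Sum>\<beta>'\<in>{\<beta>}. ?m \<alpha> \<beta>')"
      using \<alpha>\<beta> zero[of _ ms0] by (intro sum.mono_neutral_right finite_level_words) auto
    also have "\<dots> = ?m \<alpha> \<beta>" by simp
    also have "\<dots> = ip E (dilate r A \<alpha> \<beta> e) e'"
    proof -
      have "\<exists>\<gamma>\<in>MW. \<sigma> = \<alpha> @@ \<gamma> \<and> \<mu> = \<beta> @@ \<gamma>" using 1 by blast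
      then show ?thesis
        unfolding monomial_\<delta>_ip[OF r \<alpha>\<beta> \<sigma> \<mu>] dilate_def
        using E.bounded_op_closed[OF bounded_coeffsD[OF A \<alpha>\<beta>] e(1)] e(2)
        by (simp add: E.ip.scale_left)
    qed
    also have "\<dots> = ip E (ph_kernel (dilate r A) \<sigma> \<mu> e) e'"
      unfolding 1(1,2) ph_kernel_append[OF \<alpha>\<beta> length_multiword[OF 1(3)]] ..
    finally have val: "?g ms0 = ip E (ph_kernel (dilate r A) \<sigma> \<mu> e) e'" .
    show ?thesis
    proof (rule has_sum_finite_neutralI[of "{ms0}"])
      show "{ms0} \<subseteq> {ms. length ms = length ns}"
        using \<sigma> \<mu> by (simp add: ms0_def length_multiword)
      show "?g ms = 0" if "ms \<in> {ms. length ms = length ns} - {ms0}" for ms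
        using that zero by (intro sum.neutral ballI) auto
    qed (simp_all add: val)
  qed
qed

end

locale fock_tensor = fock ns \<iota> + E: hilbert_space E
  for ns and \<iota> :: "multiword \<Rightarrow> 'h" and E :: "'e hilbert"
begin

sublocale T: l2_sum E MW "\<lambda>\<mu> a. (\<lambda>b. if b = a then 1 else 0 :: complex, \<lambda>x. if x = \<iota> \<mu> then 1 else 0 :: complex)"
proof unfold_locales
  fix \<mu> \<mu>' and a a' :: 'e
  assume MW: "\<mu> \<in> MW" "\<mu>' \<in> MW"
    and eq: "(\<lambda>b. if b = a then 1 else 0 :: complex, \<lambda>x. if x = \<iota> \<mu> then 1 else 0 :: complex)
      = (\<lambda>b. if b = a' then 1 else 0, \<lambda>x. if x = \<iota> \<mu>' then 1 else 0)"
  have "a = a'" using fun_cong[OF arg_cong[OF eq, of fst], of a] by (simp split: if_splits)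
  moreover have "\<iota> \<mu> = \<iota> \<mu>'" using fun_cong[OF arg_cong[OF eq, of snd], of "\<iota> \<mu>"] by (simp split: if_splits)
  ultimately show "\<mu> = \<mu>' \<and> a = a'" using MW \<iota> by (auto dest: inj_onD)
qed

abbreviation "K \<equiv> T.L2"

definition \<tau> :: "'e cfun \<Rightarrow> 'h cfun \<Rightarrow> ('e, 'h) tensor_index cfun"
  where "\<tau> e h = T.embed (\<lambda>\<mu>. h (\<iota> \<mu>) \<cdot>\<^sub>C e)"

lemma coord_\<tau>: "\<mu> \<in> MW \<Longrightarrow> T.coord \<mu> (\<tau> e h) = h (\<iota> \<mu>) \<cdot>\<^sub>C e"
  by (simp add: \<tau>_def T.coord_embed)

lemma \<tau>_in:
  assumes "e \<in> vectors E" "h \<in> vectors H"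
  shows "\<tau> e h \<in> vectors K"
  unfolding \<tau>_def
proof (rule T.embed_in)
  have "(\<lambda>\<mu>. (cmod (h (\<iota> \<mu>)))\<^sup>2 * (hnorm E e)\<^sup>2) summable_on MW"
    using F.L2_summable[OF assms(2)] by (intro summable_on_cmult_left) (simp add: coord_eq hnorm_scalars)
  then show "(\<lambda>\<mu>. (hnorm E (h (\<iota> \<mu>) \<cdot>\<^sub>C e))\<^sup>2) summable_on MW"
    using assms(1) by (simp add: E.hnorm_scale power_mult_distrib)
qed (use assms in \<open>simp add: E.V_scale\<close>)

lemma \<tau>_\<delta>:
  assumes "v \<in> vectors E"
  shows "\<tau> v (\<delta> \<mu>) = T.single \<mu> v"
  using assms by (intro T.L2_eqI \<tau>_in \<delta>_in T.single_in) (auto simp: coord_\<tau> \<delta>_val T.coord_single)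

lemma tensor: "hilbert_tensor E H K \<tau>"
  unfolding hilbert_tensor_def
proof (intro conjI ballI allI impI)
  show "hilbert_space K" by (rule T.L2_hilbert)
  show "\<tau> e h \<in> vectors K" if "e \<in> vectors E" "h \<in> vectors H" for e h
    using that by (rule \<tau>_in)
  show "ip K (\<tau> e h) (\<tau> e' h') = ip E e e' * ip H h h'"
    if "e \<in> vectors E" "e' \<in> vectors E" "h \<in> vectors H" "h' \<in> vectors H" for e e' h h'
  proof -
    have "ip K (\<tau> e h) (\<tau> e' h') = (\<Sum>\<^sub>\<infinity>\<mu>\<in>MW. ip E e e' * (h (\<iota> \<mu>) * cnj (h' (\<iota> \<mu>))))"
      unfolding T.ip_L2
      using that by (intro infsum_cong) (simp add: coord_\<tau> E.ip.scale_left E.ip.scale_right E.V_scale)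
    then show ?thesis unfolding ip_fock by (simp add: infsum_cmult_right')
  qed
  fix u and \<epsilon> :: real assume u: "u \<in> vectors K" and "0 < \<epsilon>"
  obtain S where S: "finite S" "S \<subseteq> MW" "hnorm K (u - (\<Sum>\<mu>\<in>S. T.single \<mu> (T.coord \<mu> u))) < \<epsilon>"
    by (rule T.finite_approximation[OF u \<open>0 < \<epsilon>\<close>])
  obtain f where "bij_betw f {0..<card S} S"
    using ex_bij_betw_nat_finite[OF S(1)] by blast
  then have f: "bij_betw f {..<card S} S" by (simp add: lessThan_atLeast0)
  then have fS: "f p \<in> MW" if "p < card S" for p using that S(2) by (auto simp: bij_betw_def)
  have "(\<Sum>p<card S. \<tau> (T.coord (f p) u) (\<delta> (f p))) = (\<Sum>p<card S. T.single (f p) (T.coord (f p) u))"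
    using fS u by (intro sum.cong refl \<tau>_\<delta>) (simp add: T.coord_in)
  also have "\<dots> = (\<Sum>\<mu>\<in>S. T.single \<mu> (T.coord \<mu> u))"
    by (rule sum.reindex_bij_betw[OF f])
  finally have "hnorm K (u - (\<Sum>p<card S. \<tau> (T.coord (f p) u) (\<delta> (f p)))) < \<epsilon>"
    using S(3) by simp
  moreover have "\<forall>p<card S. T.coord (f p) u \<in> vectors E \<and> \<delta> (f p) \<in> vectors H"
    using fS u by (simp add: T.coord_in \<delta>_in)
  ultimately show "\<exists>(N::nat) e h. (\<forall>p<N. e p \<in> vectors E \<and> h p \<in> vectors H) \<and> hnorm K (u - (\<Sum>p<N. \<tau> (e p) (h p))) < \<epsilon>"
    by (intro exI[of _ "card S"] exI[of _ "\<lambda>p. T.coord (f p) u"] exI[of _ "\<lambda>p. \<delta> (f p)"] conjI)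
qed

sublocale tensor_space E H K \<tau>
  by (rule tensor_space_intro[OF E.hilbert_space_axioms F.L2_hilbert tensor])

end

theorem positive_imp_psd_kernel:
  assumes inf: "infinite (UNIV :: 'h set)" and E: "hilbert_space E"
    and F: "free_pluriharmonic TYPE('h) ns E A" and pos: "ph_positive TYPE('h) ns E A"
    and r: "0 \<le> r" "r < 1"
  shows "psd_kernel ns E (ph_kernel (dilate r A))"
proof -
  obtain f :: "nat \<Rightarrow> 'h" where f: "inj f"
    using infinite_countable_subset[OF inf] by blast
  define \<iota> :: "multiword \<Rightarrow> 'h" where "\<iota> = f \<circ> to_nat"
  have "inj \<iota>" unfolding \<iota>_def by (intro inj_compose f inj_to_nat)
  then have "fock ns \<iota>" by (intro fock.intro) (rule inj_on_subset, auto)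
  then interpret fock_tensor ns \<iota> E by (intro fock_tensor.intro E)
  let ?X = "creation r"
  let ?T = "ph_eval E H K \<tau> ns A ?X"
  note X = creation_in_polyball[OF r] and A = free_pluriharmonic_bounded_coeffs[OF F]
  note B = F.L2.polyball_bounded_rows[OF X]
  have T: "represents E H K \<tau> ns A ?X ?T"
    by (rule free_pluriharmonic_eval[OF F F.L2_hilbert tensor X])
  have TB: "bounded_op K ?T" by (rule represents_bounded[OF T A B])
  have "positive_op K ?T"
    using pos F.L2_hilbert tensor X unfolding ph_positive_def by blast
  then have pos: "ip K (?T u) u \<in> \<real>\<^sub>\<ge>\<^sub>0" if "u \<in> vectors K" for u
    using that by (simp add: positive_op_def)
  have entry: "ip K (?T (\<tau> e (\<delta> \<mu>))) (\<tau> e' (\<delta> \<sigma>)) = ip E (ph_kernel (dilate r A) \<sigma> \<mu> e) e'"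
    if "\<sigma> \<in> MW" "\<mu> \<in> MW" "e \<in> vectors E" "e' \<in> vectors E" for \<sigma> \<mu> e e'
  proof (rule represents_ip[OF T A B])
    show "\<tau> e (\<delta> \<mu>) \<in> vectors K" "\<tau> e' (\<delta> \<sigma>) \<in> vectors K"
      using that by (auto intro!: \<tau>_in \<delta>_in)
    show "((\<lambda>ms. ip K (homogeneous_part E H K \<tau> ns A ?X ms (\<tau> e (\<delta> \<mu>))) (\<tau> e' (\<delta> \<sigma>))) has_sum
        ip E (ph_kernel (dilate r A) \<sigma> \<mu> e) e') {ms. length ms = length ns}"
      unfolding homogeneous_part_ip[OF A B that(3,4) \<delta>_in \<delta>_in]
      by (rule kernel_has_sum[OF E A r that])
  qed
  show ?thesis
    unfolding psd_kernel_def
  proof (intro allI impI)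
    fix m :: nat and \<sigma> h assume \<sigma>h: "\<forall>i<m. \<sigma> i \<in> MW \<and> h i \<in> vectors E"
    let ?t = "\<lambda>i. \<tau> (h i) (\<delta> (\<sigma> i))"
    let ?u = "\<Sum>i<m. ?t i"
    have tV: "?t i \<in> vectors K" if "i < m" for i using \<sigma>h that by (intro \<tau>_in \<delta>_in) auto
    have u: "?u \<in> vectors K" using tV by (intro T.L2.V_sum) auto
    have Tu: "?T ?u = (\<Sum>j<m. ?T (?t j))"
      using tV by (intro T.L2.bounded_op_sum[OF TB]) auto
    have "ip K (?T ?u) ?u = (\<Sum>j<m. ip K (?T (?t j)) ?u)"
      unfolding Tu using tV by (intro T.L2.ip.sum_left u T.L2.bounded_op_closed[OF TB]) auto
    also have "\<dots> = (\<Sum>j<m. \<Sum>i<m. ip K (?T (?t j)) (?t i))"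
      using tV by (intro sum.cong refl T.L2.ip.sum_right T.L2.bounded_op_closed[OF TB]) auto
    also have "\<dots> = (\<Sum>i<m. \<Sum>j<m. ip K (?T (?t j)) (?t i))"
      by (rule sum.swap)
    also have "\<dots> = (\<Sum>i<m. \<Sum>j<m. ip E (ph_kernel (dilate r A) (\<sigma> i) (\<sigma> j) (h j)) (h i))"
      using \<sigma>h by (intro sum.cong refl entry) auto
    finally show "(\<Sum>i<m. \<Sum>j<m. ip E (ph_kernel (dilate r A) (\<sigma> i) (\<sigma> j) (h j)) (h i)) \<in> \<real>\<^sub>\<ge>\<^sub>0"
      using pos[OF u] by simp
  qed
qed

theorem theorem3p4:
  fixes E :: "'e hilbert" and ns :: "nat list" and A :: "'e coeffs"
  assumes "infinite (UNIV :: 'h set)"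
    and "hilbert_space E"
    and "ns \<noteq> []" and "\<forall>n\<in>set ns. n \<ge> 1"
    and "free_pluriharmonic TYPE('h) ns E A"
  shows "ph_positive TYPE('h) ns E A \<longleftrightarrow>
    (\<forall>r::real. 0 \<le> r \<and> r < 1 \<longrightarrow> psd_kernel ns E (ph_kernel (dilate r A)))"
  using positive_imp_psd_kernel[OF assms(1,2,5)] psd_kernel_imp_positive[OF assms(2,5)] by blast

end
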